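(* Every semifaithful CP-semigroup $T$ on a unital $C^*$-algebra $\mathcal{B}$ admits an elementary dilation to $\mathcal{B}(H)$ for some Hilbert space $H$: there are an injective $*$-homomorphism $\varphi:\mathcal{B}\to\mathcal{B}(H)$ and a semigroup $(c_t)_{t\in\mathbb{R}_+}$ in $\mathcal{B}(H)$ with $\varphi(T_t(b))=c_t^*\varphi(b)c_t$ for all $b\in\mathcal{B}$, $t\in\mathbb{R}_+$. If moreover $T$ is strongly continuous, the semigroup $(c_t)$ can be chosen strongly continuous.
   Context: A CP-semigroup on $\mathcal{B}$ is a semigroup $T=(T_t)_{t\in\mathbb{R}_+}$ of completely positive maps on $\mathcal{B}$ (with $T_0=\mathrm{id}$). The GNS-correspondence of a CP-map $T_t$ is the (unique) correspondence $E_t$ over $\mathcal{B}$ (right Hilbert $\mathcal{B}$-module with nondegenerate left action by adjointable operators) containing a vector $\xi_t$ that generates $E_t$ as a correspondence and satisfies $\langle\xi_t,b\xi_t\rangle=T_t(b)$. $T_t$ is semifaithful if the left action of $\mathcal{B}$ on its GNS-correspondence is injective; $T$ is semifaithful if every $T_t$ is. $T$ is strongly continuous if $t\mapsto T_t(b)$ is norm continuous for each $b$; $(c_t)$ strongly continuous means in the strong operator topology. *)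

theory Defs
  imports "HOL-Analysis.Analysis"
begin

class unital_cstar_algebra = real_normed_algebra_1 + banach +
  fixes scaleC :: "complex \<Rightarrow> 'a \<Rightarrow> 'a"
    and cstar :: "'a \<Rightarrow> 'a"
  assumes scaleC_add_right: "scaleC c (x + y) = scaleC c x + scaleC c y"
    and scaleC_add_left: "scaleC (c + d) x = scaleC c x + scaleC d x"
    and scaleC_scaleC: "scaleC c (scaleC d x) = scaleC (c * d) x"
    and scaleC_one: "scaleC 1 x = x"
    and scaleR_scaleC: "scaleR r x = scaleC (complex_of_real r) x"
    and norm_scaleC: "norm (scaleC c x) = cmod c * norm x"
    and mult_scaleC_left: "scaleC c x * y = scaleC c (x * y)"
    and mult_scaleC_right: "x * scaleC c y = scaleC c (x * y)"
    and cstar_cstar: "cstar (cstar x) = x"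
    and cstar_add: "cstar (x + y) = cstar x + cstar y"
    and cstar_scaleC: "cstar (scaleC c x) = scaleC (cnj c) (cstar x)"
    and cstar_mult: "cstar (x * y) = cstar y * cstar x"
    and cstar_identity: "norm (cstar x * x) = (norm x)\<^sup>2"

definition clinear_map :: "('a::unital_cstar_algebra \<Rightarrow> 'b::unital_cstar_algebra) \<Rightarrow> bool" where
  "clinear_map T \<longleftrightarrow> (\<forall>x y. T (x + y) = T x + T y) \<and> (\<forall>c x. T (scaleC c x) = scaleC c (T x))"

text \<open>Positive elements of \<open>M_n(B)\<close> are exactly those of the form \<open>X*X\<close>, i.e.
  with entries \<open>\<Sum>k. (X k i)* (X k j)\<close>. \<open>T\<close> is completely positive iff every
  amplification \<open>T\<^sub>n\<close> maps positive matrices to positive matrices.\<close>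

definition completely_positive :: "('a::unital_cstar_algebra \<Rightarrow> 'a) \<Rightarrow> bool" where
  "completely_positive T \<longleftrightarrow> clinear_map T \<and>
     (\<forall>(n::nat) (X::nat \<Rightarrow> nat \<Rightarrow> 'a). \<exists>Y::nat \<Rightarrow> nat \<Rightarrow> 'a.
        \<forall>i<n. \<forall>j<n. (\<Sum>k<n. T (cstar (X k i) * X k j)) = (\<Sum>k<n. cstar (Y k i) * Y k j))"

definition cp_semigroup :: "(real \<Rightarrow> 'a::unital_cstar_algebra \<Rightarrow> 'a) \<Rightarrow> bool" where
  "cp_semigroup T \<longleftrightarrow> (\<forall>t\<ge>0. completely_positive (T t)) \<and> T 0 = id \<and>
     (\<forall>s\<ge>0. \<forall>t\<ge>0. T (s + t) = T s \<circ> T t)"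

text \<open>The GNS-correspondence \<open>E\<close> of a CP-map \<open>T\<close> is the completion of the quotient of
  the algebraic tensor product \<open>B \<odot> B\<close> (elements written as finite sums
  \<open>\<Sum> a\<^sub>i \<xi> c\<^sub>i\<close>, here represented by lists of pairs \<open>(a\<^sub>i, c\<^sub>i)\<close>) by the null
  vectors of the semi-inner product below; \<open>\<xi> = 1 \<xi> 1\<close>, \<open>b\<close> acts from the left
  by \<open>b (a \<xi> c) = (b a) \<xi> c\<close>. An element \<open>b\<close> acts as zero on \<open>E\<close> iff it maps
  every element of the dense subspace to a null vector.\<close>

definition gns_inner :: "('a::unital_cstar_algebra \<Rightarrow> 'a) \<Rightarrow> ('a \<times> 'a) list \<Rightarrow> ('a \<times> 'a) list \<Rightarrow> 'a" where
  "gns_inner T xs ys = (\<Sum>p\<leftarrow>xs. \<Sum>q\<leftarrow>ys. cstar (snd p) * T (cstar (fst p) * fst q) * snd q)"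

definition gns_left_action :: "'a::unital_cstar_algebra \<Rightarrow> ('a \<times> 'a) list \<Rightarrow> ('a \<times> 'a) list" where
  "gns_left_action b xs = map (\<lambda>(a, c). (b * a, c)) xs"

definition semifaithful_map :: "('a::unital_cstar_algebra \<Rightarrow> 'a) \<Rightarrow> bool" where
  "semifaithful_map T \<longleftrightarrow>
     (\<forall>b. (\<forall>xs. gns_inner T (gns_left_action b xs) (gns_left_action b xs) = 0) \<longrightarrow> b = 0)"

definition semifaithful :: "(real \<Rightarrow> 'a::unital_cstar_algebra \<Rightarrow> 'a) \<Rightarrow> bool" where
  "semifaithful T \<longleftrightarrow> (\<forall>t\<ge>0. semifaithful_map (T t))"

definition strongly_continuous_sg :: "(real \<Rightarrow> 'a::unital_cstar_algebra \<Rightarrow> 'a) \<Rightarrow> bool" where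
  "strongly_continuous_sg T \<longleftrightarrow> (\<forall>b. continuous_on {0..} (\<lambda>t. T t b))"

text \<open>Every Hilbert space is unitarily isomorphic to \<open>\<ell>\<^sup>2(I)\<close> for some index set \<open>I\<close>.
  Vectors are functions \<open>I \<Rightarrow> \<complex>\<close> vanishing off \<open>I\<close> and square summable.
  Operators are represented by functions on these vectors; operator identities are
  understood on \<open>\<ell>\<^sup>2(I)\<close>.\<close>

definition l2 :: "'i set \<Rightarrow> ('i \<Rightarrow> complex) set" where
  "l2 I = {f. (\<forall>i. i \<notin> I \<longrightarrow> f i = 0) \<and> (\<lambda>i. (cmod (f i))\<^sup>2) summable_on I}"

definition l2_inner :: "'i set \<Rightarrow> ('i \<Rightarrow> complex) \<Rightarrow> ('i \<Rightarrow> complex) \<Rightarrow> complex" where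
  "l2_inner I f g = infsum (\<lambda>i. cnj (f i) * g i) I"

definition l2_norm :: "'i set \<Rightarrow> ('i \<Rightarrow> complex) \<Rightarrow> real" where
  "l2_norm I f = sqrt (infsum (\<lambda>i. (cmod (f i))\<^sup>2) I)"

definition bounded_op :: "'i set \<Rightarrow> (('i \<Rightarrow> complex) \<Rightarrow> ('i \<Rightarrow> complex)) \<Rightarrow> bool" where
  "bounded_op I A \<longleftrightarrow> (\<forall>f\<in>l2 I. A f \<in> l2 I) \<and>
     (\<forall>f\<in>l2 I. \<forall>g\<in>l2 I. \<forall>c d. A (\<lambda>i. c * f i + d * g i) = (\<lambda>i. c * A f i + d * A g i)) \<and>
     (\<exists>K. \<forall>f\<in>l2 I. l2_norm I (A f) \<le> K * l2_norm I f)"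

definition is_adjoint :: "'i set \<Rightarrow> (('i \<Rightarrow> complex) \<Rightarrow> ('i \<Rightarrow> complex)) \<Rightarrow> (('i \<Rightarrow> complex) \<Rightarrow> ('i \<Rightarrow> complex)) \<Rightarrow> bool" where
  "is_adjoint I A B \<longleftrightarrow> bounded_op I A \<and> bounded_op I B \<and>
     (\<forall>f\<in>l2 I. \<forall>g\<in>l2 I. l2_inner I (A f) g = l2_inner I f (B g))"

definition injective_star_hom ::
  "'i set \<Rightarrow> ('a::unital_cstar_algebra \<Rightarrow> ('i \<Rightarrow> complex) \<Rightarrow> ('i \<Rightarrow> complex)) \<Rightarrow> bool" where
  "injective_star_hom I \<phi> \<longleftrightarrow>
     (\<forall>a. bounded_op I (\<phi> a)) \<and>
     (\<forall>a b. \<forall>f\<in>l2 I. \<phi> (a + b) f = (\<lambda>i. \<phi> a f i + \<phi> b f i)) \<and>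
     (\<forall>c a. \<forall>f\<in>l2 I. \<phi> (scaleC c a) f = (\<lambda>i. c * \<phi> a f i)) \<and>
     (\<forall>a b. \<forall>f\<in>l2 I. \<phi> (a * b) f = \<phi> a (\<phi> b f)) \<and>
     (\<forall>a. is_adjoint I (\<phi> a) (\<phi> (cstar a))) \<and>
     (\<forall>a. (\<forall>f\<in>l2 I. \<phi> a f = (\<lambda>i. 0)) \<longrightarrow> a = 0)"

definition op_semigroup :: "'i set \<Rightarrow> (real \<Rightarrow> ('i \<Rightarrow> complex) \<Rightarrow> ('i \<Rightarrow> complex)) \<Rightarrow> bool" where
  "op_semigroup I c \<longleftrightarrow> (\<forall>t\<ge>0. bounded_op I (c t)) \<and> (\<forall>f\<in>l2 I. c 0 f = f) \<and>
     (\<forall>s\<ge>0. \<forall>t\<ge>0. \<forall>f\<in>l2 I. c (s + t) f = c s (c t f))"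

definition strongly_continuous_op_sg :: "'i set \<Rightarrow> (real \<Rightarrow> ('i \<Rightarrow> complex) \<Rightarrow> ('i \<Rightarrow> complex)) \<Rightarrow> bool" where
  "strongly_continuous_op_sg I c \<longleftrightarrow>
     (\<forall>f\<in>l2 I. \<forall>t\<ge>0. ((\<lambda>s. l2_norm I (\<lambda>i. c s f i - c t f i)) \<longlongrightarrow> 0) (at t within {0..}))"

definition elementary_dilation ::
  "(real \<Rightarrow> 'a::unital_cstar_algebra \<Rightarrow> 'a) \<Rightarrow> 'i set \<Rightarrow> ('a \<Rightarrow> ('i \<Rightarrow> complex) \<Rightarrow> ('i \<Rightarrow> complex))
     \<Rightarrow> (real \<Rightarrow> ('i \<Rightarrow> complex) \<Rightarrow> ('i \<Rightarrow> complex)) \<Rightarrow> bool" where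
  "elementary_dilation T I \<phi> c \<longleftrightarrow> injective_star_hom I \<phi> \<and> op_semigroup I c \<and>
     (\<forall>t\<ge>0. \<exists>cs. is_adjoint I (c t) cs \<and>
        (\<forall>b. \<forall>f\<in>l2 I. \<phi> (T t b) f = cs (\<phi> b (c t f))))"

end

theory Submission
  imports Defs
begin

text \<open>
  The dilation lives on a continuous Fock space. Let \<open>E\<^sub>s\<close> be the product system generated by the
  GNS-correspondences of the \<open>T\<^sub>t\<close>, with unit \<open>\<xi>\<^sub>t\<close>, and let \<open>H\<close> be the direct sum over all positive
  functionals \<open>\<omega>\<close> of the spaces of square integrable sections \<open>s \<mapsto> E\<^sub>s \<otimes> H\<^sub>\<omega>\<close>, \<open>s \<ge> 0\<close>. The algebra acts from the
  left, and \<open>c\<^sub>t\<close> is the translation \<open>(c\<^sub>t x)(s) = \<xi>\<^sub>t \<otimes> x(s - t)\<close>. Then \<open>\<langle>c\<^sub>t x, b c\<^sub>t y\<rangle> = \<langle>x, T\<^sub>t(b) y\<rangle>\<close>,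
  and the representation is faithful because \<open>T\<^sub>0\<close> is the identity. Integration over \<open>s\<close> is with respect
  to Lebesgue measure if \<open>T\<close> is strongly continuous, and to counting measure otherwise.
\<close>

section \<open>Positive elements and positive functionals\<close>

text \<open>An operator \<open>c t\<close> has to act within one Hilbert space, whereas tensoring
  with \<xi>_t leads from time s to time s + t; collecting all times in one space absorbs this
  shift. The two measures answer conflicting demands. For counting measure no regularity in time is
  required, but sections at different times are orthogonal, so translations are not strongly
  continuous. For Lebesgue measure translations are continuous, but inner products must depend
  measurably on time, which continuity of \<open>T\<close> provides; time 0 is then a null set, and
  faithfulness comes from \<omega>(T_s(x^* x)) staying away from 0 for small s. No tensor product or
  quotient is formed. All data sit in one scalar positive definite kernel on generators (a
  functional, a word, an interval). Vectors are Cauchy sequences of formal combinations, and vector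
  identities hold up to null vectors. Coordinates are taken once, at the end: the orthonormal basis
  has to be indexed inside the type \<open>real => 'a => 'a\<close>, so it is injected into pairs of
  a generator and a natural number, and these are coded as functions.\<close>

text \<open>Positivity is expressed through the norm, so that no spectral theory is required: a self-adjoint
  \<open>a\<close> is positive iff \<open>\<parallel>r - a\<parallel> \<le> r\<close> for some \<open>r\<close>. Square roots come from the iteration
  \<open>w \<mapsto> (z + w\<^sup>2) / 2\<close>, whose fixed point satisfies \<open>(1 - w)\<^sup>2 = 1 - z\<close>; it is dominated by the same
  iteration for \<open>z = 1\<close> in the reals.\<close>

lemma cstar_one [simp]: "cstar (1::'a::unital_cstar_algebra) = 1"
  by (metis cstar_cstar cstar_mult mult.right_neutral)

lemma cstar_scaleR: "cstar (r *\<^sub>R x) = r *\<^sub>R cstar (x::'a::unital_cstar_algebra)"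
  by (simp add: scaleR_scaleC cstar_scaleC)

lemma norm_cstar [simp]: "norm (cstar x) = norm (x::'a::unital_cstar_algebra)"
proof -
  have le: "norm (y::'a) \<le> norm (cstar y)" for y
  proof (cases "y = 0")
    case False
    have "norm y * norm y \<le> norm (cstar y) * norm y"
      using norm_mult_ineq[of "cstar y" y] cstar_identity[of y] by (simp add: power2_eq_square)
    then show ?thesis using False by simp
  qed simp
  show ?thesis using le[of x] le[of "cstar x"] by (simp add: cstar_cstar)
qed

lemma linear_cstar: "linear (cstar :: 'a::unital_cstar_algebra \<Rightarrow> 'a)"
  by (rule linearI) (simp_all add: cstar_add cstar_scaleR)

lemma cstar_diff: "cstar (x - y) = cstar x - cstar (y::'a::unital_cstar_algebra)"
  by (rule linear_diff[OF linear_cstar])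

lemma cstar_minus: "cstar (- x) = - cstar (x::'a::unital_cstar_algebra)"
  by (rule linear_neg[OF linear_cstar])

lemma cstar_zero [simp]: "cstar (0::'a::unital_cstar_algebra) = 0"
  by (rule linear_0[OF linear_cstar])

lemma cstar_sum: "cstar (sum f A) = (\<Sum>i\<in>A. cstar (f i :: 'a::unital_cstar_algebra))"
  by (rule linear_sum[OF linear_cstar])

lemma bounded_linear_cstar: "bounded_linear (cstar :: 'a::unital_cstar_algebra \<Rightarrow> 'a)"
  by (rule bounded_linear_intro[where K=1]) (simp_all add: cstar_add cstar_scaleR)

lemma linear_scaleC: "linear (scaleC c :: 'a::unital_cstar_algebra \<Rightarrow> 'a)"
  by (rule linearI) (simp_all add: scaleC_add_right scaleR_scaleC scaleC_scaleC mult.commute)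

lemmas scaleC_diff_right = linear_diff[OF linear_scaleC]

lemma scaleC_minus_one: "scaleC (-1) (x::'a::unital_cstar_algebra) = - x"
  using scaleR_scaleC[of "-1" x] by simp

lemma cstar_mult_self_eq_0: "cstar x * x = 0 \<longleftrightarrow> x = (0::'a::unital_cstar_algebra)"
  by (metis cstar_identity mult_zero_right norm_eq_zero power_eq_0_iff zero_neq_numeral)

lemma norm_square_sa: "cstar h = h \<Longrightarrow> norm (h * h) = (norm (h::'a::unital_cstar_algebra))\<^sup>2"
  using cstar_identity[of h] by simp

lemma square_sa_eq_0: "cstar h = h \<Longrightarrow> h * h = 0 \<longleftrightarrow> h = (0::'a::unital_cstar_algebra)"
  using cstar_mult_self_eq_0[of h] by simp

section \<open>Square roots by iteration\<close>

fun sqrt_iter :: "'a::real_normed_algebra_1 \<Rightarrow> nat \<Rightarrow> 'a" where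
  "sqrt_iter z 0 = 0"
| "sqrt_iter z (Suc n) = (1/2) *\<^sub>R (z + sqrt_iter z n * sqrt_iter z n)"

lemma sqrt_iter_commute: "x * z = z * x \<Longrightarrow> x * sqrt_iter z n = sqrt_iter z n * x"
proof (induction n)
  case (Suc n)
  have "x * (sqrt_iter z n * sqrt_iter z n) = sqrt_iter z n * sqrt_iter z n * x"
    using Suc by (metis mult.assoc)
  then show ?case using Suc by (simp add: algebra_simps)
qed simp

lemma sqrt_iter_one_le: "0 \<le> sqrt_iter (1::real) n \<and> sqrt_iter (1::real) n \<le> 1"
proof (induction n)
  case (Suc n)
  then have "sqrt_iter (1::real) n * sqrt_iter 1 n \<le> 1" by (simp add: mult_le_one)
  with Suc show ?case by simp
qed simp

lemma sqrt_iter_norm_le: "norm z \<le> 1 \<Longrightarrow> norm (sqrt_iter z n) \<le> sqrt_iter (1::real) n"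
proof (induction n)
  case (Suc n)
  have "norm (sqrt_iter z n * sqrt_iter z n) \<le> sqrt_iter 1 n * sqrt_iter (1::real) n"
    using Suc by (meson mult_mono norm_ge_zero norm_mult_ineq order_trans sqrt_iter_one_le)
  then show ?case using Suc norm_triangle_ineq[of z "sqrt_iter z n * sqrt_iter z n"] by simp
qed simp

text \<open>The iterates commute with each other, so a difference of squares factors and each
  increment is half of the previous increment times a sum of iterates. The same recursion holds with
  equality for z = 1 in the reals, which therefore majorizes it.\<close>

lemma sqrt_iter_step:
  assumes "norm z \<le> 1"
  shows "norm (sqrt_iter z (Suc n) - sqrt_iter z n) \<le> sqrt_iter (1::real) (Suc n) - sqrt_iter 1 n"
proof (induction n)
  case 0
  then show ?case using assms by simp
next
  case (Suc n)
  let ?w = "sqrt_iter z" and ?r = "sqrt_iter (1::real)"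
  have c: "?w (Suc n) * ?w n = ?w n * ?w (Suc n)"
    by (rule sqrt_iter_commute) (rule sqrt_iter_commute[symmetric], simp)
  have "?w (Suc (Suc n)) - ?w (Suc n)
      = (1/2) *\<^sub>R (?w (Suc n) * ?w (Suc n) - ?w n * ?w n)"
    by (subst (1 2) sqrt_iter.simps(2)) (simp add: scaleR_diff_right[symmetric] del: sqrt_iter.simps)
  also have "\<dots> = (1/2) *\<^sub>R ((?w (Suc n) - ?w n) * (?w (Suc n) + ?w n))"
    using c by (simp add: algebra_simps del: sqrt_iter.simps)
  finally have e: "?w (Suc (Suc n)) - ?w (Suc n) = (1/2) *\<^sub>R ((?w (Suc n) - ?w n) * (?w (Suc n) + ?w n))" .
  have "norm ((?w (Suc n) - ?w n) * (?w (Suc n) + ?w n))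
      \<le> (?r (Suc n) - ?r n) * (?r (Suc n) + ?r n)"
  proof (rule order_trans[OF norm_mult_ineq], rule mult_mono)
    show "norm (?w (Suc n) + ?w n) \<le> ?r (Suc n) + ?r n"
      by (rule order_trans[OF norm_triangle_ineq])
        (intro add_mono sqrt_iter_norm_le assms)
    show "0 \<le> ?r (Suc n) - ?r n" using order_trans[OF norm_ge_zero Suc] .
  qed (use Suc in auto)
  moreover have "?r (Suc (Suc n)) - ?r (Suc n) = (1/2) * ((?r (Suc n) - ?r n) * (?r (Suc n) + ?r n))"
    by (subst (1 2) sqrt_iter.simps(2)) (simp add: algebra_simps del: sqrt_iter.simps)
  ultimately show ?case unfolding e by (simp del: sqrt_iter.simps)
qed

lemma sqrt_iter_dist:
  assumes "norm z \<le> 1" "m \<le> n"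
  shows "norm (sqrt_iter z n - sqrt_iter z m) \<le> sqrt_iter (1::real) n - sqrt_iter 1 m"
  using assms(2)
proof (induction n rule: dec_induct)
  case (step n)
  have "norm (sqrt_iter z (Suc n) - sqrt_iter z m)
    \<le> norm (sqrt_iter z (Suc n) - sqrt_iter z n) + norm (sqrt_iter z n - sqrt_iter z m)"
    using norm_triangle_ineq[of "sqrt_iter z (Suc n) - sqrt_iter z n" "sqrt_iter z n - sqrt_iter z m"]
    by simp
  then show ?case using sqrt_iter_step[OF assms(1), of n] step by (simp del: sqrt_iter.simps)
qed simp

lemma sqrt_iter_Cauchy:
  assumes "norm (z::'a::real_normed_algebra_1) \<le> 1"
  shows "Cauchy (sqrt_iter z)"
proof -
  \<comment> \<open>The increments of the real iteration bound norms (take z = 1), hence are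
    nonnegative; being bounded by 1, the real iteration converges.\<close>
  have "incseq (sqrt_iter (1::real))"
    by (rule incseq_SucI) (use sqrt_iter_step[of "1::real"] in \<open>metis diff_ge_0_iff_ge norm_ge_zero norm_one order.refl order_trans\<close>)
  then have C: "Cauchy (sqrt_iter (1::real))"
    using sqrt_iter_one_le by (metis LIMSEQ_imp_Cauchy incseq_convergent)
  show ?thesis
  proof (rule metric_CauchyI)
    fix e :: real assume "e > 0"
    then obtain M where M: "\<And>m n. m \<ge> M \<Longrightarrow> n \<ge> M \<Longrightarrow> dist (sqrt_iter (1::real) m) (sqrt_iter 1 n) < e"
      using metric_CauchyD[OF C] by metis
    have "dist (sqrt_iter z m) (sqrt_iter z n) < e" if "M \<le> m" "m \<le> n" for m n
      using sqrt_iter_dist[OF assms that(2)] M[of n m] that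
      by (simp add: dist_norm norm_minus_commute)
    then show "\<exists>M. \<forall>m\<ge>M. \<forall>n\<ge>M. dist (sqrt_iter z m) (sqrt_iter z n) < e"
      by (metis dist_commute nat_le_linear)
  qed
qed

text \<open>All stated properties hold for each iterate and survive the limit. The commutation
  clause takes the place of a functional calculus: later roots of commuting elements have to
  commute.\<close>

lemma ex_sqrt_one_minus:
  assumes "norm (z::'a::unital_cstar_algebra) \<le> 1" "cstar z = z"
  shows "\<exists>w. (1 - w) * (1 - w) = 1 - z \<and> norm w \<le> 1 \<and> cstar w = w \<and>
           (\<forall>x. x * z = z * x \<longrightarrow> x * w = w * x)"
proof -
  obtain w where w: "sqrt_iter z \<longlonglongrightarrow> w"
    using Cauchy_convergent[OF sqrt_iter_Cauchy[OF assms(1)]] by (auto simp: convergent_def)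
  have "(\<lambda>n. (1/2) *\<^sub>R (z + sqrt_iter z n * sqrt_iter z n)) \<longlonglongrightarrow> (1/2) *\<^sub>R (z + w * w)"
    by (intro tendsto_intros w)
  then have "(\<lambda>n. sqrt_iter z (Suc n)) \<longlonglongrightarrow> (1/2) *\<^sub>R (z + w * w)" by simp
  moreover have "(\<lambda>n. sqrt_iter z (Suc n)) \<longlonglongrightarrow> w" using w by (rule LIMSEQ_Suc)
  ultimately have "w = (1/2) *\<^sub>R (z + w * w)" by (rule LIMSEQ_unique[rotated])
  then have "2 *\<^sub>R w = z + w * w" by (metis (no_types) divide_self_if mult.commute scaleR_one scaleR_scaleR times_divide_eq_left mult_1 zero_neq_numeral)
  then have e: "(1 - w) * (1 - w) = 1 - z" by (simp add: algebra_simps scaleR_2)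
  have "norm (sqrt_iter z n) \<le> 1" for n
    using sqrt_iter_norm_le[OF assms(1)] sqrt_iter_one_le order_trans by blast
  then have n: "norm w \<le> 1" by (intro LIMSEQ_le_const2[OF tendsto_norm[OF w]]) auto
  have "cstar (sqrt_iter z n) = sqrt_iter z n" for n
    by (induction n) (simp_all add: assms cstar_scaleR cstar_add cstar_mult)
  then have "sqrt_iter z \<longlonglongrightarrow> cstar w"
    using bounded_linear.tendsto[OF bounded_linear_cstar w] by simp
  then have s: "cstar w = w" using w LIMSEQ_unique by blast
  have "x * w = w * x" if "x * z = z * x" for x
  proof -
    have "(\<lambda>n. x * sqrt_iter z n) \<longlonglongrightarrow> x * w" by (intro tendsto_intros w)
    moreover have "(\<lambda>n. sqrt_iter z n * x) \<longlonglongrightarrow> w * x" by (intro tendsto_intros w)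
    ultimately show ?thesis using sqrt_iter_commute[OF that] LIMSEQ_unique by fastforce
  qed
  with e n s show ?thesis by blast
qed

section \<open>The positive cone and its norm estimates\<close>

definition pos :: "'a::unital_cstar_algebra \<Rightarrow> bool" where
  "pos a \<longleftrightarrow> cstar a = a \<and> (\<exists>r\<ge>0. norm (r *\<^sub>R 1 - a) \<le> r)"

lemma posI: "cstar a = a \<Longrightarrow> norm (r *\<^sub>R 1 - a) \<le> r \<Longrightarrow> pos a"
  unfolding pos_def using norm_ge_zero order_trans by blast

lemma pos_sa: "pos a \<Longrightarrow> cstar a = a" by (simp add: pos_def)

lemma pos_mono:
  assumes "norm (r *\<^sub>R 1 - a) \<le> r" "r \<le> s"
  shows "norm (s *\<^sub>R 1 - (a::'a::unital_cstar_algebra)) \<le> s"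
proof -
  have "s *\<^sub>R 1 - a = (s - r) *\<^sub>R 1 + (r *\<^sub>R 1 - a)" by (simp add: algebra_simps)
  then have "norm (s *\<^sub>R 1 - a) \<le> norm ((s - r) *\<^sub>R (1::'a)) + norm (r *\<^sub>R 1 - a)"
    by (metis norm_triangle_ineq)
  then show ?thesis using assms by simp
qed

lemma pos_add: assumes "pos a" "pos b" shows "pos (a + b)"
proof -
  obtain r s where *: "norm (r *\<^sub>R 1 - a) \<le> r" "norm (s *\<^sub>R 1 - b) \<le> s"
    using assms by (auto simp: pos_def)
  have "norm ((r + s) *\<^sub>R 1 - (a + b)) \<le> norm (r *\<^sub>R 1 - a) + norm (s *\<^sub>R 1 - b)"
    using norm_triangle_ineq[of "r *\<^sub>R 1 - a" "s *\<^sub>R 1 - b"] by (simp add: algebra_simps)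
  with * show ?thesis using assms by (intro posI[of _ "r+s"]) (auto simp: cstar_add pos_sa)
qed

lemma pos_scaleR: assumes "pos a" "c \<ge> 0" shows "pos (c *\<^sub>R a)"
proof -
  obtain r where *: "norm (r *\<^sub>R 1 - a) \<le> r" using assms by (auto simp: pos_def)
  have "norm ((c * r) *\<^sub>R 1 - c *\<^sub>R a) = c * norm (r *\<^sub>R 1 - a)"
    using assms(2) by (metis abs_of_nonneg norm_scaleR scaleR_diff_right scaleR_scaleR)
  with * show ?thesis using assms
    by (intro posI[of _ "c*r"]) (auto simp: cstar_scaleR pos_sa mult_left_mono)
qed

lemma pos_zero: "pos 0" by (rule posI[of _ 0]) auto

lemma pos_norm_diff:
  assumes "cstar a = a" "norm a \<le> r" shows "pos (r *\<^sub>R 1 - a)"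
  by (rule posI[of _ r]) (use assms in \<open>auto simp: cstar_diff cstar_scaleR\<close>)

lemma pos_sqrt:
  assumes "pos (a::'a::unital_cstar_algebra)"
  shows "\<exists>h. pos h \<and> h * h = a \<and> (\<forall>x. x * a = a * x \<longrightarrow> x * h = h * x)"
proof -
  obtain r0 where r0: "r0 \<ge> 0" "norm (r0 *\<^sub>R 1 - a) \<le> r0" using assms by (auto simp: pos_def)
  \<comment> \<open>A strictly larger radius still satisfies the norm criterion and makes division
    by \<open>r\<close> legitimate even if \<open>r0 = 0\<close>.\<close>
  define r where "r = r0 + 1"
  have r: "r > 0" "norm (r *\<^sub>R 1 - a) \<le> r" using r0 pos_mono[OF r0(2)] by (auto simp: r_def)
  define z where "z = 1 - (1/r) *\<^sub>R a"
  have "r *\<^sub>R z = r *\<^sub>R 1 - a" using r(1) by (simp add: z_def scaleR_diff_right)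
  then have "r * norm z \<le> r" using r by (metis abs_of_pos norm_scaleR)
  then have z1: "norm z \<le> 1" using r(1) by simp
  have zs: "cstar z = z" using pos_sa[OF assms] by (simp add: z_def cstar_diff cstar_scaleR)
  obtain w where w: "(1 - w) * (1 - w) = 1 - z" "norm w \<le> 1" "cstar w = w"
      "\<And>x. x * z = z * x \<Longrightarrow> x * w = w * x"
    using ex_sqrt_one_minus[OF z1 zs] by blast
  define h where "h = sqrt r *\<^sub>R (1 - w)"
  have "pos h"
  proof (rule posI[of _ "sqrt r"])
    show "cstar h = h" by (simp add: h_def cstar_scaleR cstar_diff w)
    have "sqrt r *\<^sub>R 1 - h = sqrt r *\<^sub>R w" by (simp add: h_def scaleR_diff_right)
    then show "norm (sqrt r *\<^sub>R 1 - h) \<le> sqrt r" using w(2) r(1) by (simp add: mult_left_le)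
  qed
  moreover have "h * h = a" using w(1) r(1) by (simp add: h_def z_def)
  moreover have "x * h = h * x" if "x * a = a * x" for x
    using w(4)[of x] that by (simp add: h_def z_def algebra_simps)
  ultimately show ?thesis by blast
qed

text \<open>The element u = h + i k is normal with u^* u = r^2, so its norm is r, and h is its real
  part.\<close>

lemma norm_of_sum_squares:
  assumes "cstar h = h" "cstar k = k" "h * k = k * h" "h * h + k * k = (r\<^sup>2) *\<^sub>R 1" "r \<ge> 0"
  shows "norm (h::'a::unital_cstar_algebra) \<le> r"
proof -
  define u where "u = h + scaleC \<i> k"
  have cu: "cstar u = h - scaleC \<i> k"
    using scaleC_scaleC[of "-1" \<i> k] by (simp add: u_def cstar_add cstar_scaleC assms scaleC_minus_one)
  have "cstar u * u = (r\<^sup>2) *\<^sub>R 1"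
    using assms(3,4) unfolding cu by (simp add: u_def algebra_simps mult_scaleC_left mult_scaleC_right scaleC_add_right scaleC_diff_right scaleC_scaleC scaleC_minus_one)
  then have nu: "norm u = r" using cstar_identity[of u] assms(5) by (simp add: power2_eq_iff_nonneg)
  have "2 *\<^sub>R h = u + cstar u" unfolding cu by (simp add: u_def scaleR_2)
  then have "2 * norm h \<le> norm u + norm (cstar u)"
    by (metis abs_numeral norm_scaleR norm_triangle_ineq)
  then show ?thesis by (simp add: nu)
qed

text \<open>With r the norm of h, the element r^2 - h^2 has a root k commuting with h. Now h^2 + k^2
  = r^2 bounds k by r, so r^2 - h^2 = k^2 has norm at most r^2, which is the positivity criterion
  for h^2.\<close>

lemma pos_square: assumes "cstar h = (h::'a::unital_cstar_algebra)" shows "pos (h * h)"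
proof -
  define r where "r = norm h"
  have "pos ((r\<^sup>2) *\<^sub>R 1 - h * h)"
    by (rule pos_norm_diff) (use assms in \<open>auto simp: cstar_mult norm_square_sa r_def\<close>)
  then obtain k where k: "pos k" "k * k = (r\<^sup>2) *\<^sub>R 1 - h * h"
      "\<And>x. x * ((r\<^sup>2) *\<^sub>R 1 - h * h) = ((r\<^sup>2) *\<^sub>R 1 - h * h) * x \<Longrightarrow> x * k = k * x"
    using pos_sqrt by blast
  have "norm k \<le> r"
    by (rule norm_of_sum_squares[of k h])
      (use k assms in \<open>auto simp: pos_sa r_def algebra_simps\<close>)
  then have "norm (k * k) \<le> r\<^sup>2"
    using norm_square_sa[OF pos_sa[OF k(1)]] by (simp add: power_mono)
  then show ?thesis using k(2) by (intro posI[of _ "r\<^sup>2"]) (auto simp: cstar_mult assms)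
qed

text \<open>The roots h of a and k of r - a commute and satisfy h^2 + k^2 = r, so h has norm at most
  the square root of r.\<close>

lemma pos_norm_le:
  assumes "pos a" "pos (r *\<^sub>R 1 - a)" "r \<ge> 0" shows "norm (a::'a::unital_cstar_algebra) \<le> r"
proof -
  obtain h where h: "pos h" "h * h = a" "\<And>x. x * a = a * x \<Longrightarrow> x * h = h * x" using pos_sqrt[OF assms(1)] by blast
  obtain k where k: "pos k" "k * k = r *\<^sub>R 1 - a"
      "\<And>x. x * (r *\<^sub>R 1 - a) = (r *\<^sub>R 1 - a) * x \<Longrightarrow> x * k = k * x" using pos_sqrt[OF assms(2)] by blast
  have "a * k = k * a" by (rule k(3)) (simp add: algebra_simps)
  then have "k * h = h * k" using h(3) by metis
  then have "norm h \<le> sqrt r" by (intro norm_of_sum_squares[of h k]) (use h(1,2) k(1,2) assms in \<open>simp_all add: pos_sa\<close>)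
  then have "norm h ^ 2 \<le> r" using assms(3) by (metis norm_ge_zero real_sqrt_abs real_sqrt_le_iff abs_of_nonneg)
  then show ?thesis using norm_square_sa[OF pos_sa[OF h(1)]] h(2) by simp
qed

section \<open>Invertibility, and positivity of \<open>cstar x * x\<close>\<close>

lemma neumann_inverse:
  assumes "norm (x::'a::unital_cstar_algebra) < 1"
  shows "\<exists>R. (1 - x) * R = 1 \<and> R * (1 - x) = 1"
proof -
  define R where "R = (\<Sum>n. x ^ n)"
  have S: "summable (\<lambda>n. x ^ n)" using assms by (rule complete_algebra_summable_geometric)
  have e: "R = 1 + (\<Sum>n. x ^ Suc n)"
    using suminf_split_head[OF S] by (simp add: R_def)
  have "(\<Sum>n. x ^ Suc n) = x * R"
    using suminf_mult[OF S, of x] by (simp add: R_def)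
  moreover have "(\<Sum>n. x ^ Suc n) = R * x"
    using suminf_mult2[OF S, of x] by (simp add: R_def power_commutes)
  ultimately show ?thesis using e by (intro exI[of _ R]) (simp add: algebra_simps)
qed

text \<open>Write 1 + a = (1 + r)(1 - x) with x = (r - a)/(1 + r); the positivity criterion makes
  the norm of x at most r/(1 + r) < 1.\<close>

lemma pos_one_plus_inverse:
  assumes "pos (a::'a::unital_cstar_algebra)"
  shows "\<exists>R. (1 + a) * R = 1 \<and> R * (1 + a) = 1"
proof -
  obtain r where r: "r \<ge> 0" "norm (r *\<^sub>R 1 - a) \<le> r" using assms by (auto simp: pos_def)
  define x where "x = (1 / (1 + r)) *\<^sub>R (r *\<^sub>R 1 - a)"
  have "norm x < 1" using r by (simp add: x_def divide_simps)
  then obtain R where R: "(1 - x) * R = 1" "R * (1 - x) = 1" using neumann_inverse by blast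
  have "1 - x = (1 / (1 + r)) *\<^sub>R (1 + a)"
  proof -
    have "(1 + r) *\<^sub>R (1 - x) = (1 + r) *\<^sub>R 1 - (r *\<^sub>R 1 - a)"
      using r by (simp add: x_def scaleR_diff_right)
    also have "\<dots> = 1 + a" by (simp add: algebra_simps)
    finally show ?thesis using r
      by (metis add_nonneg_pos divide_self_if less_irrefl nonzero_mult_div_cancel_left scaleR_one scaleR_scaleR times_divide_eq_left zero_less_one add.commute mult_1)
  qed
  then show ?thesis using R by (intro exI[of _ "(1 / (1 + r)) *\<^sub>R R"]) simp
qed

text \<open>The inverse of 1 + y x is 1 - y R x: away from 0, products taken in either order have
  the same spectrum.\<close>

lemma inverse_swap:
  assumes "(1 + x * y) * R = 1" "R * (1 + x * y) = (1::'a::ring_1)"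
  shows "\<exists>S. (1 + y * x) * S = 1 \<and> S * (1 + y * x) = 1"
proof (intro exI conjI)
  have "(1 + y * x) * (1 - y * R * x) = 1 + y * x - y * ((1 + x * y) * R) * x"
    by (simp add: algebra_simps)
  then show "(1 + y * x) * (1 - y * R * x) = 1" by (simp add: assms)
  have "(1 - y * R * x) * (1 + y * x) = 1 + y * x - y * (R * (1 + x * y)) * x"
    by (simp add: algebra_simps)
  then show "(1 - y * R * x) * (1 + y * x) = 1" by (simp add: assms)
qed

lemma inverse_commute:
  assumes "c * R = 1" "R * c = 1" "d * c = c * d" shows "d * R = R * (d::'a::ring_1)"
proof -
  have "d * R = R * (c * d) * R" by (metis assms(2) mult.assoc mult_1)
  also have "\<dots> = R * d" by (metis assms(1,3) mult.assoc mult_1_right)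
  finally show ?thesis .
qed

text \<open>The hypothesis excludes positive numbers from the spectrum, while the norm m of a
  positive element should lie in it. Without spectral theory: c = m - b is positive and invertible,
  hence c exceeds a constant \<delta> > 0, so b is at most m - \<delta>, which contradicts the
  choice of m.\<close>

lemma pos_eq_0_if_resolvent:
  assumes "pos (b::'a::unital_cstar_algebra)"
    and inv: "\<And>t. t \<ge> 0 \<Longrightarrow> \<exists>R. (1 - t *\<^sub>R b) * R = 1 \<and> R * (1 - t *\<^sub>R b) = 1"
  shows "b = 0"
proof (rule ccontr)
  assume "b \<noteq> 0"
  define m where "m = norm b"
  have m: "m > 0" using \<open>b \<noteq> 0\<close> by (simp add: m_def)
  define c where "c = m *\<^sub>R 1 - b"
  obtain R0 where R0: "(1 - (1/m) *\<^sub>R b) * R0 = 1" "R0 * (1 - (1/m) *\<^sub>R b) = 1"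
    using inv[of "1/m"] m by auto
  define R where "R = (1/m) *\<^sub>R R0"
  have cm: "c = m *\<^sub>R (1 - (1/m) *\<^sub>R b)" using m by (simp add: c_def scaleR_diff_right)
  have R: "c * R = 1" "R * c = 1" using R0 m by (simp_all add: cm R_def)
  have cs: "cstar c = c" by (simp add: c_def cstar_diff cstar_scaleR pos_sa[OF assms(1)])
  have "cstar R * c = 1" using arg_cong[OF R(1), of cstar] by (simp add: cstar_mult cs)
  then have Rs: "cstar R = R" using R(1) by (metis mult.assoc mult_1 mult_1_right)
  have "R \<noteq> 0" using R by auto
  \<comment> \<open>This makes 1 - \<delta> R positive. Multiplying by c, both through commuting
    square roots, shows that c - \<delta> is a square.\<close>
  define \<delta> where "\<delta> = 1 / norm R"
  have d0: "\<delta> > 0" using \<open>R \<noteq> 0\<close> by (simp add: \<delta>_def)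
  have "pos (1 *\<^sub>R 1 - \<delta> *\<^sub>R R)"
    by (rule pos_norm_diff) (use \<open>R \<noteq> 0\<close> in \<open>auto simp: Rs cstar_scaleR \<delta>_def\<close>)
  then obtain e where e: "pos e" "e * e = 1 - \<delta> *\<^sub>R R"
      "\<And>x. x * (1 - \<delta> *\<^sub>R R) = (1 - \<delta> *\<^sub>R R) * x \<Longrightarrow> x * e = e * x"
    using pos_sqrt[of "1 *\<^sub>R 1 - \<delta> *\<^sub>R R"] by (metis scaleR_one)
  have "pos c" unfolding c_def by (rule pos_norm_diff) (use assms pos_sa in \<open>auto simp: m_def\<close>)
  then obtain d where d: "pos d" "d * d = c" "\<And>x. x * c = c * x \<Longrightarrow> x * d = d * x"
    using pos_sqrt by blast
  have "d * c = c * d" using d(2) by (metis mult.assoc)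
  then have "d * R = R * d" using inverse_commute R by blast
  then have ed: "d * e = e * d" by (intro e(3)) (simp add: algebra_simps)
  have "(e * d) * (e * d) = e * (d * e) * d" by (simp add: mult.assoc)
  also have "\<dots> = (e * e) * (d * d)" unfolding ed by (simp add: mult.assoc)
  also have "\<dots> = c - \<delta> *\<^sub>R 1" unfolding d(2) e(2) using R by (simp add: algebra_simps)
  finally have 1: "(e * d) * (e * d) = (m - \<delta>) *\<^sub>R 1 - b" by (simp add: c_def algebra_simps)
  have "cstar (e * d) = e * d" by (simp add: cstar_mult pos_sa d e ed)
  then have "pos ((m - \<delta>) *\<^sub>R 1 - b)" using pos_square 1 by metis
  \<comment> \<open>\<open>pos_norm_le\<close> requires a nonnegative bound, and m - \<delta> might
    be negative.\<close>
  moreover have "pos ((max 0 (m - \<delta>) - (m - \<delta>)) *\<^sub>R (1::'a))"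
    by (rule pos_scaleR) (auto intro: posI[of _ 1])
  ultimately have "pos ((max 0 (m - \<delta>)) *\<^sub>R 1 - b)"
    using pos_add[of "(m - \<delta>) *\<^sub>R 1 - b" "(max 0 (m - \<delta>) - (m - \<delta>)) *\<^sub>R 1"] by (simp add: scaleR_diff_left)
  then have "norm b \<le> max 0 (m - \<delta>)" by (intro pos_norm_le assms) auto
  with m d0 show False by (simp add: m_def max_def split: if_splits)
qed

text \<open>With \<open>a = x\<^sup>* x\<close>, \<open>g = \<bar>a\<bar> - a\<close> and \<open>y = x g\<close>, the element \<open>- y\<^sup>* y\<close> is a square, hence \<open>y y\<^sup>*\<close>
  is positive, because \<open>y\<^sup>* y + y y\<^sup>*\<close> is a sum of squares. As \<open>1 + t y y\<^sup>*\<close> and \<open>1 + t y\<^sup>* y\<close> are invertible simultaneously, \<open>y = 0\<close>.\<close>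

lemma pos_cstar_mult: "pos (cstar x * (x::'a::unital_cstar_algebra))"
proof -
  define a where "a = cstar x * x"
  have as: "cstar a = a" by (simp add: a_def cstar_mult cstar_cstar)
  obtain v where v: "pos v" "v * v = a * a" "\<And>x. x * (a * a) = a * a * x \<Longrightarrow> x * v = v * x"
    using pos_sqrt[OF pos_square[OF as]] by blast
  obtain k where k: "pos k" "k * k = v" "\<And>x. x * v = v * x \<Longrightarrow> x * k = k * x"
    using pos_sqrt[OF v(1)] by blast
  have av: "a * v = v * a" by (rule v(3)) (simp add: mult.assoc)
  define g where "g = v - a"
  have gs: "cstar g = g" by (simp add: g_def cstar_diff as pos_sa v)
  have gk: "g * k = k * g" by (rule k(3)) (simp add: g_def algebra_simps av)
  define q where "q = g * k"
  have qs: "cstar q = q" by (simp add: q_def cstar_mult gs pos_sa k gk)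
  have gvg: "g * v * g = q * q" unfolding q_def by (subst k(2)[symmetric], subst (2) gk) (simp add: mult.assoc)
  \<comment> \<open>Since v commutes with a and v^2 = a^2, the product (v + a) g = v^2 - a^2
    vanishes.\<close>
  have "a * g = - (v * g)" using v(2) by (simp add: g_def algebra_simps av)
  then have gag: "g * a * g = - (q * q)" using gvg by (simp add: mult.assoc)
  define y where "y = x * g"
  have yy: "cstar y * y = - (q * q)"
    using gag by (simp add: y_def cstar_mult gs a_def mult.assoc)
  \<comment> \<open>Twice the real part of y and, up to sign, twice its imaginary part; in the sum
    of their squares the terms y y and its adjoint cancel.\<close>
  define p1 where "p1 = y + cstar y"
  define p2 where "p2 = scaleC \<i> (y - cstar y)"
  have ps: "cstar p1 = p1" "cstar p2 = p2"
    using scaleC_scaleC[of "-1" \<i> "cstar y - y"]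
    by (simp_all add: p1_def p2_def cstar_add cstar_diff cstar_cstar cstar_scaleC add.commute scaleC_minus_one scaleC_diff_right)
  have "p1 * p1 + p2 * p2 = 2 *\<^sub>R (y * cstar y + cstar y * y)"
    unfolding p1_def p2_def
    by (simp add: mult_scaleC_left mult_scaleC_right scaleC_scaleC scaleC_minus_one scaleC_diff_right scaleR_2 algebra_simps)
  then have "y * cstar y = (1/2) *\<^sub>R (p1 * p1 + p2 * p2) + q * q" by (simp add: yy)
  then have pyy: "pos (y * cstar y)"
    by (simp only:) (intro pos_add pos_scaleR pos_square ps qs, simp)
  have "q * q = 0"
  proof (rule pos_eq_0_if_resolvent[OF pos_square[OF qs]])
    fix t :: real assume "t \<ge> 0"
    then obtain R where "(1 + (t *\<^sub>R y) * cstar y) * R = 1" "R * (1 + (t *\<^sub>R y) * cstar y) = 1"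
      using pos_one_plus_inverse[OF pos_scaleR[OF pyy, of t]] by auto
    from inverse_swap[OF this]
    show "\<exists>R. (1 - t *\<^sub>R (q * q)) * R = 1 \<and> R * (1 - t *\<^sub>R (q * q)) = 1"
      by (simp add: yy)
  qed
  \<comment> \<open>Both terms equal q^2 up to sign, so g (v - a) g = g^3 vanishes; self-adjointness
    then gives g = 0, that is, a is its own absolute value.\<close>
  then have "g * v * g - g * a * g = 0" using gvg gag by simp
  then have "g * g * g = 0" by (simp add: g_def algebra_simps)
  then have "(g * g) * (g * g) = 0" by (simp add: mult.assoc)
  then have "g = 0" using square_sa_eq_0[of "g * g"] square_sa_eq_0[of g] gs by (simp add: cstar_mult)
  then show ?thesis using v(1) by (simp add: g_def a_def)
qed

section \<open>A Hahn-Banach theorem for sublinear functionals\<close>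

definition sublinear :: "('v::real_vector \<Rightarrow> real) \<Rightarrow> bool" where
  "sublinear p \<longleftrightarrow> (\<forall>x y. p (x + y) \<le> p x + p y) \<and> (\<forall>c\<ge>0. \<forall>x. p (c *\<^sub>R x) = c * p x)"

lemma sublinear_add: "sublinear p \<Longrightarrow> p (x + y) \<le> p x + p y"
  and sublinear_scale: "sublinear p \<Longrightarrow> c \<ge> 0 \<Longrightarrow> p (c *\<^sub>R x) = c * p x"
  and sublinear_zero: "sublinear p \<Longrightarrow> p 0 = 0"
  using sublinear_def[of p] by (auto dest: spec[of _ 0])

lemma sublinear_minus: assumes "sublinear p" shows "- p (- x) \<le> p x"
  using sublinear_add[OF assms, of x "- x"] sublinear_zero[OF assms] by simp

text \<open>Serves both infima of the Hahn-Banach argument, over a real parameter and over a chain.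
  The bound \<open>b\<close> keeps the real infima meaningful, and the inequality for scaling, used
  for c and 1/c, yields equality.\<close>

lemma sublinear_INF:
  assumes ne: "A \<noteq> {}"
    and bdd: "\<And>x i. i \<in> A \<Longrightarrow> b x \<le> q i x"
    and add: "\<And>x y i j. i \<in> A \<Longrightarrow> j \<in> A \<Longrightarrow> \<exists>k\<in>A. q k (x + y) \<le> q i x + q j y"
    and scale: "\<And>x c i. i \<in> A \<Longrightarrow> c > 0 \<Longrightarrow> \<exists>j\<in>A. q j (c *\<^sub>R x) \<le> c * q i x"
    and zero: "(INF i\<in>A. q i 0) = 0"
  shows "sublinear (\<lambda>x. INF i\<in>A. q i x :: real)"
proof -
  have B: "bdd_below ((\<lambda>i. q i x) ` A)" for x using bdd by (intro bdd_belowI2)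
  have le: "(INF i\<in>A. q i x) \<le> q i x" if "i \<in> A" for i x using B that by (rule cINF_lower)
  have sc: "(INF i\<in>A. q i (c *\<^sub>R x)) \<le> c * (INF i\<in>A. q i x)" if "c > 0" for c x
  proof -
    have "(INF i\<in>A. q i (c *\<^sub>R x)) / c \<le> (INF i\<in>A. q i x)"
    proof (rule cINF_greatest[OF ne])
      fix i assume "i \<in> A"
      then obtain j where "j \<in> A" "q j (c *\<^sub>R x) \<le> c * q i x" using scale \<open>c > 0\<close> by blast
      then show "(INF i\<in>A. q i (c *\<^sub>R x)) / c \<le> q i x"
        using le[of j "c *\<^sub>R x"] \<open>c > 0\<close> by (simp add: divide_simps mult.commute)
    qed
    then show ?thesis using \<open>c > 0\<close> by (simp add: divide_simps mult.commute)
  qed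
  show ?thesis unfolding sublinear_def
  proof (intro conjI allI impI)
    fix x y
    have "(INF i\<in>A. q i (x + y)) - (INF i\<in>A. q i y) \<le> (INF i\<in>A. q i x)"
    proof (rule cINF_greatest[OF ne])
      fix i assume i: "i \<in> A"
      have "(INF i\<in>A. q i (x + y)) - q i x \<le> (INF i\<in>A. q i y)"
      proof (rule cINF_greatest[OF ne])
        fix j assume "j \<in> A"
        then obtain k where "k \<in> A" "q k (x + y) \<le> q i x + q j y" using add i by blast
        then show "(INF i\<in>A. q i (x + y)) - q i x \<le> q j y" using le[of k "x + y"] by simp
      qed
      then show "(INF i\<in>A. q i (x + y)) - (INF i\<in>A. q i y) \<le> q i x" by simp
    qed
    then show "(INF i\<in>A. q i (x + y)) \<le> (INF i\<in>A. q i x) + (INF i\<in>A. q i y)" by simp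
  next
    fix c :: real and x assume "c \<ge> 0"
    show "(INF i\<in>A. q i (c *\<^sub>R x)) = c * (INF i\<in>A. q i x)"
    proof (cases "c = 0")
      case True then show ?thesis using zero by simp
    next
      case False
      then have "c > 0" using \<open>c \<ge> 0\<close> by simp
      have "(INF i\<in>A. q i x) \<le> (1/c) * (INF i\<in>A. q i (c *\<^sub>R x))"
        using sc[of "1/c" "c *\<^sub>R x"] \<open>c > 0\<close> by simp
      then show ?thesis using sc[OF \<open>c > 0\<close>, of x] \<open>c > 0\<close> by (simp add: divide_simps mult.commute)
    qed
  qed
qed

text \<open>The infimum lies below p (t = 0) and sends -x to at most -p(x) (t = 1). A minimal
  sublinear functional must coincide with all its shifts, and this forces additivity.\<close>

lemma sublinear_shift:
  assumes p: "sublinear p"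
  shows "sublinear (\<lambda>y. INF t\<in>{0..}. p (y + t *\<^sub>R x) - t * p x)" (is "sublinear ?q")
    and "t \<ge> 0 \<Longrightarrow> (INF t\<in>{0..}. p (y + t *\<^sub>R x) - t * p x) \<le> p (y + t *\<^sub>R x) - t * p x"
proof -
  have b: "- p (- y) \<le> p (y + t *\<^sub>R x) - t * p x" if "t \<in> {0..}" for y t
    using sublinear_add[OF p, of "y + t *\<^sub>R x" "- y"] sublinear_scale[OF p, of t x] that by simp
  show "sublinear ?q"
  proof (rule sublinear_INF[where b = "\<lambda>y. - p (- y)"])
    show "{0::real..} \<noteq> {}" by auto
    show "- p (- y) \<le> p (y + t *\<^sub>R x) - t * p x" if "t \<in> {0..}" for y t using b that .
    show "\<exists>k\<in>{0..}. p (y + z + k *\<^sub>R x) - k * p x \<le> (p (y + i *\<^sub>R x) - i * p x) + (p (z + j *\<^sub>R x) - j * p x)"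
      if "i \<in> {0..}" "j \<in> {0..}" for y z i j
      using that sublinear_add[OF p, of "y + i *\<^sub>R x" "z + j *\<^sub>R x"]
      by (intro bexI[of _ "i + j"]) (auto simp: algebra_simps)
    show "\<exists>j\<in>{0..}. p (c *\<^sub>R y + j *\<^sub>R x) - j * p x \<le> c * (p (y + i *\<^sub>R x) - i * p x)"
      if "i \<in> {0..}" "c > 0" for y c i
      using that sublinear_scale[OF p, of c "y + i *\<^sub>R x"]
      by (intro bexI[of _ "c * i"]) (auto simp: algebra_simps)
    have "p (0 + t *\<^sub>R x) - t * p x = 0" if "t \<in> {0..}" for t
      using sublinear_scale[OF p, of t x] that by simp
    then have "(\<lambda>t. p (0 + t *\<^sub>R x) - t * p x) ` {0..} = {0}" by (force simp: image_def)
    then show "(INF t\<in>{0..}. p (0 + t *\<^sub>R x) - t * p x) = 0" by simp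
  qed
  show "?q y \<le> p (y + t *\<^sub>R x) - t * p x" if "t \<ge> 0"
    by (rule cINF_lower) (use b that in \<open>auto intro!: bdd_belowI2\<close>)
qed

lemma ex_minimal_sublinear:
  assumes p: "sublinear p"
  shows "\<exists>m. sublinear m \<and> m \<le> p \<and> (\<forall>q. sublinear q \<longrightarrow> q \<le> m \<longrightarrow> q = m)"
proof -
  define A where "A = {q. sublinear q \<and> q \<le> p}"
  \<comment> \<open>The order is reversed, so that the maximal element delivered by Zorn's lemma is
    a minimal functional.\<close>
  define P where "P = (\<lambda>q q' :: 'a \<Rightarrow> real. q' \<le> q)"
  have "\<exists>m\<in>A. \<forall>a\<in>A. P m a \<longrightarrow> a = m"
  proof (rule predicate_Zorn)
    show "partial_order_on A (relation_of P A)"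
      by (rule partial_order_on_relation_ofI) (auto simp: P_def intro: order_trans)
    fix C assume C: "C \<in> Chains (relation_of P A)"
    then have CA: "C \<subseteq> A" by (auto simp: Chains_def relation_of_def)
    show "\<exists>u\<in>A. \<forall>a\<in>C. P a u"
    proof (cases "C = {}")
      case True then show ?thesis using p by (intro bexI[of _ p]) (auto simp: A_def)
    next
      case False
      \<comment> \<open>Every sublinear functional below p is at least -p(-x), so the pointwise
        infimum of a chain is finite.\<close>
      have b: "- p (- x) \<le> q x" if "q \<in> C" for q x
      proof -
        have "sublinear q" "q (- x) \<le> p (- x)" using CA that by (auto simp: A_def le_fun_def)
        then show ?thesis using sublinear_minus[of q x] by linarith
      qed
      have le: "(INF q\<in>C. q x) \<le> q x" if "q \<in> C" for q x
        by (rule cINF_lower) (use b that in \<open>auto intro!: bdd_belowI2\<close>)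
      have "sublinear (\<lambda>x. INF q\<in>C. q x)"
      proof (rule sublinear_INF[where b = "\<lambda>x. - p (- x)" and q = "\<lambda>q. q"])
        show "\<exists>k\<in>C. k (x + y) \<le> i x + j y" if "i \<in> C" "j \<in> C" for x y i j
        proof -
          have "P i j \<or> P j i" using C that by (auto simp: Chains_def relation_of_def)
          then obtain k where k: "k \<in> C" "k \<le> i" "k \<le> j" using \<open>i \<in> C\<close> \<open>j \<in> C\<close> unfolding P_def by (metis order_refl)
          then have "sublinear k" using CA by (auto simp: A_def)
          then have "k (x + y) \<le> k x + k y" by (rule sublinear_add)
          also have "\<dots> \<le> i x + j y" using k by (intro add_mono) (auto simp: le_fun_def)
          finally show ?thesis using k(1) by blast
        qed
        show "\<exists>j\<in>C. j (c *\<^sub>R x) \<le> c * i x" if "i \<in> C" "c > 0" for x c i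
          using that CA sublinear_scale[of i c x] by (intro bexI[of _ i]) (auto simp: A_def)
        have "(\<lambda>q. q 0) ` C = {0}" using False CA sublinear_zero by (force simp: A_def)
        then show "(INF q\<in>C. q 0) = 0" by simp
      qed (use False b in auto)
      moreover have "(\<lambda>x. INF q\<in>C. q x) \<le> p"
      proof (rule le_funI)
        fix x
        obtain q where "q \<in> C" using False by blast
        then show "(INF q\<in>C. q x) \<le> p x" using le[of q x] CA by (auto simp: A_def le_fun_def intro: order_trans)
      qed
      ultimately show ?thesis using le
        by (intro bexI[of _ "\<lambda>x. INF q\<in>C. q x"]) (auto simp: A_def P_def le_fun_def)
    qed
  qed
  then show ?thesis by (auto simp: A_def P_def)
qed

text \<open>A minimal sublinear functional is linear. It is taken below the shift \<open>p1\<close>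
  instead of p, because f(-x) is then at most -p(x), which gives f(x) = p(x).\<close>

theorem Hahn_Banach_sublinear:
  assumes p: "sublinear p"
  shows "\<exists>f. linear f \<and> (\<forall>y. f y \<le> p y) \<and> f x = (p x :: real)"
proof -
  define p1 where "p1 = (\<lambda>y. INF t\<in>{0..}. p (y + t *\<^sub>R x) - t * p x)"
  have p1: "sublinear p1" "p1 y \<le> p y" "p1 (- x) \<le> - p x" for y
    using sublinear_shift(1)[OF p, of x] sublinear_shift(2)[OF p, of 0 y x]
      sublinear_shift(2)[OF p, of 1 "- x" x] sublinear_zero[OF p] by (auto simp: p1_def)
  obtain f where f: "sublinear f" "f \<le> p1" "\<And>q. sublinear q \<Longrightarrow> q \<le> f \<Longrightarrow> q = f"
    using ex_minimal_sublinear[OF p1(1)] by blast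
  have add: "f (y + z) = f y + f z" for y z
  proof (rule antisym)
    define q where "q = (\<lambda>y. INF t\<in>{0..}. f (y + t *\<^sub>R z) - t * f z)"
    have "q \<le> f" using sublinear_shift(2)[OF f(1), of 0 _ z] by (auto simp: q_def le_fun_def)
    then have "q = f" using f(3) sublinear_shift(1)[OF f(1), of z] by (auto simp: q_def)
    moreover have "q y \<le> f (y + z) - f z" using sublinear_shift(2)[OF f(1), of 1 y z] by (simp add: q_def)
    ultimately show "f y + f z \<le> f (y + z)" by simp
  qed (rule sublinear_add[OF f(1)])
  have neg: "f (- y) = - f y" for y using add[of y "- y"] sublinear_zero[OF f(1)] by simp
  have "f (c *\<^sub>R y) = c * f y" for c y
    using sublinear_scale[OF f(1), of c y] sublinear_scale[OF f(1), of "- c" y] neg[of "c *\<^sub>R y"]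
    by (cases "c \<ge> 0") auto
  then have "linear f" by (intro linearI) (auto simp: add)
  moreover have le: "f y \<le> p y" for y using f(2) p1(2) by (meson le_fun_def order_trans)
  moreover have "p x \<le> f x" using neg[of x] p1(3) f(2) by (auto simp: le_fun_def dest: spec[of _ "- x"])
  ultimately show ?thesis by (intro exI[of _ f]) (auto intro: antisym)
qed

section \<open>Separation of points by positive functionals\<close>

definition pos_functional :: "('a::unital_cstar_algebra \<Rightarrow> complex) \<Rightarrow> bool" where
  "pos_functional \<omega> \<longleftrightarrow> (\<forall>x y. \<omega> (x + y) = \<omega> x + \<omega> y) \<and> (\<forall>c x. \<omega> (scaleC c x) = c * \<omega> x) \<and>
     (\<forall>x. \<exists>r\<ge>0. \<omega> (cstar x * x) = complex_of_real r) \<and> (\<exists>C. \<forall>x. cmod (\<omega> x) \<le> C * norm x)"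

lemma pos_scaleR_one_nonneg: "pos (s *\<^sub>R (1::'a::unital_cstar_algebra)) \<Longrightarrow> s \<ge> 0"
proof -
  assume "pos (s *\<^sub>R (1::'a))"
  then obtain r where "r \<ge> 0" "norm (r *\<^sub>R 1 - s *\<^sub>R (1::'a)) \<le> r" by (auto simp: pos_def)
  then have "\<bar>r - s\<bar> \<le> r" by (metis norm_one norm_scaleR mult_1_right scaleR_diff_left)
  then show ?thesis by simp
qed

definition re_part :: "'a::unital_cstar_algebra \<Rightarrow> 'a" where "re_part x = (1/2) *\<^sub>R (x + cstar x)"

text \<open>This is the largest spectral value of the real part of y. A linear functional dominated
  by it is automatically positive, which is why Hahn-Banach is applied to it and not to the
  norm.\<close>

definition upper_bound :: "'a::unital_cstar_algebra \<Rightarrow> real" where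
  "upper_bound y = Inf {r. pos (r *\<^sub>R 1 - re_part y)}"

lemma re_part: "re_part (x + y) = re_part x + re_part y" "re_part (c *\<^sub>R x) = c *\<^sub>R re_part x"
  "cstar (re_part x) = re_part x" "norm (re_part x) \<le> norm x"
proof -
  show "norm (re_part x) \<le> norm x"
    using norm_triangle_ineq[of x "cstar x"] by (simp add: re_part_def)
qed (simp_all add: re_part_def scaleR_add_right cstar_add cstar_scaleR cstar_cstar add.commute add.left_commute mult.commute)

lemma re_part_sa: "cstar x = x \<Longrightarrow> re_part x = x"
  by (simp add: re_part_def scaleR_add_left[symmetric] flip: scaleR_2)

lemma upper_bound_set:
  fixes y :: "'a::unital_cstar_algebra"
  shows "norm y \<in> {r. pos (r *\<^sub>R 1 - re_part y)}"
    "pos (r *\<^sub>R 1 - re_part y) \<Longrightarrow> - norm y \<le> r"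
    "bdd_below {r. pos (r *\<^sub>R 1 - re_part y)}"
    "pos (r *\<^sub>R 1 - re_part y) \<Longrightarrow> upper_bound y \<le> r"
proof -
  show 1: "norm y \<in> {r. pos (r *\<^sub>R 1 - re_part y)}" for y :: 'a using pos_norm_diff re_part(3,4) by blast
  show 2: "- norm y \<le> r" if "pos (r *\<^sub>R 1 - re_part y)" for r
  proof -
    have "re_part (- y) = - re_part y" using re_part(2)[of "-1" y] by simp
    then have "pos (norm y *\<^sub>R 1 + re_part y)" using 1[of "- y"] by simp
    from pos_add[OF that this] have "pos ((r + norm y) *\<^sub>R (1::'a))" by (simp add: algebra_simps)
    then show ?thesis using pos_scaleR_one_nonneg by force
  qed
  show 3: "bdd_below {r. pos (r *\<^sub>R 1 - re_part y)}" by (rule bdd_belowI) (use 2 in auto)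
  show "upper_bound y \<le> r" if "pos (r *\<^sub>R 1 - re_part y)"
    unfolding upper_bound_def by (rule cInf_lower) (use 3 that in auto)
qed

lemma upper_bound_less:
  assumes "upper_bound y < r"
  obtains s where "s < r" "pos (s *\<^sub>R 1 - re_part y)"
proof -
  have "{r. pos (r *\<^sub>R 1 - re_part y)} \<noteq> {}" using upper_bound_set(1) by blast
  from cInf_lessD[OF this, of r] assms that show ?thesis by (auto simp: upper_bound_def)
qed

lemma sublinear_upper_bound: "sublinear upper_bound"
  unfolding sublinear_def
proof (intro conjI allI impI)
  fix x y :: 'a
  show "upper_bound (x + y) \<le> upper_bound x + upper_bound y"
  proof (rule field_le_epsilon)
    fix e :: real assume "e > 0"
    obtain r s where rs: "r < upper_bound x + e/2" "pos (r *\<^sub>R 1 - re_part x)"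
        "s < upper_bound y + e/2" "pos (s *\<^sub>R 1 - re_part y)"
      using \<open>e > 0\<close> upper_bound_less[of x "upper_bound x + e/2"] upper_bound_less[of y "upper_bound y + e/2"]
      by (metis half_gt_zero less_add_same_cancel1)
    have "pos ((r + s) *\<^sub>R 1 - re_part (x + y))"
      using pos_add[OF rs(2,4)] by (simp add: re_part(1) algebra_simps)
    then have "upper_bound (x + y) \<le> r + s" by (rule upper_bound_set(4))
    with rs show "upper_bound (x + y) \<le> upper_bound x + upper_bound y + e" by simp
  qed
next
  have le: "upper_bound (c *\<^sub>R x) \<le> c * upper_bound x" if c: "c > 0" for c and x :: 'a
  proof (rule field_le_epsilon)
    fix e :: real assume "e > 0"
    obtain r where r: "r < upper_bound x + e/c" "pos (r *\<^sub>R 1 - re_part x)"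
      using \<open>e > 0\<close> c upper_bound_less[of x "upper_bound x + e/c"] by auto
    have "pos ((c * r) *\<^sub>R 1 - re_part (c *\<^sub>R x))"
      using pos_scaleR[OF r(2), of c] c by (simp add: re_part(2) scaleR_diff_right)
    then have "upper_bound (c *\<^sub>R x) \<le> c * r" by (rule upper_bound_set(4))
    also have "\<dots> \<le> c * upper_bound x + e" using r(1) c by (simp add: field_simps)
    finally show "upper_bound (c *\<^sub>R x) \<le> c * upper_bound x + e" .
  qed
  fix c :: real and x :: 'a assume "c \<ge> 0"
  show "upper_bound (c *\<^sub>R x) = c * upper_bound x"
  proof (cases "c = 0")
    case True
    have "upper_bound (0::'a) \<le> 0"
      by (rule upper_bound_set(4)) (simp add: re_part_def pos_zero)
    moreover have "0 \<le> upper_bound (0::'a)"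
      unfolding upper_bound_def
      by (rule cInf_greatest) (use upper_bound_set(1,2)[where y = "0::'a"] in \<open>auto intro: exI[of _ 0]\<close>)
    ultimately show ?thesis using True by simp
  next
    case False
    then have "c > 0" using \<open>c \<ge> 0\<close> by simp
    then show ?thesis using le[of c x] le[of "1/c" "c *\<^sub>R x"] by (simp add: field_simps)
  qed
qed

text \<open>Hahn-Banach at a = b^* b gives a real functional attaining \<open>upper_bound a\<close>;
  domination at -y gives positivity. It remains to see that this value is positive and to
  complexify.\<close>

lemma pos_functionals_separate:
  assumes "b \<noteq> (0::'a::unital_cstar_algebra)"
  shows "\<exists>\<omega>. pos_functional \<omega> \<and> \<omega> (cstar b * b) \<noteq> 0"
proof -
  define a where "a = cstar b * b"
  have a: "pos a" unfolding a_def by (rule pos_cstar_mult)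
  have a0: "a \<noteq> 0" using assms by (simp add: a_def cstar_mult_self_eq_0)
  \<comment> \<open>Otherwise s - a is positive for some s below the norm of a; since a is positive,
    s is nonnegative and bounds the norm of a.\<close>
  have "upper_bound a > 0"
  proof (rule ccontr)
    assume "\<not> upper_bound a > 0"
    then have "upper_bound a < norm a" using a0 by (smt (verit) zero_less_norm_iff)
    then obtain s where s: "s < norm a" "pos (s *\<^sub>R 1 - re_part a)" by (rule upper_bound_less)
    then have s2: "pos (s *\<^sub>R 1 - a)" using re_part_sa[OF pos_sa[OF a]] by simp
    have "s \<ge> 0" using pos_add[OF s2 a] pos_scaleR_one_nonneg[of s] by simp
    then show False using pos_norm_le[OF a s2] s(1) by simp
  qed
  obtain f where f: "linear f" "\<And>y. f y \<le> upper_bound y" "f a = upper_bound a"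
    using Hahn_Banach_sublinear[OF sublinear_upper_bound, of a] by blast
  have "f y \<le> norm y" for y
    using f(2)[of y] upper_bound_set(4)[of "norm y" y] upper_bound_set(1)[of y] by simp
  from this this[of "- y" for y] have fn: "\<bar>f y\<bar> \<le> norm y" for y
    by (simp add: linear_neg[OF f(1)] abs_le_iff)
  have fp: "f y \<ge> 0" if "pos y" for y
  proof -
    have "re_part (- y) = - y" using that by (simp add: re_part_sa pos_sa cstar_minus)
    then have "upper_bound (- y) \<le> 0" using that by (intro upper_bound_set(4)) simp
    then show ?thesis using f(2)[of "- y"] by (simp add: linear_neg[OF f(1)])
  qed
  \<comment> \<open>The complex-linear functional whose real part is f.\<close>
  define \<omega> where "\<omega> y = Complex (f y) (- f (scaleC \<i> y))" for y
  have add: "\<omega> (x + y) = \<omega> x + \<omega> y" for x y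
    by (simp add: \<omega>_def scaleC_add_right linear_add[OF f(1)] complex_eq_iff)
  have sc: "f (scaleC c y) = Re c * f y + Im c * f (scaleC \<i> y)" for c y
  proof -
    have "c = complex_of_real (Re c) + \<i> * complex_of_real (Im c)" by (rule complex_eq)
    then have "scaleC c y = Re c *\<^sub>R y + Im c *\<^sub>R scaleC \<i> y"
      by (metis mult.commute scaleC_add_left scaleC_scaleC scaleR_scaleC)
    then show ?thesis by (simp add: linear_add[OF f(1)] linear_cmul[OF f(1)])
  qed
  have "\<omega> (scaleC c y) = c * \<omega> y" for c y
    using sc[of c y] sc[of "\<i> * c" y] by (simp add: \<omega>_def scaleC_scaleC complex_eq_iff)
  moreover have "\<exists>r\<ge>0. \<omega> (cstar x * x) = complex_of_real r" for x
  proof (intro exI[of _ "f (cstar x * x)"] conjI)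
    show "f (cstar x * x) \<ge> 0" by (rule fp) (rule pos_cstar_mult)
    let ?y = "scaleC \<i> (cstar x * x)"
    \<comment> \<open>A skew-adjoint element has real part 0, so f vanishes on it; hence \<omega> is
      real on x^* x.\<close>
    have "cstar ?y = - ?y"
      using scaleC_scaleC[of "-1" \<i> "cstar x * x"] by (simp add: cstar_scaleC cstar_mult cstar_cstar scaleC_minus_one)
    then have re: "re_part ?y = 0" "re_part (- ?y) = 0" by (simp_all add: re_part_def cstar_minus)
    have "upper_bound ?y \<le> 0" "upper_bound (- ?y) \<le> 0"
      by (rule upper_bound_set(4), use re pos_zero in simp)+
    then have "f ?y = 0" using f(2)[of ?y] f(2)[of "- ?y"] by (simp add: linear_neg[OF f(1)])
    then show "\<omega> (cstar x * x) = complex_of_real (f (cstar x * x))" by (simp add: \<omega>_def complex_eq_iff)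
  qed
  moreover have "cmod (\<omega> x) \<le> 2 * norm x" for x
    using cmod_le[of "\<omega> x"] fn[of x] fn[of "scaleC \<i> x"] by (simp add: \<omega>_def norm_scaleC)
  ultimately have "pos_functional \<omega>" unfolding pos_functional_def using add by blast
  moreover have "\<omega> (cstar b * b) \<noteq> 0" using \<open>upper_bound a > 0\<close> f(3) by (simp add: \<omega>_def a_def complex_eq_iff)
  ultimately show ?thesis by blast
qed

section \<open>Semi-inner product spaces\<close>

text \<open>The vector space axioms are not assumed: they hold up to null vectors.\<close>

locale semi_inner =
  fixes C :: "'v set" and add :: "'v \<Rightarrow> 'v \<Rightarrow> 'v" and scl :: "complex \<Rightarrow> 'v \<Rightarrow> 'v"
    and ip :: "'v \<Rightarrow> 'v \<Rightarrow> complex"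
  assumes nonempty: "C \<noteq> {}"
    and add_closed [simp, intro]: "x \<in> C \<Longrightarrow> y \<in> C \<Longrightarrow> add x y \<in> C"
    and scl_closed [simp, intro]: "x \<in> C \<Longrightarrow> scl c x \<in> C"
    and ip_add_right: "x \<in> C \<Longrightarrow> y \<in> C \<Longrightarrow> z \<in> C \<Longrightarrow> ip z (add x y) = ip z x + ip z y"
    and ip_scl_right: "x \<in> C \<Longrightarrow> z \<in> C \<Longrightarrow> ip z (scl c x) = c * ip z x"
    and ip_cnj: "x \<in> C \<Longrightarrow> y \<in> C \<Longrightarrow> ip y x = cnj (ip x y)"
    and ip_nonneg: "x \<in> C \<Longrightarrow> 0 \<le> Re (ip x x)"
begin

definition nrm :: "'v \<Rightarrow> real" where "nrm x = sqrt (Re (ip x x))"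
definition sub :: "'v \<Rightarrow> 'v \<Rightarrow> 'v" where "sub x y = add x (scl (-1) y)"

definition clin :: "('v \<Rightarrow> complex) \<Rightarrow> bool" where
  "clin \<phi> \<longleftrightarrow> (\<forall>x\<in>C. \<forall>y\<in>C. \<phi> (add x y) = \<phi> x + \<phi> y) \<and> (\<forall>x\<in>C. \<forall>c. \<phi> (scl c x) = c * \<phi> x)"

lemma ip_add_left: "x \<in> C \<Longrightarrow> y \<in> C \<Longrightarrow> z \<in> C \<Longrightarrow> ip (add x y) z = ip x z + ip y z"
  using ip_cnj[of z "add x y"] ip_cnj[of z x] ip_cnj[of z y] ip_add_right[of x y z] by simp

lemma ip_scl_left: "x \<in> C \<Longrightarrow> z \<in> C \<Longrightarrow> ip (scl c x) z = cnj c * ip x z"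
  using ip_cnj[of z "scl c x"] ip_cnj[of z x] ip_scl_right[of x z c] by simp

lemma sub_closed [simp, intro]: "x \<in> C \<Longrightarrow> y \<in> C \<Longrightarrow> sub x y \<in> C"
  by (simp add: sub_def)

lemma ip_sub_right: "x \<in> C \<Longrightarrow> y \<in> C \<Longrightarrow> z \<in> C \<Longrightarrow> ip z (sub x y) = ip z x - ip z y"
  by (simp add: sub_def ip_add_right ip_scl_right)

lemma ip_sub_left: "x \<in> C \<Longrightarrow> y \<in> C \<Longrightarrow> z \<in> C \<Longrightarrow> ip (sub x y) z = ip x z - ip y z"
  by (simp add: sub_def ip_add_left ip_scl_left)

lemmas ip_simps = ip_add_right ip_scl_right ip_add_left ip_scl_left ip_sub_right ip_sub_left

lemma clin_ip: "z \<in> C \<Longrightarrow> clin (ip z)"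
  by (simp add: clin_def ip_simps)

lemma nrm_nonneg [simp]: "x \<in> C \<Longrightarrow> 0 \<le> nrm x"
  by (simp add: nrm_def ip_nonneg)

lemma nrm_sq: "x \<in> C \<Longrightarrow> (nrm x)\<^sup>2 = Re (ip x x)"
  by (simp add: nrm_def ip_nonneg)

lemma ip_self: "x \<in> C \<Longrightarrow> ip x x = complex_of_real ((nrm x)\<^sup>2)"
  using ip_cnj[of x x] by (simp add: nrm_sq complex_eq_iff)

lemma Cauchy_Schwarz:
  assumes "x \<in> C" "y \<in> C" shows "cmod (ip x y) \<le> nrm x * nrm y"
proof -
  let ?c = "ip x y"
  \<comment> \<open>The square norm of x - s c' y, with c' the conjugate of the inner product and s
    a free real parameter.\<close>
  have *: "0 \<le> (nrm x)\<^sup>2 - 2 * s * (cmod ?c)\<^sup>2 + s\<^sup>2 * (cmod ?c)\<^sup>2 * (nrm y)\<^sup>2" for s :: real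
  proof -
    let ?t = "- complex_of_real s * cnj ?c"
    have "ip (add x (scl ?t y)) (add x (scl ?t y))
        = ip x x + ?t * ?c + cnj ?t * cnj ?c + cnj ?t * ?t * ip y y"
      using assms ip_cnj[of x y] by (simp add: ip_simps algebra_simps)
    also have "\<dots> = complex_of_real ((nrm x)\<^sup>2 - 2 * s * (cmod ?c)\<^sup>2 + s\<^sup>2 * (cmod ?c)\<^sup>2 * (nrm y)\<^sup>2)"
      using complex_norm_square[of ?c]
      by (simp add: ip_self assms power2_eq_square algebra_simps)
    finally have "0 \<le> Re (complex_of_real ((nrm x)\<^sup>2 - 2 * s * (cmod ?c)\<^sup>2 + s\<^sup>2 * (cmod ?c)\<^sup>2 * (nrm y)\<^sup>2))"
      using ip_nonneg[of "add x (scl ?t y)"] assms by (metis add_closed scl_closed)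
    then show ?thesis by simp
  qed
  show ?thesis
  proof (cases "nrm y = 0")
    case True
    have "cmod ?c = 0"
    proof (rule ccontr)
      assume "cmod ?c \<noteq> 0"
      \<comment> \<open>If y is null, this value of s makes the nonnegative expression equal to
        -1.\<close>
      then show False using *[of "((nrm x)\<^sup>2 + 1) / (2 * (cmod ?c)\<^sup>2)"] True by simp
    qed
    then show ?thesis using assms by simp
  next
    case False
    then have "nrm y > 0" using assms nrm_nonneg[of y] by linarith
    then have "(cmod ?c)\<^sup>2 \<le> (nrm x * nrm y)\<^sup>2"
      using *[of "1 / (nrm y)\<^sup>2"] by (simp add: field_simps power2_eq_square)
    then show ?thesis using assms by (meson mult_nonneg_nonneg nrm_nonneg power2_le_imp_le)
  qed
qed

lemma nrm_add_sq:
  assumes "x \<in> C" "y \<in> C"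
  shows "(nrm (add x y))\<^sup>2 = (nrm x)\<^sup>2 + 2 * Re (ip x y) + (nrm y)\<^sup>2"
  using assms ip_cnj[of x y] by (simp add: nrm_sq ip_simps)

lemma nrm_sub_sq:
  assumes "x \<in> C" "y \<in> C"
  shows "(nrm (sub x y))\<^sup>2 = (nrm x)\<^sup>2 - 2 * Re (ip x y) + (nrm y)\<^sup>2"
  using assms ip_cnj[of x y] by (simp add: nrm_sq ip_simps)

lemma nrm_triangle:
  assumes "x \<in> C" "y \<in> C" shows "nrm (add x y) \<le> nrm x + nrm y"
proof (rule power2_le_imp_le)
  have "Re (ip x y) \<le> nrm x * nrm y"
    using Cauchy_Schwarz[OF assms] complex_Re_le_cmod order_trans by blast
  then show "(nrm (add x y))\<^sup>2 \<le> (nrm x + nrm y)\<^sup>2"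
    by (simp add: nrm_add_sq assms power2_sum)
qed (use assms in simp)

lemma nrm_scl: "x \<in> C \<Longrightarrow> nrm (scl c x) = cmod c * nrm x"
proof -
  assume x: "x \<in> C"
  have "ip (scl c x) (scl c x) = (c * cnj c) * ip x x" using x by (simp add: ip_simps mult_ac)
  also have "\<dots> = complex_of_real ((cmod c * nrm x)\<^sup>2)"
    by (simp only: complex_norm_square[symmetric] ip_self[OF x] of_real_mult power_mult_distrib)
  finally have "(nrm (scl c x))\<^sup>2 = (cmod c * nrm x)\<^sup>2" using x by (simp add: nrm_sq)
  then show ?thesis using x by (simp add: power2_eq_iff_nonneg)
qed

text \<open>This replaces rewriting by vector space laws: such a law is verified after pairing with
  every z, and the pairing then determines the norm.\<close>

lemma nrm_cong:
  assumes "x \<in> C" "y \<in> C" "\<And>z. z \<in> C \<Longrightarrow> ip z x = ip z y" shows "nrm x = nrm y"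
proof -
  have "ip x x = ip y y" using assms ip_cnj[of x y] ip_self by (metis complex_cnj_complex_of_real)
  then show ?thesis by (simp add: nrm_def)
qed

lemma nrm_sub_triangle:
  assumes "x \<in> C" "y \<in> C" "z \<in> C" shows "nrm (sub x z) \<le> nrm (sub x y) + nrm (sub y z)"
proof -
  have "nrm (sub x z) = nrm (add (sub x y) (sub y z))"
    using assms by (intro nrm_cong) (auto simp: ip_simps)
  then show ?thesis using nrm_triangle[of "sub x y" "sub y z"] assms by simp
qed

lemma nrm_sub_commute:
  assumes "x \<in> C" "y \<in> C" shows "nrm (sub x y) = nrm (sub y x)"
  using assms ip_cnj[of x y] by (simp add: nrm_def ip_simps)

lemma nrm_sub_self [simp]: "x \<in> C \<Longrightarrow> nrm (sub x x) = 0"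
  by (simp add: nrm_def ip_simps)

lemma ip_eq_if_nrm_sub_0:
  assumes "x \<in> C" "y \<in> C" "z \<in> C" "nrm (sub x y) = 0" shows "ip z x = ip z y"
  using Cauchy_Schwarz[of z "sub x y"] assms by (simp add: ip_simps)

lemma nrm_le_add: assumes "x \<in> C" "y \<in> C" shows "nrm x \<le> nrm y + nrm (sub x y)"
proof -
  have "nrm x = nrm (add y (sub x y))" using assms by (intro nrm_cong) (auto simp: ip_simps)
  then show ?thesis using nrm_triangle[of y "sub x y"] assms by simp
qed

lemma ip_diff_bound:
  assumes "x \<in> C" "y \<in> C" "x' \<in> C" "y' \<in> C"
  shows "cmod (ip x y - ip x' y') \<le> nrm x * nrm (sub y y') + nrm (sub x x') * nrm y'"
proof -
  have "ip x y - ip x' y' = ip x (sub y y') + ip (sub x x') y'" using assms by (simp add: ip_simps)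
  then show ?thesis
    using norm_triangle_ineq[of "ip x (sub y y')" "ip (sub x x') y'"]
      Cauchy_Schwarz[of x "sub y y'"] Cauchy_Schwarz[of "sub x x'" y'] assms by simp
qed

section \<open>Completion by Cauchy sequences\<close>

definition cseq :: "(nat \<Rightarrow> 'v) \<Rightarrow> bool" where
  "cseq X \<longleftrightarrow> (\<forall>n. X n \<in> C) \<and> (\<forall>e>0. \<exists>N. \<forall>m\<ge>N. \<forall>n\<ge>N. nrm (sub (X m) (X n)) < e)"

definition lip :: "(nat \<Rightarrow> 'v) \<Rightarrow> (nat \<Rightarrow> 'v) \<Rightarrow> complex" where
  "lip X Y = lim (\<lambda>n. ip (X n) (Y n))"

lemma cseq_C: "cseq X \<Longrightarrow> X n \<in> C" by (simp add: cseq_def)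

lemma cseqD: "cseq X \<Longrightarrow> e > 0 \<Longrightarrow> \<exists>N. \<forall>m\<ge>N. \<forall>n\<ge>N. nrm (sub (X m) (X n)) < e"
  by (simp add: cseq_def)

lemma cseq_bounded: assumes "cseq X" shows "\<exists>B>0. \<forall>n. nrm (X n) \<le> B"
proof -
  obtain N where N: "\<And>n. n \<ge> N \<Longrightarrow> nrm (sub (X n) (X N)) < 1" using cseqD[OF assms, of 1] by auto
  define B where "B = Max (nrm ` X ` {..N}) + 1"
  have 1: "nrm (X n) \<le> B - 1" if "n \<le> N" for n unfolding B_def using that by (auto intro!: Max_ge)
  have "nrm (X n) \<le> B" for n
  proof (cases "n \<le> N")
    case False
    then show ?thesis
      using nrm_le_add[of "X n" "X N"] N[of n] 1[of N] cseq_C[OF assms] by fastforce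
  qed (use 1[of n] in simp)
  moreover have "B > 0" using 1[of N] nrm_nonneg[OF cseq_C[OF assms, of N]] by linarith
  ultimately show ?thesis by blast
qed

lemma lip_tendsto:
  assumes "cseq X" "cseq Y" shows "(\<lambda>n. ip (X n) (Y n)) \<longlonglongrightarrow> lip X Y"
proof -
  obtain A B where AB: "A > 0" "\<And>n. nrm (X n) \<le> A" "B > 0" "\<And>n. nrm (Y n) \<le> B"
    using cseq_bounded assms by metis
  have "Cauchy (\<lambda>n. ip (X n) (Y n))"
  proof (rule metric_CauchyI)
    fix e :: real assume e: "e > 0"
    obtain N1 where N1: "\<forall>m\<ge>N1. \<forall>n\<ge>N1. nrm (sub (X m) (X n)) < e / (2 * B)"
      using cseqD[OF assms(1), of "e / (2 * B)"] e AB by auto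
    obtain N2 where N2: "\<forall>m\<ge>N2. \<forall>n\<ge>N2. nrm (sub (Y m) (Y n)) < e / (2 * A)"
      using cseqD[OF assms(2), of "e / (2 * A)"] e AB by auto
    have "dist (ip (X m) (Y m)) (ip (X n) (Y n)) < e" if "m \<ge> max N1 N2" "n \<ge> max N1 N2" for m n
    proof -
      have "dist (ip (X m) (Y m)) (ip (X n) (Y n))
        \<le> nrm (X m) * nrm (sub (Y m) (Y n)) + nrm (sub (X m) (X n)) * nrm (Y n)"
        unfolding dist_norm by (rule ip_diff_bound) (use assms cseq_C in auto)
      also have "\<dots> \<le> A * nrm (sub (Y m) (Y n)) + nrm (sub (X m) (X n)) * B"
        by (intro add_mono mult_mono) (use AB assms cseq_C in \<open>auto intro: less_imp_le\<close>)
      also have "\<dots> < A * (e / (2 * A)) + (e / (2 * B)) * B"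
        by (intro add_strict_mono mult_strict_left_mono mult_strict_right_mono) (use AB N1 N2 that in auto)
      also have "\<dots> = e" using AB by simp
      finally show ?thesis .
    qed
    then show "\<exists>M. \<forall>m\<ge>M. \<forall>n\<ge>M. dist (ip (X m) (Y m)) (ip (X n) (Y n)) < e" by blast
  qed
  then show ?thesis unfolding lip_def by (simp add: Cauchy_convergent_iff convergent_LIMSEQ_iff)
qed

lemma cseq_const: "x \<in> C \<Longrightarrow> cseq (\<lambda>n. x)"
  by (auto simp: cseq_def)

lemma cseq_lipschitz:
  assumes "cseq X" "\<And>n. Y n \<in> C" "\<And>m n. nrm (sub (Y m) (Y n)) \<le> K * nrm (sub (X m) (X n))"
  shows "cseq Y"
  unfolding cseq_def
proof (intro conjI allI impI)
  fix e :: real assume e: "e > 0"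
  then have "e / (\<bar>K\<bar> + 1) > 0" by (simp add: add_nonneg_pos)
  then obtain N where N: "\<forall>m\<ge>N. \<forall>n\<ge>N. nrm (sub (X m) (X n)) < e / (\<bar>K\<bar> + 1)"
    using cseqD[OF assms(1)] by blast
  have "nrm (sub (Y m) (Y n)) < e" if "m \<ge> N" "n \<ge> N" for m n
  proof -
    have "nrm (sub (Y m) (Y n)) \<le> (\<bar>K\<bar> + 1) * nrm (sub (X m) (X n))"
      by (rule order_trans[OF assms(3)], rule mult_right_mono) (use assms(1) cseq_C in auto)
    also have "\<dots> < (\<bar>K\<bar> + 1) * (e / (\<bar>K\<bar> + 1))"
      by (rule mult_strict_left_mono) (use N that in auto)
    finally show ?thesis by simp
  qed
  then show "\<exists>N. \<forall>m\<ge>N. \<forall>n\<ge>N. nrm (sub (Y m) (Y n)) < e" by blast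
qed (rule assms(2))

lemma cseq_add: assumes "cseq X" "cseq Y" shows "cseq (\<lambda>n. add (X n) (Y n))"
  unfolding cseq_def
proof (intro conjI allI impI)
  show "add (X n) (Y n) \<in> C" for n using assms cseq_C by auto
  fix e :: real assume e: "e > 0"
  obtain N1 where N1: "\<forall>m\<ge>N1. \<forall>n\<ge>N1. nrm (sub (X m) (X n)) < e / 2"
    using cseqD[OF assms(1), of "e / 2"] e by auto
  obtain N2 where N2: "\<forall>m\<ge>N2. \<forall>n\<ge>N2. nrm (sub (Y m) (Y n)) < e / 2"
    using cseqD[OF assms(2), of "e / 2"] e by auto
  have "nrm (sub (add (X m) (Y m)) (add (X n) (Y n))) < e" if "m \<ge> max N1 N2" "n \<ge> max N1 N2" for m n
  proof -
    have "nrm (sub (add (X m) (Y m)) (add (X n) (Y n))) = nrm (add (sub (X m) (X n)) (sub (Y m) (Y n)))"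
      by (rule nrm_cong) (use assms cseq_C in \<open>auto simp: ip_simps\<close>)
    also have "\<dots> \<le> nrm (sub (X m) (X n)) + nrm (sub (Y m) (Y n))"
      by (rule nrm_triangle) (use assms cseq_C in auto)
    finally show ?thesis using N1 N2 that by fastforce
  qed
  then show "\<exists>N. \<forall>m\<ge>N. \<forall>n\<ge>N. nrm (sub (add (X m) (Y m)) (add (X n) (Y n))) < e" by blast
qed

lemma cseq_scl: assumes "cseq X" shows "cseq (\<lambda>n. scl c (X n))"
proof (rule cseq_lipschitz[OF assms])
  show "scl c (X n) \<in> C" for n using assms cseq_C by auto
  fix m n
  have "nrm (sub (scl c (X m)) (scl c (X n))) = nrm (scl c (sub (X m) (X n)))"
    by (rule nrm_cong) (use assms cseq_C in \<open>auto simp: ip_simps algebra_simps\<close>)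
  then show "nrm (sub (scl c (X m)) (scl c (X n))) \<le> cmod c * nrm (sub (X m) (X n))"
    using assms cseq_C by (simp add: nrm_scl)
qed

interpretation cpl: semi_inner "Collect cseq" "\<lambda>X Y n. add (X n) (Y n)" "\<lambda>c X n. scl c (X n)" lip
proof
  show "Collect cseq \<noteq> {}" using nonempty cseq_const by blast
next
  fix X Y Z assume "X \<in> Collect cseq" "Y \<in> Collect cseq" "Z \<in> Collect cseq"
  then have *: "cseq X" "cseq Y" "cseq Z" by auto
  have "(\<lambda>n. ip (Z n) (X n) + ip (Z n) (Y n)) \<longlonglongrightarrow> lip Z X + lip Z Y"
    by (intro tendsto_add lip_tendsto *)
  then have "(\<lambda>n. ip (Z n) (add (X n) (Y n))) \<longlonglongrightarrow> lip Z X + lip Z Y"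
    using * by (simp add: ip_simps cseq_C)
  then show "lip Z (\<lambda>n. add (X n) (Y n)) = lip Z X + lip Z Y"
    unfolding lip_def[of Z "\<lambda>n. add (X n) (Y n)"] by (rule limI)
next
  fix X Z c assume "X \<in> Collect cseq" "Z \<in> Collect cseq"
  then have *: "cseq X" "cseq Z" by auto
  have "(\<lambda>n. c * ip (Z n) (X n)) \<longlonglongrightarrow> c * lip Z X" by (intro tendsto_intros lip_tendsto *)
  then have "(\<lambda>n. ip (Z n) (scl c (X n))) \<longlonglongrightarrow> c * lip Z X" using * by (simp add: ip_simps cseq_C)
  then show "lip Z (\<lambda>n. scl c (X n)) = c * lip Z X"
    unfolding lip_def[of Z "\<lambda>n. scl c (X n)"] by (rule limI)
next
  fix X Y assume "X \<in> Collect cseq" "Y \<in> Collect cseq"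
  then have *: "cseq X" "cseq Y" by auto
  have "(\<lambda>n. cnj (ip (X n) (Y n))) \<longlonglongrightarrow> cnj (lip X Y)" by (intro tendsto_cnj lip_tendsto *)
  then have "(\<lambda>n. ip (Y n) (X n)) \<longlonglongrightarrow> cnj (lip X Y)"
    using * by (subst ip_cnj) (auto simp: cseq_C)
  then show "lip Y X = cnj (lip X Y)" unfolding lip_def[of Y X] by (rule limI)
next
  fix X assume "X \<in> Collect cseq"
  then have *: "cseq X" by auto
  show "0 \<le> Re (lip X X)"
    by (rule LIMSEQ_le_const[OF tendsto_Re[OF lip_tendsto[OF * *]]])
      (use * cseq_C ip_nonneg in blast)
qed (auto intro: cseq_add cseq_scl)

lemmas semi_inner_completion = cpl.semi_inner_axioms

lemma nrm_tendsto:
  assumes "cseq X" shows "(\<lambda>n. nrm (X n)) \<longlonglongrightarrow> cpl.nrm X"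
  unfolding nrm_def cpl.nrm_def by (intro tendsto_intros lip_tendsto assms)

text \<open>A Cauchy sequence is approximated by the constant sequence of one of its late terms;
  constants are dense in the completion.\<close>

lemma cpl_approx:
  assumes "cseq X" "e > 0" shows "\<exists>x\<in>C. cpl.nrm (cpl.sub X (\<lambda>n. x)) < e"
proof -
  obtain N where N: "\<forall>m\<ge>N. \<forall>n\<ge>N. nrm (sub (X m) (X n)) < e / 2" using cseqD[OF assms(1), of "e/2"] assms by auto
  have c: "cseq (\<lambda>n. X N)" using assms(1) cseq_C cseq_const by blast
  have "cseq (cpl.sub X (\<lambda>n. X N))" using cpl.sub_closed[of X "\<lambda>n. X N"] assms c by simp
  then have "(\<lambda>n. nrm (cpl.sub X (\<lambda>n. X N) n)) \<longlonglongrightarrow> cpl.nrm (cpl.sub X (\<lambda>n. X N))" by (rule nrm_tendsto)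
  then have "(\<lambda>n. nrm (sub (X n) (X N))) \<longlonglongrightarrow> cpl.nrm (cpl.sub X (\<lambda>n. X N))"
    by (simp add: cpl.sub_def sub_def)
  then have "cpl.nrm (cpl.sub X (\<lambda>n. X N)) \<le> e / 2"
    by (rule LIMSEQ_le_const2) (use N in \<open>auto intro!: exI[of _ N] less_imp_le\<close>)
  then show ?thesis using assms cseq_C by (intro bexI[of _ "X N"]) auto
qed

end

locale semi_hilbert = semi_inner C add scl ip for C :: "'v set" and add scl ip +
  assumes complete: "cseq X \<Longrightarrow> \<exists>x\<in>C. (\<lambda>n. nrm (sub (X n) x)) \<longlonglongrightarrow> 0"

context semi_inner
begin

interpretation cpl: semi_inner "Collect cseq" "\<lambda>X Y n. add (X n) (Y n)" "\<lambda>c X n. scl c (X n)" lip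
  by (rule semi_inner_completion)

lemma nrm_sub_const_eq: "x \<in> C \<Longrightarrow> y \<in> C \<Longrightarrow> cpl.nrm (cpl.sub (\<lambda>n. x) (\<lambda>n. y)) = nrm (sub x y)"
  by (simp add: cpl.nrm_def cpl.sub_def nrm_def sub_def lip_def)

text \<open>Replace the n-th Cauchy sequence by a constant y n within 1/(n + 1). The sequence y is
  then Cauchy in the original space, hence a point of the completion, and it is the limit.\<close>

lemma semi_hilbert_completion:
  "semi_hilbert (Collect cseq) (\<lambda>X Y n. add (X n) (Y n)) (\<lambda>c X n. scl c (X n)) lip"
proof unfold_locales
  fix XX assume XX: "cpl.cseq XX"
  then have X: "cseq (XX n)" for n using cpl.cseq_C by blast
  have "\<forall>n. \<exists>x\<in>C. cpl.nrm (cpl.sub (XX n) (\<lambda>k. x)) < 1 / Suc n" using cpl_approx[OF X] by simp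
  then obtain y where y: "\<And>n. y n \<in> C" "\<And>n. cpl.nrm (cpl.sub (XX n) (\<lambda>k. y n)) < 1 / Suc n" by metis
  have yc: "cseq (\<lambda>k. y n)" for n using cseq_const y(1) by blast
  have inv: "(\<lambda>n. 1 / real (Suc n)) \<longlonglongrightarrow> 0" using LIMSEQ_inverse_real_of_nat by (simp add: inverse_eq_divide)
  have Y: "cseq y" unfolding cseq_def
  proof (intro conjI allI impI)
    fix e :: real assume e: "e > 0"
    obtain N1 where N1: "\<forall>m\<ge>N1. \<forall>n\<ge>N1. cpl.nrm (cpl.sub (XX m) (XX n)) < e / 3"
      using cpl.cseqD[OF XX, of "e/3"] e by auto
    obtain N2 where N2: "\<And>n. n \<ge> N2 \<Longrightarrow> 1 / real (Suc n) < e / 3"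
      using order_tendstoD(2)[OF inv, of "e/3"] e by (auto simp: eventually_sequentially)
    have "nrm (sub (y m) (y n)) < e" if mn: "m \<ge> max N1 N2" "n \<ge> max N1 N2" for m n
    proof -
      have "nrm (sub (y m) (y n)) = cpl.nrm (cpl.sub (\<lambda>k. y m) (\<lambda>k. y n))" using y by (simp add: nrm_sub_const_eq)
      also have "\<dots> \<le> cpl.nrm (cpl.sub (\<lambda>k. y m) (XX m)) + cpl.nrm (cpl.sub (XX m) (\<lambda>k. y n))"
        by (rule cpl.nrm_sub_triangle) (use X yc in auto)
      also have "\<dots> \<le> cpl.nrm (cpl.sub (\<lambda>k. y m) (XX m)) + (cpl.nrm (cpl.sub (XX m) (XX n)) + cpl.nrm (cpl.sub (XX n) (\<lambda>k. y n)))"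
        by (intro add_left_mono cpl.nrm_sub_triangle) (use X yc in auto)
      also have "cpl.nrm (cpl.sub (\<lambda>k. y m) (XX m)) = cpl.nrm (cpl.sub (XX m) (\<lambda>k. y m))"
        by (rule cpl.nrm_sub_commute) (use X yc in auto)
      finally show ?thesis using y(2)[of m] y(2)[of n] N2[of m] N2[of n] N1 mn by fastforce
    qed
    then show "\<exists>N. \<forall>m\<ge>N. \<forall>n\<ge>N. nrm (sub (y m) (y n)) < e" by blast
  qed (rule y(1))
  have "(\<lambda>n. cpl.nrm (cpl.sub (\<lambda>k. y n) y)) \<longlonglongrightarrow> 0"
  proof (rule LIMSEQ_I)
    fix e :: real assume e: "e > 0"
    obtain N where N: "\<forall>m\<ge>N. \<forall>n\<ge>N. nrm (sub (y m) (y n)) < e / 2" using cseqD[OF Y, of "e/2"] e by auto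
    have "norm (cpl.nrm (cpl.sub (\<lambda>k. y n) y) - 0) < e" if "n \<ge> N" for n
    proof -
      have "cseq (cpl.sub (\<lambda>k. y n) y)" using cpl.sub_closed[of "\<lambda>k. y n" y] yc Y by simp
      from nrm_tendsto[OF this]
      have "(\<lambda>m. nrm (sub (y n) (y m))) \<longlonglongrightarrow> cpl.nrm (cpl.sub (\<lambda>k. y n) y)"
        by (simp add: cpl.sub_def sub_def)
      then have "cpl.nrm (cpl.sub (\<lambda>k. y n) y) \<le> e / 2"
        by (rule LIMSEQ_le_const2) (use N that in \<open>auto intro!: exI[of _ N] less_imp_le\<close>)
      then show ?thesis using e cpl.nrm_nonneg[OF cpl.sub_closed[of "\<lambda>k. y n" y]] yc Y by simp
    qed
    then show "\<exists>N. \<forall>n\<ge>N. norm (cpl.nrm (cpl.sub (\<lambda>k. y n) y) - 0) < e" by blast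
  qed
  then have lim: "(\<lambda>n. 1 / real (Suc n) + cpl.nrm (cpl.sub (\<lambda>k. y n) y)) \<longlonglongrightarrow> 0"
    using tendsto_add[OF inv] by force
  have "(\<lambda>n. cpl.nrm (cpl.sub (XX n) y)) \<longlonglongrightarrow> 0"
  proof (rule tendsto_sandwich[OF _ _ tendsto_const lim])
    show "\<forall>\<^sub>F n in sequentially. 0 \<le> cpl.nrm (cpl.sub (XX n) y)"
      by (intro always_eventually allI cpl.nrm_nonneg cpl.sub_closed) (use X Y in auto)
    have "cpl.nrm (cpl.sub (XX n) y) \<le> 1 / real (Suc n) + cpl.nrm (cpl.sub (\<lambda>k. y n) y)" for n
      using cpl.nrm_sub_triangle[of "XX n" "\<lambda>k. y n" y] y(2)[of n] X yc Y by simp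
    then show "\<forall>\<^sub>F n in sequentially. cpl.nrm (cpl.sub (XX n) y) \<le> 1 / real (Suc n) + cpl.nrm (cpl.sub (\<lambda>k. y n) y)"
      by simp
  qed
  then show "\<exists>x\<in>Collect cseq. (\<lambda>n. cpl.nrm (cpl.sub (XX n) x)) \<longlonglongrightarrow> 0" using Y by blast
qed

end


section \<open>Orthonormal bases and the Riesz representation theorem\<close>

context semi_hilbert
begin

definition ortho :: "'v set \<Rightarrow> bool" where
  "ortho E \<longleftrightarrow> E \<subseteq> C \<and> (\<forall>e\<in>E. \<forall>f\<in>E. ip e f = (if e = f then 1 else 0))"

definition onb :: "'v set \<Rightarrow> bool" where
  "onb E \<longleftrightarrow> ortho E \<and> (\<forall>x\<in>C. (\<forall>e\<in>E. ip e x = 0) \<longrightarrow> nrm x = 0)"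

text \<open>A linear combination recognised by the values of functionals, since no finite sum is
  available in the carrier. Testing against every \<open>clin\<close> functional, and not just inner
  products, lets \<open>ex_representer\<close> evaluate a functional not yet known to be
  one.\<close>

definition comb :: "('v \<Rightarrow> complex) \<Rightarrow> 'v set \<Rightarrow> 'v \<Rightarrow> bool" where
  "comb f F y \<longleftrightarrow> y \<in> C \<and> (\<forall>\<phi>. clin \<phi> \<longrightarrow> \<phi> y = (\<Sum>e\<in>F. f e * \<phi> e))"

lemma ex_comb: "finite F \<Longrightarrow> F \<subseteq> C \<Longrightarrow> \<exists>y. comb f F y"
proof (induction F rule: finite_induct)
  case empty
  obtain x where "x \<in> C" using nonempty by blast
  \<comment> \<open>A scalar multiple by 0 stands in for the zero vector.\<close>
  then show ?case by (intro exI[of _ "scl 0 x"]) (auto simp: comb_def clin_def)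
next
  case (insert e F)
  then obtain y where "comb f F y" by auto
  with insert show ?case
    by (intro exI[of _ "add (scl (f e) e) y"]) (auto simp: comb_def clin_def)
qed

lemma ex_ortho_comb: "ortho E \<Longrightarrow> finite F \<Longrightarrow> F \<subseteq> E \<Longrightarrow> \<exists>y. comb f F y"
  by (rule ex_comb) (auto simp: ortho_def)

lemma comb_ip: "comb f F y \<Longrightarrow> z \<in> C \<Longrightarrow> ip z y = (\<Sum>e\<in>F. f e * ip z e)"
  using clin_ip by (simp add: comb_def)

lemma comb_coord:
  assumes "comb f F y" "ortho E" "finite F" "F \<subseteq> E" "e \<in> E"
  shows "ip e y = (if e \<in> F then f e else 0)"
proof -
  have o: "g \<in> F \<Longrightarrow> ip e g = (if e = g then 1 else 0)" for g using assms unfolding ortho_def by blast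
  have "e \<in> C" using assms unfolding ortho_def by blast
  then have "ip e y = (\<Sum>g\<in>F. f g * ip e g)" using comb_ip assms(1) by blast
  also have "\<dots> = (\<Sum>g\<in>F. if e = g then f e else 0)" by (intro sum.cong) (auto simp: o)
  finally show ?thesis using assms by simp
qed

lemma comb_ip_comb:
  assumes "comb f F y" "comb f G z" "ortho E" "finite F" "F \<subseteq> E" "finite G" "G \<subseteq> E"
  shows "ip y z = complex_of_real (\<Sum>e\<in>F \<inter> G. (cmod (f e))\<^sup>2)"
proof -
  have y: "y \<in> C" using assms(1) by (simp add: comb_def)
  have "ip y z = (\<Sum>e\<in>G. f e * ip y e)" using comb_ip[OF assms(2) y] .
  also have "\<dots> = (\<Sum>e\<in>G. if e \<in> F then complex_of_real ((cmod (f e))\<^sup>2) else 0)"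
  proof (rule sum.cong)
    fix e assume e: "e \<in> G"
    then have "e \<in> E" "e \<in> C" using assms by (auto simp: ortho_def)
    then have "ip y e = cnj (if e \<in> F then f e else 0)"
      using comb_coord[OF assms(1,3-5)] ip_cnj[of e y] y by simp
    then show "f e * ip y e = (if e \<in> F then complex_of_real ((cmod (f e))\<^sup>2) else 0)"
      by (simp add: complex_norm_square del: of_real_power)
  qed simp
  also have "\<dots> = complex_of_real (\<Sum>e\<in>F \<inter> G. (cmod (f e))\<^sup>2)"
    using assms by (simp add: sum.If_cases Int_commute Collect_mem_eq)
  finally show ?thesis .
qed

lemma comb_nrm:
  assumes "comb f F y" "ortho E" "finite F" "F \<subseteq> E"
  shows "(nrm y)\<^sup>2 = (\<Sum>e\<in>F. (cmod (f e))\<^sup>2)"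
  using comb_ip_comb[OF assms(1,1,2,3,4,3,4)] assms(1) by (simp add: nrm_sq comb_def)

lemma projection_error:
  assumes "comb (\<lambda>e. ip e x) F y" "ortho E" "finite F" "F \<subseteq> E" "x \<in> C"
  shows "(nrm (sub x y))\<^sup>2 = (nrm x)\<^sup>2 - (\<Sum>e\<in>F. (cmod (ip e x))\<^sup>2)"
proof -
  have y: "y \<in> C" using assms(1) by (simp add: comb_def)
  have "ip x y = (\<Sum>e\<in>F. ip e x * ip x e)" using comb_ip[OF assms(1,5)] .
  also have "\<dots> = (\<Sum>e\<in>F. complex_of_real ((cmod (ip e x))\<^sup>2))"
  proof (rule sum.cong)
    fix e assume "e \<in> F"
    then have "e \<in> C" using assms by (auto simp: ortho_def)
    then show "ip e x * ip x e = complex_of_real ((cmod (ip e x))\<^sup>2)"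
      using ip_cnj[of e x] assms(5) by (simp add: complex_norm_square del: of_real_power)
  qed simp
  finally have "Re (ip x y) = (\<Sum>e\<in>F. (cmod (ip e x))\<^sup>2)" by simp
  then show ?thesis using nrm_sub_sq[OF assms(5) y] comb_nrm[OF assms(1-4)] by simp
qed

lemma bessel:
  assumes "ortho E" "finite F" "F \<subseteq> E" "x \<in> C"
  shows "(\<Sum>e\<in>F. (cmod (ip e x))\<^sup>2) \<le> (nrm x)\<^sup>2"
proof -
  obtain y where "comb (\<lambda>e. ip e x) F y" using ex_ortho_comb[of E F] assms by blast
  from projection_error[OF this assms] show ?thesis by (smt (verit) zero_le_power2)
qed

lemma bessel_summable:
  assumes "ortho E" "x \<in> C" shows "(\<lambda>e. (cmod (ip e x))\<^sup>2) summable_on E"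
proof (rule nonneg_bdd_above_summable_on)
  show "bdd_above (sum (\<lambda>e. (cmod (ip e x))\<^sup>2) ` {F. F \<subseteq> E \<and> finite F})"
    by (rule bdd_aboveI2[of _ _ "(nrm x)\<^sup>2"]) (use bessel assms in auto)
qed simp

lemma ex_onb: "\<exists>E. onb E"
proof -
  have "\<exists>M\<in>Collect ortho. \<forall>X\<in>Collect ortho. M \<subseteq> X \<longrightarrow> X = M"
  proof (rule subset_Zorn')
    fix K assume K: "subset.chain (Collect ortho) K"
    have "ip e f = (if e = f then 1 else 0)" if ef: "e \<in> \<Union>K" "f \<in> \<Union>K" for e f
    proof -
      obtain A B where AB: "A \<in> K" "B \<in> K" "e \<in> A" "f \<in> B" using ef by blast
      then have "A \<subseteq> B \<or> B \<subseteq> A" using K by (auto simp: subset_chain_def)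
      then obtain D where "D \<in> K" "e \<in> D" "f \<in> D" using AB by blast
      then show ?thesis using K by (auto simp: subset_chain_def ortho_def)
    qed
    moreover have "\<Union>K \<subseteq> C" using K unfolding subset_chain_def ortho_def by blast
    ultimately show "\<Union>K \<in> Collect ortho" by (simp add: ortho_def)
  qed
  then obtain E where E: "ortho E" "\<And>X. ortho X \<Longrightarrow> E \<subseteq> X \<Longrightarrow> X = E" by auto
  have "nrm x = 0" if x: "x \<in> C" "\<forall>e\<in>E. ip e x = 0" for x
  proof (rule ccontr)
    assume n: "nrm x \<noteq> 0"
    define e where "e = scl (complex_of_real (1 / nrm x)) x"
    have e: "e \<in> C" using x(1) by (simp add: e_def)
    have "nrm e = 1" using x(1) n by (simp add: e_def nrm_scl norm_divide)
    then have e1: "ip e e = 1" using ip_self[OF e] by simp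
    have "\<forall>f\<in>E. ip f e = 0" using x E(1) by (auto simp: e_def ortho_def ip_simps)
    moreover from this have "\<forall>f\<in>E. ip e f = 0"
      using e E(1) ip_cnj by (metis complex_cnj_zero ortho_def subsetD)
    ultimately have "ortho (insert e E)" using E(1) e e1 by (auto simp: ortho_def)
    then have "e \<in> E" using E(2) by blast
    then show False using \<open>\<forall>f\<in>E. ip f e = 0\<close> e1 by auto
  qed
  with E show ?thesis by (auto simp: onb_def)
qed

text \<open>Choose finite sets F n whose finite supersets all have sums within 1/(n + 1) of S. The
  corresponding combinations form a Cauchy sequence; its limit has the prescribed coordinates and
  norm.\<close>

lemma riesz_fischer:
  assumes E: "ortho E" and S: "((\<lambda>e. (cmod (f e))\<^sup>2) has_sum S) E"
  shows "\<exists>x\<in>C. (\<forall>e\<in>E. ip e x = f e) \<and> (nrm x)\<^sup>2 = S"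
proof -
  define a where "a e = (cmod (f e))\<^sup>2" for e
  have "\<exists>F. finite F \<and> F \<subseteq> E \<and> (\<forall>G. finite G \<and> F \<subseteq> G \<and> G \<subseteq> E \<longrightarrow> \<bar>sum a G - S\<bar> < 1 / real (Suc n))" for n
  proof -
    have "\<forall>\<^sub>F F in finite_subsets_at_top E. dist (sum a F) S < 1 / real (Suc n)"
      using S unfolding has_sum_def a_def by (rule tendstoD) simp
    then show ?thesis by (auto simp: eventually_finite_subsets_at_top dist_real_def)
  qed
  then obtain F where F: "\<And>n. finite (F n)" "\<And>n. F n \<subseteq> E"
    "\<And>n G. finite G \<Longrightarrow> F n \<subseteq> G \<Longrightarrow> G \<subseteq> E \<Longrightarrow> \<bar>sum a G - S\<bar> < 1 / real (Suc n)" by metis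
  have "\<forall>n. \<exists>y. comb f (F n) y" using ex_comb F E by (meson ortho_def order_trans)
  then obtain y where y: "\<And>n. comb f (F n) (y n)" by metis
  have yC: "y n \<in> C" for n using y by (simp add: comb_def)
  have inv: "(\<lambda>n. 1 / real (Suc n)) \<longlonglongrightarrow> 0" using LIMSEQ_inverse_real_of_nat by (simp add: inverse_eq_divide)
  \<comment> \<open>The square distance is the sum over the symmetric difference, that is, twice the
    sum over the union minus the two separate sums; each of these is close to S.\<close>
  have d: "(nrm (sub (y m) (y n)))\<^sup>2 \<le> 2 * (1 / real (Suc m) + 1 / real (Suc n))" for m n
  proof -
    have "sum a (F m \<union> F n) = sum a (F m) + sum a (F n) - sum a (F m \<inter> F n)"
      using sum.union_inter[OF F(1)[of m] F(1)[of n], of a] by simp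
    moreover have "(nrm (sub (y m) (y n)))\<^sup>2 = sum a (F m) - 2 * sum a (F m \<inter> F n) + sum a (F n)"
      using nrm_sub_sq[OF yC yC] comb_ip_comb[OF y y E F(1,2) F(1,2)] comb_nrm[OF y E F(1,2)]
      by (simp add: a_def)
    moreover have "\<bar>sum a (F m \<union> F n) - S\<bar> < 1 / real (Suc m)" "\<bar>sum a (F m \<union> F n) - S\<bar> < 1 / real (Suc n)"
      "\<bar>sum a (F m) - S\<bar> < 1 / real (Suc m)" "\<bar>sum a (F n) - S\<bar> < 1 / real (Suc n)"
      by (rule F(3); use F(1,2) in auto)+
    ultimately show ?thesis by (simp add: abs_less_iff)
  qed
  have cy: "cseq y" unfolding cseq_def
  proof (intro conjI allI impI)
    fix e :: real assume e: "e > 0"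
    obtain N where N: "\<And>n. n \<ge> N \<Longrightarrow> 1 / real (Suc n) < e\<^sup>2 / 4"
      using order_tendstoD(2)[OF inv, of "e\<^sup>2/4"] e by (auto simp: eventually_sequentially)
    have "nrm (sub (y m) (y n)) < e" if "m \<ge> N" "n \<ge> N" for m n
    proof (rule power_less_imp_less_base)
      show "(nrm (sub (y m) (y n)))\<^sup>2 < e\<^sup>2" using d[of m n] N[OF that(1)] N[OF that(2)] by simp
    qed (use e in simp)
    then show "\<exists>N. \<forall>m\<ge>N. \<forall>n\<ge>N. nrm (sub (y m) (y n)) < e" by blast
  qed (rule yC)
  obtain x where x: "x \<in> C" "(\<lambda>n. nrm (sub (y n) x)) \<longlonglongrightarrow> 0" using complete[OF cy] by blast
  have ipx: "(\<lambda>n. ip z (y n)) \<longlonglongrightarrow> ip z x" if z: "z \<in> C" for z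
  proof (rule LIM_zero_cancel, rule tendsto_norm_zero_cancel, rule tendsto_sandwich[OF _ _ tendsto_const])
    show "(\<lambda>n. nrm z * nrm (sub (y n) x)) \<longlonglongrightarrow> 0" using tendsto_mult_right_zero[OF x(2)] .
    have "norm (ip z (y n) - ip z x) \<le> nrm z * nrm (sub (y n) x)" for n
      using Cauchy_Schwarz[of z "sub (y n) x"] z x yC by (simp add: ip_simps)
    then show "\<forall>\<^sub>F n in sequentially. norm (ip z (y n) - ip z x) \<le> nrm z * nrm (sub (y n) x)" by simp
  qed simp
  have "ip e x = f e" if e: "e \<in> E" for e
  proof -
    \<comment> \<open>If e is missing from F n, adding it changes the sum by the square of its
      coefficient, yet both sums are within 1/(n + 1) of S.\<close>
    have b: "(norm (ip e (y n) - f e))\<^sup>2 \<le> 2 * (1 / real (Suc n))" for n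
    proof (cases "e \<in> F n")
      case True then show ?thesis using comb_coord[OF y E F(1,2) e] by simp
    next
      case False
      then have "sum a (insert e (F n)) = a e + sum a (F n)" using F(1) by simp
      moreover have "\<bar>sum a (insert e (F n)) - S\<bar> < 1 / real (Suc n)" "\<bar>sum a (F n) - S\<bar> < 1 / real (Suc n)"
        by (rule F(3); use F(1,2) e in auto)+
      moreover have "ip e (y n) = 0" using comb_coord[OF y E F(1,2) e] False by simp
      ultimately show ?thesis by (simp add: a_def)
    qed
    have "(\<lambda>n. (norm (ip e (y n) - f e))\<^sup>2) \<longlonglongrightarrow> (norm (ip e x - f e))\<^sup>2"
      by (intro tendsto_intros ipx) (use e E in \<open>auto simp: ortho_def\<close>)
    moreover have "(\<lambda>n. 2 * (1 / real (Suc n))) \<longlonglongrightarrow> 0" using tendsto_mult_right_zero[OF inv] .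
    ultimately have "(norm (ip e x - f e))\<^sup>2 \<le> 0" using b by (intro LIMSEQ_le) auto
    then show ?thesis by simp
  qed
  moreover have "(nrm x)\<^sup>2 = S"
  proof (rule LIMSEQ_unique)
    show "(\<lambda>n. sum a (F n)) \<longlonglongrightarrow> S"
    proof (rule LIM_zero_cancel, rule tendsto_norm_zero_cancel, rule tendsto_sandwich[OF _ _ tendsto_const inv])
      show "\<forall>\<^sub>F n in sequentially. norm (sum a (F n) - S) \<le> 1 / real (Suc n)"
        using F by (intro always_eventually allI less_imp_le) (simp add: F(3))
    qed simp
    have "(\<lambda>n. nrm (y n)) \<longlonglongrightarrow> nrm x"
    proof (rule LIM_zero_cancel, rule tendsto_norm_zero_cancel, rule tendsto_sandwich[OF _ _ tendsto_const x(2)])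
      have "norm (nrm (y n) - nrm x) \<le> nrm (sub (y n) x)" for n
        using nrm_le_add[OF yC[of n] x(1)] nrm_le_add[OF x(1) yC[of n]] nrm_sub_commute[OF yC[of n] x(1)] by simp
      then show "\<forall>\<^sub>F n in sequentially. norm (nrm (y n) - nrm x) \<le> nrm (sub (y n) x)" by simp
    qed simp
    from tendsto_power[OF this, of 2] show "(\<lambda>n. sum a (F n)) \<longlonglongrightarrow> (nrm x)\<^sup>2"
      using comb_nrm[OF y E F(1,2)] by (simp add: a_def)
  qed
  ultimately show ?thesis using x(1) by blast
qed

text \<open>The vector rebuilt by Riesz-Fischer from the coordinates of x differs from x by a vector
  orthogonal to the basis, hence null.\<close>

lemma parseval_nrm:
  assumes "onb E" "x \<in> C" shows "((\<lambda>e. (cmod (ip e x))\<^sup>2) has_sum (nrm x)\<^sup>2) E"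
proof -
  have E: "ortho E" using assms by (simp add: onb_def)
  have h: "((\<lambda>e. (cmod (ip e x))\<^sup>2) has_sum (\<Sum>\<^sub>\<infinity>e\<in>E. (cmod (ip e x))\<^sup>2)) E"
    using bessel_summable[OF E assms(2)] by (rule has_sum_infsum)
  obtain y where y: "y \<in> C" "\<And>e. e \<in> E \<Longrightarrow> ip e y = ip e x" "(nrm y)\<^sup>2 = (\<Sum>\<^sub>\<infinity>e\<in>E. (cmod (ip e x))\<^sup>2)"
    using riesz_fischer[OF E h] by blast
  have "\<forall>e\<in>E. ip e (sub x y) = 0" using y E assms by (auto simp: ip_simps ortho_def)
  then have "nrm (sub x y) = 0" using assms y(1) by (auto simp: onb_def)
  then have "nrm x = nrm y" using assms(2) y(1) by (intro nrm_cong ip_eq_if_nrm_sub_0)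
  then show ?thesis using h y by simp
qed

lemma parseval:
  assumes "onb E" "x \<in> C" "y \<in> C" shows "((\<lambda>e. cnj (ip e x) * ip e y) has_sum ip x y) E"
proof -
  have EC: "e \<in> C" if "e \<in> E" for e using assms that by (auto simp: onb_def ortho_def)
  \<comment> \<open>Polarization, with differences written as sums with a factor -1 so that the
    summation rules for sums and multiples apply literally.\<close>
  define Q where "Q z1 z2 z3 z4 = (1/4) * ((complex_of_real z1 + (-1) * complex_of_real z2)
     + (-\<i>) * (complex_of_real z3 + (-1) * complex_of_real z4))" for z1 z2 z3 z4
  have pol: "cnj a * b = Q ((cmod (a + b))\<^sup>2) ((cmod (a - b))\<^sup>2) ((cmod (a + \<i> * b))\<^sup>2) ((cmod (a - \<i> * b))\<^sup>2)" for a b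
    unfolding complex_norm_square Q_def by (simp add: algebra_simps)
  have ii: "complex_of_real ((nrm z)\<^sup>2) = ip z z" if "z \<in> C" for z using ip_self[OF that] by simp
  have "((\<lambda>e. Q ((cmod (ip e (add x y)))\<^sup>2) ((cmod (ip e (sub x y)))\<^sup>2)
         ((cmod (ip e (add x (scl \<i> y))))\<^sup>2) ((cmod (ip e (sub x (scl \<i> y))))\<^sup>2))
    has_sum Q ((nrm (add x y))\<^sup>2) ((nrm (sub x y))\<^sup>2) ((nrm (add x (scl \<i> y)))\<^sup>2) ((nrm (sub x (scl \<i> y)))\<^sup>2)) E"
    unfolding Q_def
    by (intro has_sum_cmult_right has_sum_add has_sum_of_real parseval_nrm assms add_closed sub_closed scl_closed)
  also have "Q ((nrm (add x y))\<^sup>2) ((nrm (sub x y))\<^sup>2) ((nrm (add x (scl \<i> y)))\<^sup>2) ((nrm (sub x (scl \<i> y)))\<^sup>2) = ip x y"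
    unfolding Q_def using assms ii by (simp add: ip_simps algebra_simps del: of_real_power)
  finally show ?thesis
    by (rule has_sum_cong[THEN iffD1, rotated]) (use assms EC pol in \<open>simp add: ip_simps\<close>)
qed

text \<open>The conjugated values of \<phi> on the basis are to be the coordinates of z. They are
  square summable: on a combination y with these coefficients, \<phi>(y) is the square norm of y, so
  that norm is at most |K|. Both functionals agree on finite combinations and are bounded.\<close>

lemma ex_representer:
  assumes "clin \<phi>" "\<And>x. x \<in> C \<Longrightarrow> cmod (\<phi> x) \<le> K * nrm x"
  shows "\<exists>z\<in>C. \<forall>x\<in>C. ip z x = \<phi> x"
proof -
  obtain E where E: "onb E" using ex_onb by blast
  then have o: "ortho E" by (simp add: onb_def)
  have bd: "(\<Sum>e\<in>F. (cmod (cnj (\<phi> e)))\<^sup>2) \<le> K\<^sup>2" if F: "finite F" "F \<subseteq> E" for F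
  proof -
    obtain y where y: "comb (\<lambda>e. cnj (\<phi> e)) F y" using ex_ortho_comb[OF o] F by blast
    define s where "s = (\<Sum>e\<in>F. (cmod (cnj (\<phi> e)))\<^sup>2)"
    have "\<phi> y = (\<Sum>e\<in>F. complex_of_real ((cmod (\<phi> e))\<^sup>2))"
      using y assms(1) by (simp add: comb_def complex_norm_square mult.commute del: of_real_power)
    then have "\<phi> y = complex_of_real s" by (simp add: s_def)
    moreover have n: "(nrm y)\<^sup>2 = s" using comb_nrm[OF y o F] by (simp add: s_def)
    moreover have yC: "y \<in> C" using y by (simp add: comb_def)
    moreover have "s \<ge> 0" by (simp add: s_def sum_nonneg)
    ultimately have "nrm y * nrm y \<le> K * nrm y" using assms(2)[of y] by (simp add: power2_eq_square)
    then have "nrm y \<le> K \<or> nrm y = 0" using nrm_nonneg[OF yC] by (auto simp: mult_le_cancel_right)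
    then have "(nrm y)\<^sup>2 \<le> K\<^sup>2"
    proof
      assume "nrm y \<le> K" then show ?thesis using nrm_nonneg[OF yC] by (rule power_mono)
    qed simp
    then show ?thesis using n by (simp add: s_def)
  qed
  have "(\<lambda>e. (cmod (cnj (\<phi> e)))\<^sup>2) summable_on E"
    by (rule nonneg_bdd_above_summable_on, simp, rule bdd_aboveI2[of _ _ "K\<^sup>2"]) (use bd in auto)
  then obtain z where z: "z \<in> C" "\<And>e. e \<in> E \<Longrightarrow> ip e z = cnj (\<phi> e)"
    using riesz_fischer[OF o has_sum_infsum] by metis
  have "ip z x = \<phi> x" if x: "x \<in> C" for x
  proof -
    have "cmod (\<phi> x - ip z x) < e" if e: "e > 0" for e
    proof -
      \<comment> \<open>Dominates the bounds of \<phi> and of the pairing with z together, and is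
        positive, so e / L makes sense.\<close>
      define L where "L = \<bar>K\<bar> + nrm z + 1"
      have L: "L > 0" using nrm_nonneg[OF z(1)] by (simp add: L_def)
      have "\<forall>\<^sub>F F in finite_subsets_at_top E. dist (\<Sum>e\<in>F. (cmod (ip e x))\<^sup>2) ((nrm x)\<^sup>2) < (e / L)\<^sup>2"
        using parseval_nrm[OF E x] unfolding has_sum_def by (rule tendstoD) (use e L in simp)
      then obtain F where F: "finite F" "F \<subseteq> E" "dist (\<Sum>e\<in>F. (cmod (ip e x))\<^sup>2) ((nrm x)\<^sup>2) < (e / L)\<^sup>2"
        by (auto simp: eventually_finite_subsets_at_top)
      obtain y where y: "comb (\<lambda>e. ip e x) F y" using ex_ortho_comb[OF o] F by blast
      have yC: "y \<in> C" using y by (simp add: comb_def)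
      have "(nrm (sub x y))\<^sup>2 < (e / L)\<^sup>2" using projection_error[OF y o F(1,2) x] F(3) by (simp add: dist_real_def)
      then have n: "nrm (sub x y) < e / L" by (rule power_less_imp_less_base) (use e L in simp)
      have "ip z e = \<phi> e" if "e \<in> F" for e
      proof -
        have "e \<in> E" "e \<in> C" using that F(2) o by (auto simp: ortho_def)
        then show ?thesis using z(2)[of e] ip_cnj[of e z] z(1) by simp
      qed
      then have "ip z y = \<phi> y" using comb_ip[OF y z(1)] y assms(1) by (simp add: comb_def)
      moreover have "\<phi> (sub x y) = \<phi> x - \<phi> y" using assms(1) x yC by (simp add: clin_def sub_def)
      ultimately have "\<phi> x - ip z x = \<phi> (sub x y) - ip z (sub x y)" using x yC z(1) by (simp add: ip_simps)
      then have "cmod (\<phi> x - ip z x) \<le> cmod (\<phi> (sub x y)) + cmod (ip z (sub x y))"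
        by (simp add: norm_triangle_ineq4)
      also have "\<dots> \<le> K * nrm (sub x y) + nrm z * nrm (sub x y)"
        by (intro add_mono assms(2) Cauchy_Schwarz) (use x yC z in auto)
      also have "\<dots> \<le> L * nrm (sub x y)"
      proof -
        have "(K + nrm z) * nrm (sub x y) \<le> L * nrm (sub x y)"
          by (rule mult_right_mono) (use x yC in \<open>auto simp: L_def\<close>)
        then show ?thesis by (simp add: algebra_simps)
      qed
      also have "\<dots> < e" using n L by (simp add: field_simps)
      finally show ?thesis .
    qed
    from this[of "cmod (\<phi> x - ip z x)"] show ?thesis by force
  qed
  with z(1) show ?thesis by blast
qed

text \<open>By totality every basis vector meets some generator, and by Bessel each generator meets
  only countably many basis vectors. A generator together with a number in that countable set
  identifies the basis vector.\<close>

lemma onb_inject: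
  fixes gen :: "'s \<Rightarrow> 'v"
  assumes E: "onb E" and gen: "\<And>s. gen s \<in> C"
    and total: "\<And>x. x \<in> C \<Longrightarrow> (\<And>s. ip (gen s) x = 0) \<Longrightarrow> nrm x = 0"
  shows "\<exists>\<iota> :: 'v \<Rightarrow> 's \<times> nat. inj_on \<iota> E"
proof -
  have o: "ortho E" using E by (simp add: onb_def)
  define B where "B s = {e\<in>E. ip e (gen s) \<noteq> 0}" for s
  have cB: "countable (B s)" for s
  proof -
    have "(\<lambda>e. (cmod (ip e (gen s)))\<^sup>2) summable_on E" using bessel_summable[OF o gen] .
    then have "countable {e\<in>E. (cmod (ip e (gen s)))\<^sup>2 \<noteq> 0}"
      by (rule summable_countable_real)
    then show ?thesis by (simp add: B_def)
  qed
  have "\<exists>s. e \<in> B s" if e: "e \<in> E" for e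
  proof (rule ccontr)
    assume n: "\<not> ?thesis"
    have eC: "e \<in> C" "ip e e = 1" using o e by (auto simp: ortho_def)
    have "ip (gen s) e = 0" for s
      using n e ip_cnj[of e "gen s"] gen eC by (simp add: B_def)
    then show False using total[OF eC(1)] eC by (simp add: nrm_def)
  qed
  then obtain s where s: "\<And>e. e \<in> E \<Longrightarrow> e \<in> B (s e)" by metis
  have "inj_on (\<lambda>e. (s e, to_nat_on (B (s e)) e)) E"
  proof (rule inj_onI)
    fix e f assume ef: "e \<in> E" "f \<in> E" "(s e, to_nat_on (B (s e)) e) = (s f, to_nat_on (B (s f)) f)"
    then have "e \<in> B (s e)" "f \<in> B (s e)" "to_nat_on (B (s e)) e = to_nat_on (B (s e)) f"
      using s by (metis prod.inject)+
    then show "e = f" using inj_on_to_nat_on[OF cB[of "s e"]] by (meson inj_onD)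
  qed
  then show ?thesis by blast
qed

end

section \<open>Coordinates in \<open>l2 I\<close>, bounded operators and adjoints\<close>

context semi_hilbert
begin

text \<open>\<open>J\<close> plays the role of a unitary onto \<open>l2 I\<close>, but is injective
  only modulo null vectors; the last clause turns equality of all pairings into genuine equality of
  coordinates.\<close>

definition l2_model :: "'i set \<Rightarrow> ('v \<Rightarrow> 'i \<Rightarrow> complex) \<Rightarrow> bool" where
  "l2_model I J \<longleftrightarrow> (\<forall>x\<in>C. J x \<in> l2 I) \<and> (\<forall>f\<in>l2 I. \<exists>x\<in>C. J x = f) \<and>
     (\<forall>x\<in>C. \<forall>y\<in>C. J (add x y) = (\<lambda>i. J x i + J y i)) \<and>
     (\<forall>x\<in>C. \<forall>c. J (scl c x) = (\<lambda>i. c * J x i)) \<and>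
     (\<forall>x\<in>C. \<forall>y\<in>C. l2_inner I (J x) (J y) = ip x y) \<and>
     (\<forall>x\<in>C. l2_norm I (J x) = nrm x) \<and>
     (\<forall>x\<in>C. \<forall>y\<in>C. (\<forall>z\<in>C. ip z x = ip z y) \<longrightarrow> J x = J y)"

lemma ex_l2_model:
  assumes E: "onb E" and c: "inj_on c E"
  shows "l2_model (c ` E) (\<lambda>x i. if i \<in> c ` E then ip (inv_into E c i) x else 0)"
    (is "l2_model ?I ?J")
proof -
  have EC: "e \<in> C" if "e \<in> E" for e using E that by (auto simp: onb_def ortho_def)
  have o: "ortho E" using E by (simp add: onb_def)
  have Jc: "?J x (c e) = ip e x" if "e \<in> E" for x e using that c by simp
  have sq: "((\<lambda>i. (cmod (?J x i))\<^sup>2) has_sum (nrm x)\<^sup>2) ?I" if "x \<in> C" for x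
  proof -
    have "((\<lambda>e. (cmod (?J x (c e)))\<^sup>2) has_sum (nrm x)\<^sup>2) E"
      by (rule has_sum_cong[THEN iffD2, OF _ parseval_nrm[OF E that]]) (simp add: c)
    then show ?thesis by (subst has_sum_reindex[OF c]) (simp add: o_def)
  qed
  have inn: "((\<lambda>i. cnj (?J x i) * ?J y i) has_sum ip x y) ?I" if "x \<in> C" "y \<in> C" for x y
  proof -
    have "((\<lambda>e. cnj (?J x (c e)) * ?J y (c e)) has_sum ip x y) E"
      by (rule has_sum_cong[THEN iffD2, OF _ parseval[OF E that]]) (simp add: c)
    then show ?thesis by (subst has_sum_reindex[OF c]) (simp add: o_def)
  qed
  have surj: "\<exists>x\<in>C. ?J x = f" if f: "f \<in> l2 ?I" for f
  proof -
    have "(\<lambda>i. (cmod (f i))\<^sup>2) summable_on ?I" using f by (simp add: l2_def)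
    then have "(\<lambda>e. (cmod (f (c e)))\<^sup>2) summable_on E"
      using summable_on_reindex[OF c, of "\<lambda>i. (cmod (f i))\<^sup>2"] by (simp add: o_def)
    then obtain x where x: "x \<in> C" "\<And>e. e \<in> E \<Longrightarrow> ip e x = f (c e)"
      using riesz_fischer[OF o has_sum_infsum, of "\<lambda>e. f (c e)"] by blast
    have "?J x = f"
    proof
      fix i show "?J x i = f i"
      proof (cases "i \<in> ?I")
        case True
        then obtain e where "e \<in> E" "i = c e" by blast
        then show ?thesis using x(2) c by simp
      next
        case False
        then show ?thesis using f by (auto simp: l2_def)
      qed
    qed
    with x(1) show ?thesis by blast
  qed
  have inv: "inv_into E c i \<in> C" if "i \<in> ?I" for i using that EC c by auto
  show ?thesis unfolding l2_model_def
  proof (intro conjI ballI allI impI)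
    fix x assume x: "x \<in> C"
    show "?J x \<in> l2 ?I" using has_sum_imp_summable[OF sq[OF x]] by (simp add: l2_def)
    show "l2_norm ?I (?J x) = nrm x" using infsumI[OF sq[OF x]] x by (simp add: l2_norm_def)
    show "?J (scl k x) = (\<lambda>i. k * ?J x i)" for k using x inv by (auto simp: ip_simps)
    fix y assume y: "y \<in> C"
    show "?J (add x y) = (\<lambda>i. ?J x i + ?J y i)" using x y inv by (auto simp: ip_simps)
    show "l2_inner ?I (?J x) (?J y) = ip x y" using infsumI[OF inn[OF x y]] by (simp add: l2_inner_def)
    assume "\<forall>z\<in>C. ip z x = ip z y"
    then show "?J x = ?J y" using inv by auto
  qed (rule surj)
qed

text \<open>Linearity is demanded only after pairing, because the maps in use respect sums and
  multiples up to null vectors.\<close>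

definition bop :: "real \<Rightarrow> ('v \<Rightarrow> 'v) \<Rightarrow> bool" where
  "bop K \<Phi> \<longleftrightarrow> (\<forall>x\<in>C. \<Phi> x \<in> C) \<and> (\<forall>z\<in>C. clin (\<lambda>x. ip z (\<Phi> x))) \<and> (\<forall>x\<in>C. nrm (\<Phi> x) \<le> K * nrm x)"

lemma bop_closed: "bop K \<Phi> \<Longrightarrow> x \<in> C \<Longrightarrow> \<Phi> x \<in> C" by (simp add: bop_def)

lemma bop_ip_sub:
  assumes "bop K \<Phi>" "x \<in> C" "y \<in> C" "z \<in> C"
  shows "ip z (\<Phi> (sub x y)) = ip z (sub (\<Phi> x) (\<Phi> y))"
  using assms by (simp add: bop_def clin_def sub_def ip_simps)

lemma bop_nrm_sub:
  assumes "bop K \<Phi>" "x \<in> C" "y \<in> C"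
  shows "nrm (sub (\<Phi> x) (\<Phi> y)) \<le> K * nrm (sub x y)"
proof -
  have "nrm (sub (\<Phi> x) (\<Phi> y)) = nrm (\<Phi> (sub x y))"
    using assms by (intro nrm_cong) (auto simp: bop_ip_sub bop_closed)
  then show ?thesis using assms by (simp add: bop_def)
qed

text \<open>The Riesz vector of x \<mapsto> <y, \<Phi> x> is the value at y. The bound follows from
  |\<Psi> y|^2 = <y, \<Phi> \<Psi> y>; nonnegativity of K covers the case of a null \<Psi>
  y.\<close>

lemma ex_adjoint:
  assumes \<Phi>: "bop K \<Phi>" and K: "K \<ge> 0"
  shows "\<exists>\<Psi>. bop K \<Psi> \<and> (\<forall>x\<in>C. \<forall>y\<in>C. ip (\<Phi> x) y = ip x (\<Psi> y))"
proof -
  have "\<exists>z\<in>C. \<forall>x\<in>C. ip z x = ip y (\<Phi> x)" if y: "y \<in> C" for y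
  proof (rule ex_representer[where K = "K * nrm y"])
    show "clin (\<lambda>x. ip y (\<Phi> x))" using \<Phi> y by (simp add: bop_def)
    fix x assume x: "x \<in> C"
    have "cmod (ip y (\<Phi> x)) \<le> nrm y * nrm (\<Phi> x)" using \<Phi> x y by (intro Cauchy_Schwarz) (auto simp: bop_closed)
    also have "\<dots> \<le> nrm y * (K * nrm x)" using \<Phi> x y by (intro mult_left_mono) (auto simp: bop_def)
    finally show "cmod (ip y (\<Phi> x)) \<le> K * nrm y * nrm x" by (simp add: mult_ac)
  qed
  then obtain \<Psi> where \<Psi>: "\<And>y. y \<in> C \<Longrightarrow> \<Psi> y \<in> C" "\<And>x y. x \<in> C \<Longrightarrow> y \<in> C \<Longrightarrow> ip (\<Psi> y) x = ip y (\<Phi> x)"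
    by metis
  have adj: "ip (\<Phi> x) y = ip x (\<Psi> y)" if "x \<in> C" "y \<in> C" for x y
    using \<Psi>(2)[OF that] ip_cnj[of y "\<Phi> x"] ip_cnj[of "\<Psi> y" x] \<Psi>(1)[OF that(2)] that bop_closed[OF \<Phi>] by simp
  have "bop K \<Psi>" unfolding bop_def
  proof (intro conjI ballI)
    show "clin (\<lambda>x. ip z (\<Psi> x))" if "z \<in> C" for z
    proof -
      have "clin (\<lambda>x. ip (\<Phi> z) x)" using that \<Phi> bop_closed by (intro clin_ip) auto
      then show ?thesis using adj that by (simp add: clin_def)
    qed
    fix y assume y: "y \<in> C"
    have "nrm (\<Psi> y) * nrm (\<Psi> y) = cmod (ip y (\<Phi> (\<Psi> y)))"
    proof -
      have "complex_of_real ((nrm (\<Psi> y))\<^sup>2) = ip y (\<Phi> (\<Psi> y))"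
        using \<Psi>(2)[of "\<Psi> y" y] ip_self[of "\<Psi> y"] \<Psi>(1)[OF y] y by metis
      then have "cmod (ip y (\<Phi> (\<Psi> y))) = (nrm (\<Psi> y))\<^sup>2" by (metis abs_power2 norm_of_real)
      then show ?thesis by (simp add: power2_eq_square)
    qed
    also have "\<dots> \<le> nrm y * nrm (\<Phi> (\<Psi> y))" using y \<Psi>(1) \<Phi> by (intro Cauchy_Schwarz) (auto simp: bop_closed)
    also have "\<dots> \<le> nrm y * (K * nrm (\<Psi> y))" using \<Phi> \<Psi>(1) y by (intro mult_left_mono) (auto simp: bop_def)
    finally have "nrm (\<Psi> y) * nrm (\<Psi> y) \<le> (K * nrm y) * nrm (\<Psi> y)" by (simp add: mult_ac)
    moreover have "0 \<le> K * nrm y" "0 \<le> nrm (\<Psi> y)" using K y \<Psi>(1) by auto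
    ultimately show "nrm (\<Psi> y) \<le> K * nrm y" by (metis mult_le_cancel_right less_eq_real_def)
  qed (rule \<Psi>(1))
  with adj show ?thesis by blast
qed

end

locale hilbert_model = semi_hilbert C add scl ip
  for C :: "'v set" and add scl ip +
  fixes I :: "'i set" and J :: "'v \<Rightarrow> 'i \<Rightarrow> complex"
  assumes model: "l2_model I J"
begin

lemma J_l2: "x \<in> C \<Longrightarrow> J x \<in> l2 I"
  and J_surj: "f \<in> l2 I \<Longrightarrow> \<exists>x\<in>C. J x = f"
  and J_add: "x \<in> C \<Longrightarrow> y \<in> C \<Longrightarrow> J (add x y) = (\<lambda>i. J x i + J y i)"
  and J_scl: "x \<in> C \<Longrightarrow> J (scl c x) = (\<lambda>i. c * J x i)"
  and J_inner: "x \<in> C \<Longrightarrow> y \<in> C \<Longrightarrow> l2_inner I (J x) (J y) = ip x y"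
  and J_norm: "x \<in> C \<Longrightarrow> l2_norm I (J x) = nrm x"
  and J_eqI: "x \<in> C \<Longrightarrow> y \<in> C \<Longrightarrow> (\<And>z. z \<in> C \<Longrightarrow> ip z x = ip z y) \<Longrightarrow> J x = J y"
  using model unfolding l2_model_def by blast+

definition opr :: "('v \<Rightarrow> 'v) \<Rightarrow> ('i \<Rightarrow> complex) \<Rightarrow> 'i \<Rightarrow> complex" where
  "opr \<Phi> f = J (\<Phi> (SOME x. x \<in> C \<and> J x = f))"

lemma J_sub: "x \<in> C \<Longrightarrow> y \<in> C \<Longrightarrow> J (sub x y) = (\<lambda>i. J x i - J y i)"
  by (simp add: sub_def J_add J_scl)

text \<open>The chosen preimage is immaterial: two preimages differ by a null vector, and a bounded
  map sends null differences to null differences.\<close>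

lemma opr_J:
  assumes "bop K \<Phi>" "x \<in> C" shows "opr \<Phi> (J x) = J (\<Phi> x)"
proof -
  define y where "y = (SOME y. y \<in> C \<and> J y = J x)"
  have y: "y \<in> C" "J y = J x" using someI[of "\<lambda>y. y \<in> C \<and> J y = J x" x] assms by (auto simp: y_def)
  have "ip z y = ip z x" if "z \<in> C" for z using J_inner[of z y] J_inner[of z x] that y assms by simp
  then have "nrm (sub y x) = 0" using y(1) assms by (simp add: nrm_def ip_simps)
  then have "nrm (sub (\<Phi> y) (\<Phi> x)) \<le> 0" using bop_nrm_sub[OF assms(1) y(1) assms(2)] by simp
  then have "nrm (sub (\<Phi> y) (\<Phi> x)) = 0"
    using nrm_nonneg[of "sub (\<Phi> y) (\<Phi> x)"] bop_closed[OF assms(1)] y(1) assms(2) by (simp add: antisym)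
  then have "J (\<Phi> y) = J (\<Phi> x)"
    using bop_closed[OF assms(1)] y(1) assms(2) by (intro J_eqI ip_eq_if_nrm_sub_0) auto
  then show ?thesis by (simp add: opr_def y_def)
qed

lemma bounded_opr:
  assumes \<Phi>: "bop K \<Phi>" shows "bounded_op I (opr \<Phi>)"
  unfolding bounded_op_def
proof (intro conjI ballI allI exI[of _ K])
  fix f assume "f \<in> l2 I"
  then obtain x where x: "x \<in> C" "f = J x" using J_surj by blast
  show "opr \<Phi> f \<in> l2 I" using x \<Phi> by (auto simp: opr_J J_l2 bop_closed)
  show "l2_norm I (opr \<Phi> f) \<le> K * l2_norm I f"
    using x \<Phi> by (simp add: opr_J[OF \<Phi>] J_norm bop_closed[OF \<Phi>]) (simp add: bop_def)
  fix g c d assume "g \<in> l2 I"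
  then obtain y where y: "y \<in> C" "g = J y" using J_surj by blast
  have cl: "\<Phi> x \<in> C" "\<Phi> y \<in> C" "\<Phi> (add (scl c x) (scl d y)) \<in> C"
    using x y bop_closed[OF \<Phi>] by auto
  have "(\<lambda>i. c * f i + d * g i) = J (add (scl c x) (scl d y))"
    using x y by (simp add: J_add J_scl)
  then have "opr \<Phi> (\<lambda>i. c * f i + d * g i) = J (\<Phi> (add (scl c x) (scl d y)))"
    using x y opr_J[OF \<Phi>] by simp
  also have "\<dots> = J (add (scl c (\<Phi> x)) (scl d (\<Phi> y)))"
    using x y \<Phi> cl by (intro J_eqI) (auto simp: bop_def clin_def ip_simps)
  finally show "opr \<Phi> (\<lambda>i. c * f i + d * g i) = (\<lambda>i. c * opr \<Phi> f i + d * opr \<Phi> g i)"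
    using x y cl opr_J[OF \<Phi>] by (simp add: J_add J_scl)
qed

lemma is_adjoint_opr:
  assumes "bop K \<Phi>" "bop L \<Psi>" "\<And>x y. x \<in> C \<Longrightarrow> y \<in> C \<Longrightarrow> ip (\<Phi> x) y = ip x (\<Psi> y)"
  shows "is_adjoint I (opr \<Phi>) (opr \<Psi>)"
  unfolding is_adjoint_def
proof (intro conjI ballI)
  fix f g assume "f \<in> l2 I" "g \<in> l2 I"
  then obtain x y where "x \<in> C" "f = J x" "y \<in> C" "g = J y" using J_surj by metis
  then show "l2_inner I (opr \<Phi> f) g = l2_inner I f (opr \<Psi> g)"
    using assms by (simp add: opr_J[OF assms(1)] opr_J[OF assms(2)] J_inner bop_closed[OF assms(1)] bop_closed[OF assms(2)])
qed (use assms bounded_opr in blast)+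

end

section \<open>Dilations from positive definite kernels\<close>

text \<open>Finite formal linear combinations are lists of pairs of a coefficient and a generator.
  The vector space laws hold for them only up to null vectors, which is all that is needed.\<close>

definition ipl :: "('s \<Rightarrow> 's \<Rightarrow> complex) \<Rightarrow> (complex \<times> 's) list \<Rightarrow> (complex \<times> 's) list \<Rightarrow> complex" where
  "ipl k xs ys = (\<Sum>p\<leftarrow>xs. \<Sum>q\<leftarrow>ys. cnj (fst p) * fst q * k (snd p) (snd q))"

definition scll :: "complex \<Rightarrow> (complex \<times> 's) list \<Rightarrow> (complex \<times> 's) list" where
  "scll c xs = map (\<lambda>p. (c * fst p, snd p)) xs"

definition mapl :: "('s \<Rightarrow> 't) \<Rightarrow> (complex \<times> 's) list \<Rightarrow> (complex \<times> 't) list" where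
  "mapl h xs = map (\<lambda>p. (fst p, h (snd p))) xs"

lemma mapl_simps: "mapl h (xs @ ys) = mapl h xs @ mapl h ys" "mapl h (scll c xs) = scll c (mapl h xs)"
  "mapl h (mapl h' xs) = mapl (\<lambda>s. h (h' s)) xs" "mapl (\<lambda>s. s) xs = xs"
  by (auto simp: mapl_def scll_def)

lemma ipl_mapl: "ipl k (mapl h xs) (mapl h' ys) = ipl (\<lambda>s t. k (h s) (h' t)) xs ys"
  by (simp add: ipl_def mapl_def o_def)

lemma ipl_Nil: "ipl k [] ys = 0"
  by (simp add: ipl_def)

lemma ipl_append_right: "ipl k xs (ys @ zs) = ipl k xs ys + ipl k xs zs"
  by (simp add: ipl_def sum_list_addf)

lemma ipl_scll_right: "ipl k xs (scll c ys) = c * ipl k xs ys"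
  by (simp add: ipl_def scll_def o_def sum_list_const_mult[symmetric] mult_ac)

lemma ipl_kernel_add: "ipl (\<lambda>s t. k s t + k' s t) xs ys = ipl k xs ys + ipl k' xs ys"
  by (simp add: ipl_def sum_list_addf algebra_simps)

lemma ipl_kernel_scale: "ipl (\<lambda>s t. c * k s t) xs ys = c * ipl k xs ys"
  by (simp add: ipl_def sum_list_const_mult[symmetric] mult_ac)

lemma sum_list_swap:
  "(\<Sum>x\<leftarrow>xs. \<Sum>y\<leftarrow>ys. f x y) = (\<Sum>y\<leftarrow>ys. \<Sum>x\<leftarrow>xs. f x y :: 'b::comm_monoid_add)"
  by (induction xs) (simp_all add: sum_list_addf)

lemma sum_list_cnj: "cnj (sum_list (map f xs)) = (\<Sum>x\<leftarrow>xs. cnj (f x))"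
  by (induction xs) auto

lemma ipl_cnj:
  assumes "\<And>s t. k t s = cnj (k s t)" shows "ipl k ys xs = cnj (ipl k xs ys)"
proof -
  have "ipl k ys xs = (\<Sum>q\<leftarrow>ys. \<Sum>p\<leftarrow>xs. cnj (cnj (fst p) * fst q * k (snd p) (snd q)))"
    unfolding ipl_def by (subst assms) (simp add: mult_ac)
  also have "\<dots> = cnj (ipl k xs ys)"
    unfolding ipl_def sum_list_cnj by (rule sum_list_swap)
  finally show ?thesis .
qed

locale pd_kernel =
  fixes k :: "'s \<Rightarrow> 's \<Rightarrow> complex"
  assumes herm: "k t s = cnj (k s t)"
    and psd: "0 \<le> Re (ipl k xs xs)"
begin

sublocale V: semi_inner "UNIV :: (complex \<times> 's) list set" "(@)" scll "ipl k"
proof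
  show "ipl k ys xs = cnj (ipl k xs ys)" for xs ys by (rule ipl_cnj) (rule herm)
qed (auto simp: ipl_append_right ipl_scll_right psd)

sublocale H: semi_hilbert "Collect V.cseq" "\<lambda>X Y n. X n @ Y n" "\<lambda>c X n. scll c (X n)" V.lip
  by (rule V.semi_hilbert_completion)

definition gen_seq :: "'s \<Rightarrow> nat \<Rightarrow> (complex \<times> 's) list" where "gen_seq s = (\<lambda>n. [(1, s)])"

text \<open>Orthogonality to the generators extends to all constant sequences. If x is orthogonal to
  X, the distance from X to x is at least the norm of X, and density makes that distance arbitrarily
  small.\<close>

lemma gen_seq_total:
  assumes X: "V.cseq X" and 0: "\<And>s. V.lip (gen_seq s) X = 0"
  shows "H.nrm X = 0"
proof -
  have c: "V.cseq (\<lambda>n. xs)" for xs using V.cseq_const by blast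
  have xs: "V.lip (\<lambda>n. xs) X = 0" for xs
  proof (induction xs)
    case Nil
    then show ?case by (simp add: V.lip_def ipl_Nil)
  next
    case (Cons p xs)
    have "(\<lambda>n. p # xs) = (\<lambda>n. scll (fst p) (gen_seq (snd p) n) @ xs)" by (simp add: gen_seq_def scll_def)
    then have "V.lip (\<lambda>n. p # xs) X = cnj (fst p) * V.lip (gen_seq (snd p)) X + V.lip (\<lambda>n. xs) X"
      using H.ip_add_left[of "\<lambda>n. scll (fst p) (gen_seq (snd p) n)" "\<lambda>n. xs" X]
        H.ip_scl_left[of "gen_seq (snd p)" X "fst p"] c X H.scl_closed[of "gen_seq (snd p)" "fst p"]
      by (simp add: gen_seq_def)
    then show ?case using Cons 0 by simp
  qed
  have "H.nrm X \<le> e" if e: "e > 0" for e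
  proof -
    obtain x where x: "H.nrm (H.sub X (\<lambda>n. x)) < e" using V.cpl_approx[OF X e] by auto
    have "(H.nrm (H.sub X (\<lambda>n. x)))\<^sup>2 = (H.nrm X)\<^sup>2 - 2 * Re (V.lip X (\<lambda>n. x)) + (H.nrm (\<lambda>n. x))\<^sup>2"
      using X c by (intro H.nrm_sub_sq) auto
    moreover have "V.lip X (\<lambda>n. x) = 0" using xs H.ip_cnj[of "\<lambda>n. x" X] X c by simp
    ultimately have "(H.nrm X)\<^sup>2 \<le> (H.nrm (H.sub X (\<lambda>n. x)))\<^sup>2" by simp
    then have "H.nrm X \<le> H.nrm (H.sub X (\<lambda>n. x))"
      by (rule power2_le_imp_le) (use H.sub_closed[of X "\<lambda>n. x"] X c in simp)
    with x show ?thesis by simp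
  qed
  then show ?thesis using H.nrm_nonneg[of X] X by (meson antisym dense_ge mem_Collect_eq)
qed

definition lift :: "('s \<Rightarrow> 's) \<Rightarrow> (nat \<Rightarrow> (complex \<times> 's) list) \<Rightarrow> nat \<Rightarrow> (complex \<times> 's) list" where
  "lift h X = (\<lambda>n. mapl h (X n))"

lemma mapl_sub: "mapl h (V.sub xs ys) = V.sub (mapl h xs) (mapl h ys)"
  by (simp add: V.sub_def mapl_simps)

lemma bop_lift:
  assumes K: "\<And>xs. V.nrm (mapl h xs) \<le> K * V.nrm xs"
  shows "H.bop K (lift h)"
proof -
  have cl: "V.cseq (lift h X)" if "V.cseq X" for X
    using that K by (auto intro!: V.cseq_lipschitz[of X _ K] simp: lift_def mapl_sub[symmetric])
  show ?thesis unfolding H.bop_def H.clin_def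
  proof (intro conjI ballI allI)
    fix X Y assume "X \<in> Collect V.cseq" "Y \<in> Collect V.cseq"
    then have X: "V.cseq X" "V.cseq Y" by auto
    show "lift h X \<in> Collect V.cseq" using cl X by simp
    show "H.nrm (lift h X) \<le> K * H.nrm X"
      by (rule LIMSEQ_le[OF V.nrm_tendsto[OF cl[OF X(1)]] tendsto_mult_left[OF V.nrm_tendsto[OF X(1)]]])
        (use K in \<open>auto simp: lift_def\<close>)
    fix Z assume "Z \<in> Collect V.cseq"
    then have Z: "V.cseq Z" by simp
    have "lift h (\<lambda>n. X n @ Z n) = (\<lambda>n. lift h X n @ lift h Z n)" by (simp add: lift_def mapl_simps)
    then show "V.lip Y (lift h (\<lambda>n. X n @ Z n)) = V.lip Y (lift h X) + V.lip Y (lift h Z)"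
      using X Z cl H.ip_add_right[of "lift h X" "lift h Z" Y] by simp
  next
    fix X Y c assume "X \<in> Collect V.cseq" "Y \<in> Collect V.cseq"
    moreover have "lift h (\<lambda>n. scll c (X n)) = (\<lambda>n. scll c (lift h X n))" by (simp add: lift_def mapl_simps)
    ultimately show "V.lip Y (lift h (\<lambda>n. scll c (X n))) = c * V.lip Y (lift h X)"
      using cl H.ip_scl_right[of "lift h X" Y c] by simp
  qed
qed

end


text \<open>Isolates what is needed on generators: an action \<alpha> of the algebra, translations
  \<gamma>, and the dilation identity for the kernel. The operator theory is thus carried out once
  for both measures.\<close>

locale dilation_kernel = pd_kernel k
  for k :: "'s \<Rightarrow> 's \<Rightarrow> complex" +
  fixes T :: "real \<Rightarrow> 'a::unital_cstar_algebra \<Rightarrow> 'a"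
    and \<alpha> :: "'a \<Rightarrow> 's \<Rightarrow> 's" and \<gamma> :: "real \<Rightarrow> 's \<Rightarrow> 's"
  assumes T_one_sa: "t \<ge> 0 \<Longrightarrow> cstar (T t 1) = T t 1"
    and \<alpha>_mult: "\<alpha> (a * b) g = \<alpha> a (\<alpha> b g)" and \<alpha>_one: "\<alpha> 1 g = g"
    and \<alpha>_adj: "k (\<alpha> a g) h = k g (\<alpha> (cstar a) h)"
    and \<alpha>_add: "k g (\<alpha> (a + b) h) = k g (\<alpha> a h) + k g (\<alpha> b h)"
    and \<alpha>_scale: "k g (\<alpha> (scaleC c a) h) = c * k g (\<alpha> a h)"
    and faithful: "a \<noteq> 0 \<Longrightarrow> \<exists>g. k g (\<alpha> (cstar a * a) g) \<noteq> 0"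
    and \<gamma>_zero: "\<gamma> 0 g = g"
    and \<gamma>_add: "s \<ge> 0 \<Longrightarrow> t \<ge> 0 \<Longrightarrow> \<gamma> (s + t) g = \<gamma> s (\<gamma> t g)"
    and dilates: "t \<ge> 0 \<Longrightarrow> k (\<gamma> t g) (\<alpha> b (\<gamma> t h)) = k g (\<alpha> (T t b) h)"
begin

abbreviation lact :: "'a \<Rightarrow> (complex \<times> 's) list \<Rightarrow> (complex \<times> 's) list" where
  "lact a \<equiv> mapl (\<alpha> a)"

abbreviation shft :: "real \<Rightarrow> (complex \<times> 's) list \<Rightarrow> (complex \<times> 's) list" where
  "shft t \<equiv> mapl (\<gamma> t)"

lemma lact_mult: "lact (a * b) xs = lact a (lact b xs)"
  by (simp add: mapl_def \<alpha>_mult)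

lemma lact_one: "lact 1 xs = xs"
  by (simp add: mapl_def \<alpha>_one)

lemma ipl_map_right: "ipl k xs (mapl h ys) = ipl (\<lambda>s t. k s (h t)) xs ys"
  using ipl_mapl[of k "\<lambda>s. s" xs h ys] by (simp add: mapl_simps)

lemma lact_adj: "ipl k (lact a xs) ys = ipl k xs (lact (cstar a) ys)"
  using ipl_mapl[of k "\<alpha> a" xs "\<lambda>s. s" ys] by (simp add: mapl_simps ipl_map_right \<alpha>_adj)

lemma lact_add: "ipl k xs (lact (a + b) ys) = ipl k xs (lact a ys) + ipl k xs (lact b ys)"
  by (simp add: ipl_map_right \<alpha>_add ipl_kernel_add)

lemma lact_scale: "ipl k xs (lact (scaleC c a) ys) = c * ipl k xs (lact a ys)"
  by (simp add: ipl_map_right \<alpha>_scale ipl_kernel_scale)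

lemma lact_diff: "ipl k xs (lact (a - b) ys) = ipl k xs (lact a ys) - ipl k xs (lact b ys)"
  using lact_add[of xs "a - b" b ys] by simp

lemma shft_dilates: "t \<ge> 0 \<Longrightarrow> ipl k (shft t xs) (lact b (shft t ys)) = ipl k xs (lact (T t b) ys)"
  by (simp add: mapl_simps ipl_mapl dilates) (simp add: ipl_map_right)

lemma shft_add: "s \<ge> 0 \<Longrightarrow> t \<ge> 0 \<Longrightarrow> shft (s + t) xs = shft s (shft t xs)"
  by (simp add: mapl_def \<gamma>_add)

text \<open>The element norm(a) - a is a square h^2 with h self-adjoint, so its quadratic form at x
  is the square norm of h x.\<close>

lemma lact_sa_le:
  assumes "cstar a = a" shows "Re (ipl k xs (lact a xs)) \<le> norm a * (V.nrm xs)\<^sup>2"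
proof -
  obtain h where h: "pos h" "h * h = norm a *\<^sub>R 1 - a"
    using pos_sqrt[OF pos_norm_diff[OF assms order_refl]] by blast
  have "ipl k (lact h xs) (lact h xs) = ipl k xs (lact (norm a *\<^sub>R 1 - a) xs)"
    by (simp add: lact_adj pos_sa[OF h(1)] lact_mult[symmetric] h(2))
  also have "\<dots> = complex_of_real (norm a) * ipl k xs xs - ipl k xs (lact a xs)"
    by (simp add: lact_diff scaleR_scaleC lact_scale lact_one)
  finally have "Re (ipl k xs (lact a xs)) \<le> norm a * Re (ipl k xs xs)"
    using psd[of "lact h xs"] by simp
  then show ?thesis by (simp add: V.nrm_sq)
qed

lemma nrm_lact: "V.nrm (lact a xs) \<le> norm a * V.nrm xs"
proof (rule power2_le_imp_le)
  have "ipl k (lact a xs) (lact a xs) = ipl k xs (lact (cstar a * a) xs)"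
    by (simp add: lact_adj lact_mult)
  then have "(V.nrm (lact a xs))\<^sup>2 \<le> norm (cstar a * a) * (V.nrm xs)\<^sup>2"
    using lact_sa_le[of "cstar a * a" xs] by (simp add: V.nrm_sq cstar_mult cstar_cstar)
  then show "(V.nrm (lact a xs))\<^sup>2 \<le> (norm a * V.nrm xs)\<^sup>2"
    by (simp add: cstar_identity power_mult_distrib)
qed simp

text \<open>The dilation identity at b = 1 turns the square norm of a translate into the quadratic
  form of \<open>T t 1\<close>.\<close>

lemma nrm_shft: assumes "t \<ge> 0" shows "V.nrm (shft t xs) \<le> sqrt (norm (T t 1)) * V.nrm xs"
proof (rule power2_le_imp_le)
  have "ipl k (shft t xs) (shft t xs) = ipl k xs (lact (T t 1) xs)"
    using shft_dilates[OF assms, of xs 1 xs] by (simp add: lact_one)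
  then show "(V.nrm (shft t xs))\<^sup>2 \<le> (sqrt (norm (T t 1)) * V.nrm xs)\<^sup>2"
    using lact_sa_le[OF T_one_sa[OF assms], of xs] by (simp add: V.nrm_sq power_mult_distrib)
qed simp

lemma bop_lact: "H.bop (norm a) (lift (\<alpha> a))"
  by (rule bop_lift) (rule nrm_lact)

lemma bop_shft: "t \<ge> 0 \<Longrightarrow> H.bop (sqrt (norm (T t 1))) (lift (\<gamma> t))"
  by (rule bop_lift) (rule nrm_shft)

section \<open>Strong continuity of the translations\<close>

definition cont_at :: "(complex \<times> 's) list \<Rightarrow> bool" where
  "cont_at xs \<longleftrightarrow> ((\<lambda>t. V.nrm (V.sub (shft t xs) xs)) \<longlongrightarrow> 0) (at_right 0)"

context
  assumes Tc: "strongly_continuous_sg T" and T0: "T 0 = id"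
begin

lemma T_tendsto: "t \<ge> 0 \<Longrightarrow> ((\<lambda>s. T s b) \<longlongrightarrow> T t b) (at t within {0..})"
  using Tc by (auto simp: strongly_continuous_sg_def continuous_on_def)

lemma T_tendsto_0: "((\<lambda>s. T s b) \<longlongrightarrow> b) (at_right 0)"
proof -
  have "{0::real<..} \<subseteq> {0..}" by auto
  from tendsto_within_subset[OF T_tendsto[OF order_refl] this] show ?thesis using T0 by simp
qed

text \<open>The path t \<mapsto> T_t(1) is continuous, hence bounded on a compact interval. A bound
  uniform in time allows continuity to be checked on a dense set.\<close>

lemma nrm_shft_locally_bounded:
  "\<exists>M>0. \<forall>s\<in>{0..R}. \<forall>xs. V.nrm (shft s xs) \<le> M * V.nrm xs"
proof -
  have "continuous_on {0..} (\<lambda>t. T t 1)" using Tc by (simp add: strongly_continuous_sg_def)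
  then have "continuous_on {0..R} (\<lambda>t. T t 1)" by (rule continuous_on_subset) auto
  then have "compact ((\<lambda>t. T t 1) ` {0..R})" by (rule compact_continuous_image) auto
  then obtain B where B: "\<And>t. t \<in> {0..R} \<Longrightarrow> norm (T t 1) \<le> B"
    using compact_imp_bounded by (force simp: bounded_iff)
  have "V.nrm (shft s xs) \<le> (sqrt \<bar>B\<bar> + 1) * V.nrm xs" if s: "s \<in> {0..R}" for s xs
  proof -
    have "sqrt (norm (T s 1)) \<le> sqrt \<bar>B\<bar>" using B[OF s] by simp
    then have "sqrt (norm (T s 1)) \<le> sqrt \<bar>B\<bar> + 1" by linarith
    then show ?thesis using nrm_shft[of s xs] s by (meson V.nrm_nonneg UNIV_I atLeastAtMost_iff mult_right_mono order_trans)
  qed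
  then show ?thesis by (intro exI[of _ "sqrt \<bar>B\<bar> + 1"]) (auto intro: add_nonneg_pos)
qed

lemma lact_form_tendsto:
  assumes "(f \<longlongrightarrow> a) F" shows "((\<lambda>t. ipl k xs (lact (f t) xs)) \<longlongrightarrow> ipl k xs (lact a xs)) F"
proof (rule LIM_zero_cancel, rule tendsto_0_le[where K = "(V.nrm xs)\<^sup>2"])
  show "((\<lambda>t. norm (f t - a)) \<longlongrightarrow> 0) F" using assms by (simp add: LIM_zero tendsto_norm_zero)
  have "norm (ipl k xs (lact (f t) xs) - ipl k xs (lact a xs)) \<le> V.nrm xs * (norm (f t - a) * V.nrm xs)" for t
    unfolding lact_diff[symmetric]
    by (rule order_trans[OF V.Cauchy_Schwarz mult_left_mono[OF nrm_lact]]) auto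
  then show "\<forall>\<^sub>F t in F. norm (ipl k xs (lact (f t) xs) - ipl k xs (lact a xs)) \<le> norm (norm (f t - a)) * (V.nrm xs)\<^sup>2"
    by (simp add: power2_eq_square mult_ac)
qed

text \<open>The vectors that are right continuous at 0 are closed under sums, multiples,
  translations and left multiplication, so any word can be built from trivial ones.\<close>

lemma cont_at_append: assumes "cont_at xs" "cont_at ys" shows "cont_at (xs @ ys)"
  unfolding cont_at_def
proof (rule tendsto_sandwich[OF _ _ tendsto_const])
  show "((\<lambda>t. V.nrm (V.sub (shft t xs) xs) + V.nrm (V.sub (shft t ys) ys)) \<longlongrightarrow> 0) (at_right 0)"
    using tendsto_add[OF assms[unfolded cont_at_def]] by simp
  have "V.nrm (V.sub (shft t (xs @ ys)) (xs @ ys)) \<le> V.nrm (V.sub (shft t xs) xs) + V.nrm (V.sub (shft t ys) ys)" for t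
  proof -
    have "V.nrm (V.sub (shft t (xs @ ys)) (xs @ ys)) = V.nrm (V.sub (shft t xs) xs @ V.sub (shft t ys) ys)"
      by (rule V.nrm_cong) (auto simp: V.ip_simps mapl_simps)
    then show ?thesis using V.nrm_triangle[of "V.sub (shft t xs) xs" "V.sub (shft t ys) ys"] by simp
  qed
  then show "\<forall>\<^sub>F t in at_right 0. V.nrm (V.sub (shft t (xs @ ys)) (xs @ ys))
      \<le> V.nrm (V.sub (shft t xs) xs) + V.nrm (V.sub (shft t ys) ys)" by simp
qed auto

lemma cont_at_scll: assumes "cont_at xs" shows "cont_at (scll c xs)"
proof -
  have "V.nrm (V.sub (shft t (scll c xs)) (scll c xs)) = cmod c * V.nrm (V.sub (shft t xs) xs)" for t
  proof -
    have "V.nrm (V.sub (shft t (scll c xs)) (scll c xs)) = V.nrm (scll c (V.sub (shft t xs) xs))"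
      by (rule V.nrm_cong) (auto simp: V.ip_simps mapl_simps algebra_simps)
    then show ?thesis by (simp add: V.nrm_scl)
  qed
  then show ?thesis using tendsto_mult_left[OF assms[unfolded cont_at_def], of "cmod c"] by (simp add: cont_at_def)
qed

lemma cont_at_shft: assumes "cont_at xs" "s \<ge> 0" shows "cont_at (shft s xs)"
  unfolding cont_at_def
proof (rule tendsto_sandwich[OF _ _ tendsto_const])
  let ?K = "sqrt (norm (T s 1))"
  show "((\<lambda>t. ?K * V.nrm (V.sub (shft t xs) xs)) \<longlongrightarrow> 0) (at_right 0)"
    using tendsto_mult_left[OF assms(1)[unfolded cont_at_def], of ?K] by simp
  have "V.nrm (V.sub (shft t (shft s xs)) (shft s xs)) \<le> ?K * V.nrm (V.sub (shft t xs) xs)" if "t > 0" for t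
  proof -
    have "shft t (shft s xs) = shft s (shft t xs)"
      using shft_add[of s t xs] shft_add[of t s xs] that assms(2) by (simp add: add.commute)
    then show ?thesis using nrm_shft[OF assms(2), of "V.sub (shft t xs) xs"] by (simp add: mapl_sub)
  qed
  then show "\<forall>\<^sub>F t in at_right 0. V.nrm (V.sub (shft t (shft s xs)) (shft s xs)) \<le> ?K * V.nrm (V.sub (shft t xs) xs)"
    by (auto simp: eventually_at_right_field intro: exI[of _ 1])
qed auto

text \<open>The commutator of a translation and a left multiplication tends to zero: its square norm on
  \<open>x\<close> is \<open>\<langle>x, (b\<^sup>* T\<^sub>t(1) b - 2 Re b\<^sup>* T\<^sub>t(b) + T\<^sub>t(b\<^sup>* b)) x\<rangle>\<close>.\<close>

lemma cont_at_lact: assumes "cont_at xs" shows "cont_at (lact b xs)"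
proof -
  have comm: "((\<lambda>t. V.nrm (V.sub (shft t (lact b xs)) (lact b (shft t xs)))) \<longlongrightarrow> 0) (at_right 0)"
  proof -
    have e: "(V.nrm (V.sub (shft t (lact b xs)) (lact b (shft t xs))))\<^sup>2
       = Re (ipl k xs (lact (cstar b * (T t 1 * b)) xs)) - 2 * Re (ipl k xs (lact (cstar b * T t b) xs))
         + Re (ipl k xs (lact (T t (cstar b * b)) xs))" if t: "t > 0" for t
    proof -
      have 1: "ipl k (shft t (lact b xs)) (shft t (lact b xs)) = ipl k xs (lact (cstar b * (T t 1 * b)) xs)"
        using shft_dilates[of t "lact b xs" 1 "lact b xs"] t by (simp add: lact_one lact_adj lact_mult)
      have 2: "ipl k (shft t (lact b xs)) (lact b (shft t xs)) = ipl k xs (lact (cstar b * T t b) xs)"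
        using shft_dilates[of t "lact b xs" b xs] t by (simp add: lact_adj lact_mult)
      have 3: "ipl k (lact b (shft t xs)) (lact b (shft t xs)) = ipl k xs (lact (T t (cstar b * b)) xs)"
        using shft_dilates[of t xs "cstar b * b" xs] t by (simp add: lact_adj lact_mult)
      show ?thesis by (subst V.nrm_sub_sq) (simp_all add: V.nrm_sq 1 2 3)
    qed
    have "((\<lambda>t. Re (ipl k xs (lact (cstar b * (T t 1 * b)) xs)) - 2 * Re (ipl k xs (lact (cstar b * T t b) xs))
         + Re (ipl k xs (lact (T t (cstar b * b)) xs))) \<longlongrightarrow>
         Re (ipl k xs (lact (cstar b * (1 * b)) xs)) - 2 * Re (ipl k xs (lact (cstar b * b) xs))
         + Re (ipl k xs (lact (cstar b * b) xs))) (at_right 0)"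
      by (intro tendsto_intros lact_form_tendsto T_tendsto_0)
    then have "((\<lambda>t. Re (ipl k xs (lact (cstar b * (T t 1 * b)) xs)) - 2 * Re (ipl k xs (lact (cstar b * T t b) xs))
         + Re (ipl k xs (lact (T t (cstar b * b)) xs))) \<longlongrightarrow> 0) (at_right 0)" by simp
    then have "((\<lambda>t. (V.nrm (V.sub (shft t (lact b xs)) (lact b (shft t xs))))\<^sup>2) \<longlongrightarrow> 0) (at_right 0)"
      by (rule Lim_transform_eventually) (auto simp: eventually_at_right_field e intro!: exI[of _ 1])
    then have "((\<lambda>t. sqrt ((V.nrm (V.sub (shft t (lact b xs)) (lact b (shft t xs))))\<^sup>2)) \<longlongrightarrow> sqrt 0) (at_right 0)"
      by (rule tendsto_real_sqrt)
    then show ?thesis by simp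
  qed
  show ?thesis unfolding cont_at_def
  proof (rule tendsto_sandwich[OF _ _ tendsto_const])
    show "((\<lambda>t. V.nrm (V.sub (shft t (lact b xs)) (lact b (shft t xs)))
        + norm b * V.nrm (V.sub (shft t xs) xs)) \<longlongrightarrow> 0) (at_right 0)"
      using tendsto_add[OF comm tendsto_mult_left[OF assms[unfolded cont_at_def], of "norm b"]] by simp
    have "V.nrm (V.sub (shft t (lact b xs)) (lact b xs)) \<le> V.nrm (V.sub (shft t (lact b xs)) (lact b (shft t xs)))
        + norm b * V.nrm (V.sub (shft t xs) xs)" for t
      using V.nrm_sub_triangle[of "shft t (lact b xs)" "lact b (shft t xs)" "lact b xs"]
        nrm_lact[of b "V.sub (shft t xs) xs"] by (simp add: mapl_sub)
    then show "\<forall>\<^sub>F t in at_right 0. V.nrm (V.sub (shft t (lact b xs)) (lact b xs))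
        \<le> V.nrm (V.sub (shft t (lact b xs)) (lact b (shft t xs))) + norm b * V.nrm (V.sub (shft t xs) xs)" by simp
  qed auto
qed

text \<open>Density and local boundedness carry right continuity at 0 from generators to every X.
  For times m and m + h the difference is \<gamma>_m applied to the difference between h and 0, so
  continuity from both sides follows.\<close>

lemma lift_continuous:
  assumes gens: "\<And>g. cont_at [(1, g)]" and X: "V.cseq X" and t: "t \<ge> 0"
  shows "((\<lambda>s. H.nrm (H.sub (lift (\<gamma> s) X) (lift (\<gamma> t) X))) \<longlongrightarrow> 0) (at t within {0..})"
proof -
  have all: "cont_at xs" for xs
  proof (induction xs)
    case Nil
    then show ?case by (simp add: cont_at_def V.nrm_def V.sub_def mapl_def scll_def ipl_Nil)
  next
    case (Cons p xs)
    have "cont_at (scll (fst p) [(1, snd p)] @ xs)" by (intro cont_at_append cont_at_scll gens Cons)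
    then show ?case by (simp add: scll_def)
  qed
  \<comment> \<open>The window reaches one unit beyond t, to cover times slightly larger than
    t.\<close>
  obtain M where M: "M > 0" "\<And>s xs. s \<in> {0..t+1} \<Longrightarrow> V.nrm (shft s xs) \<le> M * V.nrm xs"
    using nrm_shft_locally_bounded[of "t+1"] by blast
  have bM: "H.bop M (lift (\<gamma> s))" if "s \<in> {0..t+1}" for s by (rule bop_lift) (use M that in auto)
  have cl: "V.cseq (lift (\<gamma> s) X)" if "s \<ge> 0" for s using H.bop_closed[OF bop_shft[OF that], of X] X by simp
  have 0: "\<exists>d>0. \<forall>h\<in>{0..d}. h \<le> t + 1 \<longrightarrow> H.nrm (H.sub (lift (\<gamma> h) X) X) < e" if e: "e > 0" for e
  proof -
    \<comment> \<open>The approximation error is paid twice, once multiplied by M under the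
      translation and once plainly; the other half of e is for the approximant.\<close>
    have pos: "e / (2 * (M + 1)) > 0" "e/2 > 0" using e M(1) by auto
    obtain x where x: "H.nrm (H.sub X (\<lambda>n. x)) < e / (2 * (M + 1))" using V.cpl_approx[OF X pos(1)] by auto
    have xc: "V.cseq (\<lambda>n. xs)" for xs using V.cseq_const by blast
    have "\<forall>\<^sub>F h in at_right 0. V.nrm (V.sub (shft h x) x) < e / 2"
      using order_tendstoD(2)[OF all[of x, unfolded cont_at_def] pos(2)] .
    then obtain d where d: "d > 0" "\<And>h. h > 0 \<Longrightarrow> h < d \<Longrightarrow> V.nrm (V.sub (shft h x) x) < e / 2"
      by (auto simp: eventually_at_right_field)
    have "H.nrm (H.sub (lift (\<gamma> h) X) X) < e" if h: "h \<in> {0..d/2}" "h \<le> t + 1" for h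
    proof -
      have hc: "V.cseq (lift (\<gamma> h) X)" using cl h by simp
      have l: "lift (\<gamma> h) (\<lambda>n. x) = (\<lambda>n. shft h x)" by (simp add: lift_def)
      have s0: "V.nrm (V.sub (shft h x) x) < e / 2"
      proof (cases "h = 0")
        case True
        then have "shft h x = x" by (simp add: mapl_def \<gamma>_zero)
        then show ?thesis using e by simp
      qed (use d h in auto)
      have "H.nrm (H.sub (lift (\<gamma> h) X) X) \<le> H.nrm (H.sub (lift (\<gamma> h) X) (\<lambda>n. shft h x)) + H.nrm (H.sub (\<lambda>n. shft h x) X)"
        by (rule H.nrm_sub_triangle) (use hc X xc in auto)
      also have "\<dots> \<le> H.nrm (H.sub (lift (\<gamma> h) X) (\<lambda>n. shft h x)) + (H.nrm (H.sub (\<lambda>n. shft h x) (\<lambda>n. x)) + H.nrm (H.sub (\<lambda>n. x) X))"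
        by (intro add_left_mono H.nrm_sub_triangle) (use X xc in auto)
      also have "H.nrm (H.sub (lift (\<gamma> h) X) (\<lambda>n. shft h x)) \<le> M * H.nrm (H.sub X (\<lambda>n. x))"
        using H.bop_nrm_sub[OF bM[of h], of X "\<lambda>n. x"] h X xc by (simp add: l)
      also have "H.nrm (H.sub (\<lambda>n. shft h x) (\<lambda>n. x)) = V.nrm (V.sub (shft h x) x)"
        by (rule V.nrm_sub_const_eq) auto
      also have "H.nrm (H.sub (\<lambda>n. x) X) = H.nrm (H.sub X (\<lambda>n. x))"
        by (rule H.nrm_sub_commute) (use X xc in auto)
      finally have "H.nrm (H.sub (lift (\<gamma> h) X) X) < (M + 1) * H.nrm (H.sub X (\<lambda>n. x)) + e / 2"
        using s0 by (simp add: algebra_simps)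
      also have "(M + 1) * H.nrm (H.sub X (\<lambda>n. x)) \<le> (M + 1) * (e / (2 * (M + 1)))"
        using x M(1) by (intro mult_left_mono) auto
      also have "(M + 1) * (e / (2 * (M + 1))) + e / 2 = e" using M(1) by (simp add: field_simps)
      finally show ?thesis by simp
    qed
    then show ?thesis using d(1) by (intro exI[of _ "d/2"]) auto
  qed
  show ?thesis
  proof (rule tendstoI)
    fix e :: real assume e: "e > 0"
    obtain d where d: "d > 0" "\<And>h. 0 \<le> h \<Longrightarrow> h \<le> d \<Longrightarrow> h \<le> t + 1 \<Longrightarrow> H.nrm (H.sub (lift (\<gamma> h) X) X) < e / M"
      using 0[of "e / M"] e M(1) by (auto simp: Ball_def)
    have est: "H.nrm (H.sub (lift (\<gamma> (m + h)) X) (lift (\<gamma> m) X)) < e"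
      if "0 \<le> m" "m \<le> t + 1" "0 \<le> h" "h \<le> d" "h \<le> t + 1" for m h
    proof -
      have "lift (\<gamma> (m + h)) X = lift (\<gamma> m) (lift (\<gamma> h) X)" using that by (simp add: lift_def shft_add)
      then have "H.nrm (H.sub (lift (\<gamma> (m + h)) X) (lift (\<gamma> m) X)) \<le> M * H.nrm (H.sub (lift (\<gamma> h) X) X)"
        using H.bop_nrm_sub[OF bM[of m], of "lift (\<gamma> h) X" X] that X cl by simp
      also have "\<dots> < M * (e / M)" by (rule mult_strict_left_mono) (use d that M in auto)
      finally show ?thesis using M(1) by simp
    qed
    have "H.nrm (H.sub (lift (\<gamma> s) X) (lift (\<gamma> t) X)) < e" if s: "s \<ge> 0" "dist s t < min d 1" for s
    proof (cases "s \<ge> t")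
      case True
      then show ?thesis using est[of t "s - t"] s t by (simp add: dist_real_def)
    next
      case False
      then have "H.nrm (H.sub (lift (\<gamma> t) X) (lift (\<gamma> s) X)) < e"
        using est[of s "t - s"] s t by (simp add: dist_real_def)
      then show ?thesis using H.nrm_sub_commute[of "lift (\<gamma> t) X" "lift (\<gamma> s) X"] cl s t by simp
    qed
    moreover have "0 \<le> H.nrm (H.sub (lift (\<gamma> s) X) (lift (\<gamma> t) X))" if "s \<ge> 0" for s
      using cl that t by (intro H.nrm_nonneg H.sub_closed) auto
    ultimately show "\<forall>\<^sub>F s in at t within {0..}. dist (H.nrm (H.sub (lift (\<gamma> s) X) (lift (\<gamma> t) X))) 0 < e"
      unfolding eventually_at using d(1) by (intro exI[of _ "min d 1"]) (auto simp: dist_real_def)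
  qed
qed

end

text \<open>The maps \<alpha> and \<gamma> lift to the completion and are read in coordinates of an
  orthonormal basis; \<open>code\<close> places that basis inside the required index type.\<close>

theorem ex_elementary_dilation:
  assumes "inj (code :: 's \<times> nat \<Rightarrow> 'i)"
  shows "\<exists>(I :: 'i set) \<phi> c. elementary_dilation T I \<phi> c \<and>
    (strongly_continuous_sg T \<longrightarrow> T 0 = id \<longrightarrow> (\<forall>g. cont_at [(1, g)]) \<longrightarrow> strongly_continuous_op_sg I c)"
proof -
  obtain E where E: "H.onb E" using H.ex_onb by blast
  have "\<exists>\<iota> :: (nat \<Rightarrow> (complex \<times> 's) list) \<Rightarrow> 's \<times> nat. inj_on \<iota> E"
  proof (rule H.onb_inject[OF E, where gen = gen_seq])
    show "gen_seq s \<in> Collect V.cseq" for s using V.cseq_const by (simp add: gen_seq_def)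
    show "H.nrm X = 0" if "X \<in> Collect V.cseq" "\<And>s. V.lip (gen_seq s) X = 0" for X
      using gen_seq_total that by simp
  qed
  then obtain \<iota> :: "(nat \<Rightarrow> (complex \<times> 's) list) \<Rightarrow> 's \<times> nat" where "inj_on \<iota> E" by blast
  then have "inj_on (code \<circ> \<iota>) E" using assms by (meson comp_inj_on inj_on_subset subset_UNIV)
  from H.ex_l2_model[OF E this] obtain I :: "'i set" and J where "H.l2_model I J" by blast
  then interpret M: hilbert_model "Collect V.cseq" "\<lambda>X Y n. X n @ Y n" "\<lambda>c X n. scll c (X n)" V.lip I J
    by unfold_locales
  define \<phi> where "\<phi> a = M.opr (lift (\<alpha> a))" for a
  define c where "c t = M.opr (lift (\<gamma> t))" for t
  have \<phi>J: "\<phi> a (J X) = J (lift (\<alpha> a) X)" if "V.cseq X" for a X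
    unfolding \<phi>_def by (rule M.opr_J[OF bop_lact]) (use that in simp)
  have cJ: "c t (J X) = J (lift (\<gamma> t) X)" if "V.cseq X" "t \<ge> 0" for t X
    unfolding c_def by (rule M.opr_J[OF bop_shft]) (use that in auto)
  have ca: "V.cseq (lift (\<alpha> a) X)" if "V.cseq X" for a X using H.bop_closed[OF bop_lact, of X] that by simp
  have cg: "V.cseq (lift (\<gamma> t) X)" if "V.cseq X" "t \<ge> 0" for t X using H.bop_closed[OF bop_shft, of t X] that by simp
  have obt: "\<exists>X. V.cseq X \<and> f = J X" if "f \<in> l2 I" for f using M.J_surj[OF that] by auto
  have adj: "V.lip (lift (\<alpha> a) X) Y = V.lip X (lift (\<alpha> (cstar a)) Y)" for a X Y
    by (simp add: V.lip_def lift_def lact_adj)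
  have hom: "injective_star_hom I \<phi>" unfolding injective_star_hom_def
  proof (intro conjI allI ballI impI)
    show "bounded_op I (\<phi> a)" for a unfolding \<phi>_def by (rule M.bounded_opr[OF bop_lact])
    show "is_adjoint I (\<phi> a) (\<phi> (cstar a))" for a
      unfolding \<phi>_def by (rule M.is_adjoint_opr[OF bop_lact bop_lact]) (rule adj)
    fix f a b z assume "f \<in> l2 I"
    then obtain X where X: "V.cseq X" "f = J X" using obt by blast
    have "\<phi> (a + b) f = J (\<lambda>n. lift (\<alpha> a) X n @ lift (\<alpha> b) X n)"
      unfolding X(2) \<phi>J[OF X(1)]
    proof (rule M.J_eqI)
      fix Z assume "Z \<in> Collect V.cseq"
      then have Z: "V.cseq Z" by simp
      have "V.lip Z (lift (\<alpha> (a + b)) X) = V.lip Z (\<lambda>n. lift (\<alpha> a) X n @ lift (\<alpha> b) X n)"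
        by (simp add: V.lip_def lift_def lact_add ipl_append_right)
      then show "V.lip Z (lift (\<alpha> (a + b)) X) = V.lip Z (\<lambda>n. lift (\<alpha> a) X n @ lift (\<alpha> b) X n)" .
    qed (use X ca V.cseq_add[OF ca[OF X(1)] ca[OF X(1)]] in auto)
    then show "\<phi> (a + b) f = (\<lambda>i. \<phi> a f i + \<phi> b f i)"
      using X ca by (simp add: \<phi>J M.J_add)
    have "\<phi> (scaleC z a) f = J (\<lambda>n. scll z (lift (\<alpha> a) X n))"
      unfolding X(2) \<phi>J[OF X(1)]
      by (rule M.J_eqI) (use X ca V.cseq_scl[OF ca[OF X(1)]] in \<open>auto simp: V.lip_def lift_def lact_scale ipl_scll_right\<close>)
    then show "\<phi> (scaleC z a) f = (\<lambda>i. z * \<phi> a f i)"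
      using X ca by (simp add: \<phi>J M.J_scl)
    have "lift (\<alpha> (a * b)) X = lift (\<alpha> a) (lift (\<alpha> b) X)" by (simp add: lift_def lact_mult)
    then show "\<phi> (a * b) f = \<phi> a (\<phi> b f)" using X ca by (simp add: \<phi>J)
  next
    fix a assume a: "\<forall>f\<in>l2 I. \<phi> a f = (\<lambda>i. 0)"
    show "a = 0"
    proof (rule ccontr)
      assume "a \<noteq> 0"
      then obtain g where g: "k g (\<alpha> (cstar a * a) g) \<noteq> 0" using faithful by blast
      let ?X = "gen_seq g"
      have X: "V.cseq ?X" using V.cseq_const by (simp add: gen_seq_def)
      have "\<phi> a (J ?X) = (\<lambda>i. 0)" using a X M.J_l2[of ?X] by simp
      then have "J (lift (\<alpha> a) ?X) = (\<lambda>i. 0)" using \<phi>J[OF X, of a] by simp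
      then have "V.lip (lift (\<alpha> a) ?X) (lift (\<alpha> a) ?X) = 0"
        using M.J_inner[of "lift (\<alpha> a) ?X" "lift (\<alpha> a) ?X"] X ca by (simp add: l2_inner_def)
      then have "ipl k (lact a [(1, g)]) (lact a [(1, g)]) = 0" by (simp add: V.lip_def lift_def gen_seq_def)
      then have "ipl k [(1, g)] (lact (cstar a * a) [(1, g)]) = 0" by (simp add: lact_adj lact_mult)
      then show False using g by (simp add: ipl_def mapl_def)
    qed
  qed
  have sg: "op_semigroup I c" unfolding op_semigroup_def
  proof (intro conjI allI ballI impI)
    show "bounded_op I (c t)" if "0 \<le> t" for t unfolding c_def by (rule M.bounded_opr[OF bop_shft[OF that]])
    fix f assume "f \<in> l2 I"
    then obtain X where X: "V.cseq X" "f = J X" using obt by blast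
    have "lift (\<gamma> 0) X = X" by (simp add: lift_def \<gamma>_zero mapl_def)
    then show "c 0 f = f" using X by (simp add: cJ)
    fix s t :: real assume st: "0 \<le> s" "0 \<le> t"
    then have "lift (\<gamma> (s + t)) X = lift (\<gamma> s) (lift (\<gamma> t) X)" by (simp add: lift_def shft_add)
    then show "c (s + t) f = c s (c t f)" using X st cg by (simp add: cJ)
  qed
  have dil: "\<exists>cs. is_adjoint I (c t) cs \<and> (\<forall>b. \<forall>f\<in>l2 I. \<phi> (T t b) f = cs (\<phi> b (c t f)))" if t: "t \<ge> 0" for t
  proof -
    obtain \<Psi> where \<Psi>: "H.bop (sqrt (norm (T t 1))) \<Psi>"
      "\<And>X Y. V.cseq X \<Longrightarrow> V.cseq Y \<Longrightarrow> V.lip (lift (\<gamma> t) X) Y = V.lip X (\<Psi> Y)"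
      using H.ex_adjoint[OF bop_shft[OF t]] by auto
    have "is_adjoint I (c t) (M.opr \<Psi>)"
      unfolding c_def by (rule M.is_adjoint_opr[OF bop_shft[OF t] \<Psi>(1)]) (use \<Psi>(2) in auto)
    moreover have "\<phi> (T t b) f = M.opr \<Psi> (\<phi> b (c t f))" if "f \<in> l2 I" for b f
    proof -
      obtain X where X: "V.cseq X" "f = J X" using obt[OF \<open>f \<in> l2 I\<close>] by blast
      have cc: "V.cseq (lift (\<alpha> b) (lift (\<gamma> t) X))" using X t ca cg by blast
      \<comment> \<open>Tested against Z: the adjoint moves \<Psi> to a translation of Z, and the
        dilation identity removes both translations.\<close>
      have "J (lift (\<alpha> (T t b)) X) = J (\<Psi> (lift (\<alpha> b) (lift (\<gamma> t) X)))"
      proof (rule M.J_eqI)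
        fix Z assume "Z \<in> Collect V.cseq"
        then have Z: "V.cseq Z" by simp
        have "V.lip Z (\<Psi> (lift (\<alpha> b) (lift (\<gamma> t) X))) = V.lip (lift (\<gamma> t) Z) (lift (\<alpha> b) (lift (\<gamma> t) X))"
          using \<Psi>(2)[OF Z cc] by simp
        also have "\<dots> = V.lip Z (lift (\<alpha> (T t b)) X)" by (simp add: V.lip_def lift_def shft_dilates[OF t])
        finally show "V.lip Z (lift (\<alpha> (T t b)) X) = V.lip Z (\<Psi> (lift (\<alpha> b) (lift (\<gamma> t) X)))" by simp
      qed (use X ca H.bop_closed[OF \<Psi>(1), of "lift (\<alpha> b) (lift (\<gamma> t) X)"] cc in auto)
      then show ?thesis using X t cg cc M.opr_J[OF \<Psi>(1)] by (simp add: \<phi>J cJ)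
    qed
    ultimately show ?thesis by blast
  qed
  have "strongly_continuous_op_sg I c"
    if Tc: "strongly_continuous_sg T" and T0: "T 0 = id" and gens: "\<forall>g. cont_at [(1, g)]"
    unfolding strongly_continuous_op_sg_def
  proof (intro ballI allI impI)
    fix f and t :: real assume "f \<in> l2 I" and t: "t \<ge> 0"
    then obtain X where X: "V.cseq X" "f = J X" using obt by blast
    have "l2_norm I (\<lambda>i. c s f i - c t f i) = H.nrm (H.sub (lift (\<gamma> s) X) (lift (\<gamma> t) X))" if "s \<ge> 0" for s
      using M.J_norm[of "H.sub (lift (\<gamma> s) X) (lift (\<gamma> t) X)"] M.J_sub[of "lift (\<gamma> s) X" "lift (\<gamma> t) X"]
        H.sub_closed[of "lift (\<gamma> s) X" "lift (\<gamma> t) X"] X cg that t by (simp add: cJ)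
    then have "\<forall>\<^sub>F s in at t within {0..}. H.nrm (H.sub (lift (\<gamma> s) X) (lift (\<gamma> t) X)) = l2_norm I (\<lambda>i. c s f i - c t f i)"
      by (auto simp: eventually_at intro!: exI[of _ 1])
    then show "((\<lambda>s. l2_norm I (\<lambda>i. c s f i - c t f i)) \<longlongrightarrow> 0) (at t within {0..})"
      using lift_continuous[OF Tc T0 _ X(1) t] gens by (auto elim: Lim_transform_eventually[rotated])
  qed
  with hom sg dil show ?thesis unfolding elementary_dilation_def by blast
qed

end

section \<open>The product system of a CP-semigroup\<close>

text \<open>Reality of the quadratic form implies hermitian symmetry: weights 1, 1 compare imaginary
  parts, and weights 1, i compare real parts.\<close>

lemma pd_kernelI:
  assumes real: "\<And>xs. Im (ipl k xs xs) = 0 \<and> 0 \<le> Re (ipl k xs xs)"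
  shows "pd_kernel k"
proof
  fix s t
  have ss: "Im (k s s) = 0" for s using real[of "[(1, s)]"] by (simp add: ipl_def)
  have "Im (k s t) + Im (k t s) = 0"
    using real[of "[(1, s), (1, t)]"] ss[of s] ss[of t] by (simp add: ipl_def)
  moreover have "Re (k s t) = Re (k t s)"
    using real[of "[(1, s), (\<i>, t)]"] ss[of s] ss[of t] by (simp add: ipl_def)
  ultimately show "k t s = cnj (k s t)" by (simp add: complex_eq_iff)
qed (use real in blast)

lemma pos_functional_add: "pos_functional \<omega> \<Longrightarrow> \<omega> (x + y) = \<omega> x + \<omega> y"
  and pos_functional_scale: "pos_functional \<omega> \<Longrightarrow> \<omega> (scaleC c x) = c * \<omega> x"
  by (simp_all add: pos_functional_def)

lemma pos_functional_zero: "pos_functional \<omega> \<Longrightarrow> \<omega> 0 = 0"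
  using pos_functional_add[of \<omega> 0 0] by simp

lemma pos_functional_sum: "pos_functional \<omega> \<Longrightarrow> \<omega> (sum f A) = (\<Sum>i\<in>A. \<omega> (f i))"
  by (induction A rule: infinite_finite_induct) (simp_all add: pos_functional_zero pos_functional_add)

lemma pos_functional_tendsto:
  assumes "pos_functional \<omega>" "(f \<longlongrightarrow> l) F" shows "((\<lambda>x. \<omega> (f x)) \<longlongrightarrow> \<omega> l) F"
proof -
  obtain K where K: "\<And>x. cmod (\<omega> x) \<le> K * norm x" using assms(1) by (auto simp: pos_functional_def)
  have "bounded_linear \<omega>"
    by (rule bounded_linear_intro[where K = K])
      (use assms(1) K in \<open>auto simp: pos_functional_add scaleR_scaleC pos_functional_scale scaleR_conv_of_real mult.commute\<close>)
  then show ?thesis using assms(2) by (rule bounded_linear.tendsto)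
qed

text \<open>With y_k the sum of z_i Y_ki, the double sum collapses to the sum of \<omega>(y_k^*
  y_k).\<close>

lemma pos_functional_matrix:
  fixes n m :: nat
  assumes "pos_functional \<omega>" "\<And>i j. i < n \<Longrightarrow> j < n \<Longrightarrow> B i j = (\<Sum>k<m. cstar (Y k i) * Y k j)"
  shows "\<exists>r\<ge>0. (\<Sum>i<n. \<Sum>j<n. cnj (z i) * z j * \<omega> (B i j)) = complex_of_real r"
proof -
  define y where "y k = (\<Sum>i<n. scaleC (z i) (Y k i))" for k
  have "\<forall>k. \<exists>r\<ge>0. \<omega> (cstar (y k) * y k) = complex_of_real r" using assms(1) by (simp add: pos_functional_def)
  then obtain r where r: "\<And>k. r k \<ge> 0" "\<And>k. \<omega> (cstar (y k) * y k) = complex_of_real (r k)" by metis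
  have e: "(\<Sum>i<n. \<Sum>j<n. cnj (z i) * z j * \<omega> (cstar (Y k i) * Y k j)) = \<omega> (cstar (y k) * y k)" for k
    unfolding y_def
    by (simp add: cstar_sum cstar_scaleC sum_product pos_functional_sum[OF assms(1)] mult_scaleC_left mult_scaleC_right
        pos_functional_scale[OF assms(1)] mult.assoc mult.left_commute)
  have "(\<Sum>i<n. \<Sum>j<n. cnj (z i) * z j * \<omega> (B i j)) =
    (\<Sum>i<n. \<Sum>j<n. \<Sum>k<m. cnj (z i) * z j * \<omega> (cstar (Y k i) * Y k j))"
    by (intro sum.cong refl) (simp add: assms pos_functional_sum sum_distrib_left)
  also have "\<dots> = (\<Sum>i<n. \<Sum>k<m. \<Sum>j<n. cnj (z i) * z j * \<omega> (cstar (Y k i) * Y k j))"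
    by (intro sum.cong refl sum.swap)
  also have "\<dots> = (\<Sum>k<m. \<Sum>i<n. \<Sum>j<n. cnj (z i) * z j * \<omega> (cstar (Y k i) * Y k j))"
    by (rule sum.swap)
  also have "\<dots> = complex_of_real (\<Sum>k<m. r k)" by (simp add: e r)
  finally show ?thesis using r(1) by (intro exI[of _ "\<Sum>k<m. r k"]) (simp add: sum_nonneg)
qed

text \<open>Iterates the rule <\<xi>_t b, A \<xi>_t c> = b^* T_t(A) c along a list of times.
  \<open>q\<close> is the time reached so far and \<open>A\<close> the inner product accumulated up
  to it.\<close>

fun merge :: "(real \<Rightarrow> 'a \<Rightarrow> 'a) \<Rightarrow> (real \<Rightarrow> 'a) \<Rightarrow> (real \<Rightarrow> 'a) \<Rightarrow> real \<Rightarrow> 'a \<Rightarrow> real list \<Rightarrow> 'a::unital_cstar_algebra" where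
  "merge T u v q A [] = A"
| "merge T u v q A (p # ps) = merge T u v p (cstar (u p) * T (p - q) A * v p) ps"

definition supp :: "(real \<Rightarrow> 'a::unital_cstar_algebra) \<Rightarrow> real set" where
  "supp u = {p. u p \<noteq> 1}"

text \<open>The word \<xi>_t u: no letter occurs before time t, and the letters of u follow with
  delay t.\<close>

definition shift :: "real \<Rightarrow> (real \<Rightarrow> 'a) \<Rightarrow> real \<Rightarrow> 'a::unital_cstar_algebra" where
  "shift t u = (\<lambda>p. if p < t then 1 else u (p - t))"

definition act :: "'a \<Rightarrow> (real \<Rightarrow> 'a) \<Rightarrow> real \<Rightarrow> 'a::unital_cstar_algebra" where
  "act b u = u(0 := b * u 0)"

lemma merge_append: "merge T u v q A (ps @ [p]) = cstar (u p) * T (p - last (q # ps)) (merge T u v q A ps) * v p"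
  by (induction ps arbitrary: q A) auto

lemma merge_cong:
  "(\<And>p. p \<in> set ps \<Longrightarrow> u p = u' p \<and> v p = v' p) \<Longrightarrow> merge T u v q A ps = merge T u' v' q A ps"
  by (induction ps arbitrary: q A) auto

lemma merge_shift:
  "(\<And>p. p \<in> set ps \<Longrightarrow> p \<ge> 0) \<Longrightarrow> merge T (shift t u) (shift t v) (t + q) A (map ((+) t) ps) = merge T u v q A ps"
proof (induction ps arbitrary: q A)
  case (Cons p ps)
  have "p \<ge> 0" using Cons.prems by simp
  then have "shift t u (t + p) = u p" "shift t v (t + p) = v p" by (simp_all add: shift_def)
  then show ?case using Cons.IH Cons.prems by simp
qed simp

lemma sorted_le_last: "sorted xs \<Longrightarrow> x \<in> set xs \<Longrightarrow> x \<le> last xs"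
  by (induction xs) auto

lemma sorted_list_of_set_shift:
  assumes "finite P" shows "sorted_list_of_set ((+) (t::real) ` P) = map ((+) t) (sorted_list_of_set P)"
proof (rule sorted_distinct_set_unique)
  show "sorted (map ((+) t) (sorted_list_of_set P))"
    unfolding sorted_map by (rule sorted_wrt_mono_rel[OF _ sorted_sorted_list_of_set]) auto
qed (use assms in \<open>auto simp: distinct_map\<close>)

lemma sorted_0_Cons: "finite P \<Longrightarrow> P \<subseteq> {0..s::real} \<Longrightarrow> sorted (0 # sorted_list_of_set P)"
  by auto

section \<open>Inner products of words\<close>

locale cp_sg =
  fixes T :: "real \<Rightarrow> 'a::unital_cstar_algebra \<Rightarrow> 'a"
  assumes cp: "cp_semigroup T"
begin

lemma T_cp: "t \<ge> 0 \<Longrightarrow> completely_positive (T t)"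
  and T_zero: "T 0 = id"
  and T_sum: "s \<ge> 0 \<Longrightarrow> t \<ge> 0 \<Longrightarrow> T (s + t) A = T s (T t A)"
  using cp by (auto simp: cp_semigroup_def)

lemma T_add: "t \<ge> 0 \<Longrightarrow> T t (x + y) = T t x + T t y"
  and T_scale: "t \<ge> 0 \<Longrightarrow> T t (scaleC c x) = scaleC c (T t x)"
  using T_cp by (auto simp: completely_positive_def clinear_map_def)

lemma T_sum_right: assumes "t \<ge> 0" shows "T t (sum f S) = (\<Sum>i\<in>S. T t (f i))"
proof -
  have "T t 0 = 0" using T_add[OF assms, of 0 0] by simp
  then show ?thesis by (induction S rule: infinite_finite_induct) (simp_all add: T_add assms)
qed

lemma T_psd:
  assumes "t \<ge> 0"
  shows "\<exists>Y :: nat \<Rightarrow> nat \<Rightarrow> 'a. \<forall>i<n. \<forall>j<n. (\<Sum>k<n. T t (cstar (X k i) * X k j)) = (\<Sum>k<n. cstar (Y k i) * Y k j)"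
  using T_cp[OF assms, unfolded completely_positive_def, THEN conjunct2, THEN spec[of _ n], THEN spec[of _ X]] .

lemma T_one_sa: assumes "t \<ge> 0" shows "cstar (T t 1) = T t 1"
proof -
  obtain Y :: "nat \<Rightarrow> nat \<Rightarrow> 'a" where "T t 1 = cstar (Y 0 0) * Y 0 0"
    using T_psd[OF assms, of 1 "\<lambda>_ _. 1"] by auto
  then show ?thesis by (simp add: cstar_mult cstar_cstar)
qed

text \<open>A time with trivial letters merely splits one step, and \<open>T\<close> is a semigroup.
  It must not exceed the last time, since that would append a further application of
  \<open>T\<close>.\<close>

lemma merge_insort:
  assumes "sorted (q # ps)" "ps \<noteq> []" "u p0 = 1" "v p0 = 1" "q \<le> p0" "p0 \<le> last ps"
  shows "merge T u v q A (insort p0 ps) = merge T u v q A ps"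
  using assms
proof (induction ps arbitrary: q A)
  case (Cons p ps)
  show ?case
  proof (cases "p0 \<le> p")
    case True
    have "T (p - q) A = T (p - p0) (T (p0 - q) A)"
      using T_sum[of "p - p0" "p0 - q" A] True Cons.prems by simp
    then show ?thesis using True Cons.prems by simp
  next
    case False
    then have "ps \<noteq> []" using Cons.prems by auto
    then show ?thesis using Cons False by simp
  qed
qed simp

lemma merge_superset:
  assumes "finite D" "finite P" "s \<in> P" "P \<subseteq> {0..s}" "D \<subseteq> {0..s}"
    and "\<And>p. p \<in> D \<Longrightarrow> p \<notin> P \<Longrightarrow> u p = 1 \<and> v p = 1"
  shows "merge T u v 0 A (sorted_list_of_set (P \<union> D)) = merge T u v 0 A (sorted_list_of_set P)"
  using assms(1,5,6)
proof (induction D rule: finite_induct)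
  case (insert x D)
  show ?case
  proof (cases "x \<in> P")
    case True
    then show ?thesis using insert by (simp add: insert_absorb)
  next
    case False
    let ?ps = "sorted_list_of_set (P \<union> D)"
    have f: "finite (P \<union> D)" "x \<notin> P \<union> D" using insert assms False by auto
    have "s \<in> set ?ps" using f(1) assms by simp
    then have ne: "?ps \<noteq> []" by auto
    then have "s \<le> last ?ps" using \<open>s \<in> set ?ps\<close> by (intro sorted_le_last) auto
    moreover have "sorted (0 # ?ps)" using f(1) assms insert by auto
    ultimately have "merge T u v 0 A (insort x ?ps) = merge T u v 0 A ?ps"
      using insert.prems(1) insert.prems(2)[of x] False ne by (intro merge_insort) simp_all
    moreover have "sorted_list_of_set (P \<union> insert x D) = insort x ?ps"
      using f by simp
    ultimately show ?thesis using insert.IH insert.prems by simp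
  qed
qed simp

text \<open>\<open>K s A u v\<close> is the inner product of \<open>u\<close> and \<open>A v\<close> in the correspondence at time \<open>s\<close> of the
  product system of the semigroup. A word \<open>b\<^sub>0 \<xi>\<^sub>t\<^sub>1 b\<^sub>1 \<xi>\<^sub>t\<^sub>2 b\<^sub>2 \<dots>\<close> is encoded as the function with
  value \<open>b\<^sub>i\<close> at time \<open>t\<^sub>1 + \<dots> + t\<^sub>i\<close> and \<open>1\<close> elsewhere, so that two words always have a common refinement.\<close>

definition K :: "real \<Rightarrow> 'a \<Rightarrow> (real \<Rightarrow> 'a) \<Rightarrow> (real \<Rightarrow> 'a) \<Rightarrow> 'a" where
  "K s A u v = merge T u v 0 A (sorted_list_of_set ((supp u \<union> supp v) \<inter> {0..s} \<union> {0, s}))"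

text \<open>Any admissible finite set of times and the standard one are both compared with their
  union, which refines each of them by trivial letters. The endpoint s has to be present, as it
  fixes the total time.\<close>

lemma K_eq:
  assumes "finite P" "P \<subseteq> {0..s}" "s \<in> P" "(supp u \<union> supp v) \<inter> {0..s} \<subseteq> P" "s \<ge> 0"
  shows "K s A u v = merge T u v 0 A (sorted_list_of_set P)"
proof -
  let ?Q = "(supp u \<union> supp v) \<inter> {0..s} \<union> {0, s}"
  have "?Q \<subseteq> P \<union> {0, s}" using assms(4) by blast
  then have fQ: "finite ?Q" by (rule finite_subset) (use assms(1) in simp)
  have "merge T u v 0 A (sorted_list_of_set (?Q \<union> P)) = K s A u v"
    unfolding K_def by (rule merge_superset) (use assms fQ in \<open>auto simp: supp_def\<close>)
  moreover have "merge T u v 0 A (sorted_list_of_set (P \<union> ?Q)) = merge T u v 0 A (sorted_list_of_set P)"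
    by (rule merge_superset) (use assms fQ in \<open>auto simp: supp_def\<close>)
  ultimately show ?thesis by (simp add: Un_commute)
qed

lemma sorted_list_of_set_0:
  assumes "finite P" "P \<subseteq> {0..s}" "(0::real) \<in> P"
  shows "sorted_list_of_set P = 0 # sorted_list_of_set (P - {0})"
proof -
  have "sorted_list_of_set (insert 0 P) = insort 0 (sorted_list_of_set (P - {0}))"
    using assms by (simp add: sorted_list_of_set_insert_remove)
  also have "\<dots> = 0 # sorted_list_of_set (P - {0})"
    by (rule insort_is_Cons) (use assms in auto)
  finally show ?thesis using assms by (simp add: insert_absorb)
qed

definition pts :: "real \<Rightarrow> (real \<Rightarrow> 'a) \<Rightarrow> (real \<Rightarrow> 'a) \<Rightarrow> real set" where
  "pts s u v = (supp u \<union> supp v) \<inter> {0..s} \<union> {0, s}"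

lemma pts: "finite (supp u) \<Longrightarrow> finite (supp v) \<Longrightarrow> finite (pts s u v)"
  "0 \<le> s \<Longrightarrow> pts s u v \<subseteq> {0..s}" "0 \<in> pts s u v" "s \<in> pts s u v"
  by (auto simp: pts_def)

text \<open>Since \<open>T 0 = id\<close>, the letters at time 0 enclose \<open>A\<close> directly.
  Left multiplication changes just these letters, so it can be moved into \<open>A\<close>.\<close>

lemma K_Cons:
  assumes "finite (supp u)" "finite (supp v)" "s \<ge> 0"
  shows "K s A u v = merge T u v 0 (cstar (u 0) * A * v 0) (sorted_list_of_set (pts s u v - {0}))"
  unfolding K_def pts_def[symmetric]
  by (subst sorted_list_of_set_0[OF pts(1,2,3)]) (use assms in \<open>auto simp: T_zero\<close>)

lemma supp_act: "supp (act b u) \<subseteq> insert 0 (supp u)" "supp u - {0} \<subseteq> supp (act b u)"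
  by (auto simp: supp_def act_def)

lemma finite_supp_act: "finite (supp (act b u)) \<longleftrightarrow> finite (supp u)"
  proof
  assume "finite (supp (act b u))"
  then show "finite (supp u)" using finite_subset[OF supp_act(2)[of u b]] by simp
next
  assume "finite (supp u)"
  then show "finite (supp (act b u))" using finite_subset[OF supp_act(1)[of b u]] by simp
qed

lemma K_act_right:
  assumes "finite (supp u)" "finite (supp v)" "s \<ge> 0" shows "K s A u (act b v) = K s (A * b) u v"
proof -
  have "K s A u (act b v) = merge T u (act b v) 0 A (sorted_list_of_set (pts s u v))"
    by (rule K_eq) (use assms pts(1)[OF assms(1,2)] supp_act(1)[of b v] in \<open>auto simp: pts_def\<close>)
  also have "\<dots> = merge T u (act b v) 0 (cstar (u 0) * A * act b v 0) (sorted_list_of_set (pts s u v - {0}))"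
    by (subst sorted_list_of_set_0[OF pts(1,2,3)]) (use assms in \<open>auto simp: T_zero\<close>)
  also have "\<dots> = merge T u v 0 (cstar (u 0) * A * act b v 0) (sorted_list_of_set (pts s u v - {0}))"
    by (rule merge_cong) (use assms pts(1) in \<open>auto simp: act_def\<close>)
  also have "\<dots> = K s (A * b) u v" using assms by (simp add: K_Cons act_def mult.assoc)
  finally show ?thesis .
qed

lemma K_act_left:
  assumes "finite (supp u)" "finite (supp v)" "s \<ge> 0" shows "K s A (act b u) v = K s (cstar b * A) u v"
proof -
  have "K s A (act b u) v = merge T (act b u) v 0 A (sorted_list_of_set (pts s u v))"
    by (rule K_eq) (use assms pts(1)[OF assms(1,2)] supp_act(1)[of b u] in \<open>auto simp: pts_def\<close>)
  also have "\<dots> = merge T (act b u) v 0 (cstar (act b u 0) * A * v 0) (sorted_list_of_set (pts s u v - {0}))"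
    by (subst sorted_list_of_set_0[OF pts(1,2,3)]) (use assms in \<open>auto simp: T_zero\<close>)
  also have "\<dots> = merge T u v 0 (cstar (act b u 0) * A * v 0) (sorted_list_of_set (pts s u v - {0}))"
    by (rule merge_cong) (use assms pts(1) in \<open>auto simp: act_def\<close>)
  also have "\<dots> = K s (cstar b * A) u v" using assms by (simp add: K_Cons act_def mult.assoc cstar_mult)
  finally show ?thesis .
qed

lemma merge_add:
  "sorted (q # ps) \<Longrightarrow> merge T u v q (A + B) ps = merge T u v q A ps + merge T u v q B ps"
  by (induction ps arbitrary: q A B) (simp_all add: T_add algebra_simps)

lemma merge_scale:
  "sorted (q # ps) \<Longrightarrow> merge T u v q (scaleC c A) ps = scaleC c (merge T u v q A ps)"
  by (induction ps arbitrary: q A) (simp_all add: T_scale mult_scaleC_left mult_scaleC_right)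

lemma sorted_pts:
  assumes "finite (supp u)" "finite (supp v)" "s \<ge> 0" shows "sorted (0 # sorted_list_of_set (pts s u v))"
  using pts(1)[OF assms(1,2), of s] pts(2)[OF assms(3), of u v] by auto

lemma K_add:
  assumes "finite (supp u)" "finite (supp v)" "s \<ge> 0" shows "K s (A + B) u v = K s A u v + K s B u v"
  unfolding K_def pts_def[symmetric] by (rule merge_add[OF sorted_pts[OF assms]])

lemma K_scale:
  assumes "finite (supp u)" "finite (supp v)" "s \<ge> 0" shows "K s (scaleC c A) u v = scaleC c (K s A u v)"
  unfolding K_def pts_def[symmetric] by (rule merge_scale[OF sorted_pts[OF assms]])

lemma supp_shift: "supp (shift t u) \<subseteq> (+) t ` supp u"
proof
  fix p assume "p \<in> supp (shift t u)"
  then have "p - t \<in> supp u" by (auto simp: supp_def shift_def split: if_splits)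
  then show "p \<in> (+) t ` supp u" by (force simp: image_iff)
qed

text \<open>The first letters of the shifted words sit at time t, which is reached from 0 by one
  application of T_t; thereafter only differences of times matter. This is the source of the
  dilation identity.\<close>

lemma K_shift:
  assumes "finite (supp u)" "finite (supp v)" "s \<ge> 0" "t \<ge> 0"
  shows "K (s + t) A (shift t u) (shift t v) = K s (T t A) u v"
proof -
  have P: "finite (pts s u v)" "pts s u v \<subseteq> {0..s}" using pts assms by auto
  have sub: "(supp (shift t u) \<union> supp (shift t v)) \<inter> {0..s + t} \<subseteq> (+) t ` pts s u v"
  proof
    fix p assume p: "p \<in> (supp (shift t u) \<union> supp (shift t v)) \<inter> {0..s + t}"
    then have "p \<ge> t" "p - t \<in> supp u \<union> supp v" "p \<le> s + t"
      by (auto simp: supp_def shift_def split: if_splits)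
    then have "p - t \<in> pts s u v" by (auto simp: pts_def)
    then show "p \<in> (+) t ` pts s u v" by (force simp: image_iff)
  qed
  have "K (s + t) A (shift t u) (shift t v)
    = merge T (shift t u) (shift t v) 0 A (sorted_list_of_set ((+) t ` pts s u v))"
    by (rule K_eq) (use P sub assms pts(4)[of s u v] in \<open>auto simp: image_iff\<close>)
  also have "\<dots> = merge T (shift t u) (shift t v) 0 A (map ((+) t) (0 # sorted_list_of_set (pts s u v - {0})))"
    using P pts(3) by (subst sorted_list_of_set_shift[OF P(1)], subst sorted_list_of_set_0[OF P]) auto
  also have "\<dots> = merge T (shift t u) (shift t v) (t + 0) (cstar (u 0) * T t A * v 0)
      (map ((+) t) (sorted_list_of_set (pts s u v - {0})))" by (simp add: shift_def)
  also have "\<dots> = merge T u v 0 (cstar (u 0) * T t A * v 0) (sorted_list_of_set (pts s u v - {0}))"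
    by (rule merge_shift) (use P in auto)
  also have "\<dots> = K s (T t A) u v" using assms by (simp add: K_Cons)
  finally show ?thesis .
qed

text \<open>With no letter after m, a single step T_(s - m) is left. Inner products thus depend on s
  through the semigroup applied to a fixed element, which makes integrability accessible.\<close>

lemma K_extend:
  assumes "finite (supp u)" "finite (supp v)" "supp u \<subseteq> {0..m}" "supp v \<subseteq> {0..m}" "0 \<le> m" "m \<le> s"
  shows "K s A u v = T (s - m) (K m A u v)"
proof (cases "s = m")
  case True
  then show ?thesis by (simp add: T_zero)
next
  case False
  let ?P = "pts m u v"
  have P: "finite ?P" "?P \<subseteq> {0..m}" "m \<in> ?P" using assms pts by auto
  have sm: "s > m" using False assms by simp
  have l: "sorted_list_of_set (?P \<union> {s}) = sorted_list_of_set ?P @ [s]"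
  proof -
    have "s \<notin> ?P" using P sm by auto
    then have "sorted_list_of_set (insert s ?P) = insort s (sorted_list_of_set ?P)" using P(1) by simp
    also have "\<dots> = sorted_list_of_set ?P @ [s]"
      by (rule sorted_insort_is_snoc) (use P sm in auto)
    finally show ?thesis by simp
  qed
  have last: "last (0 # sorted_list_of_set ?P) = m"
  proof -
    have ne: "sorted_list_of_set ?P \<noteq> []" using P by auto
    have "m \<le> last (sorted_list_of_set ?P)" by (rule sorted_le_last) (use P in auto)
    moreover have "last (sorted_list_of_set ?P) \<in> ?P" using last_in_set[OF ne] P(1) by simp
    then have "last (sorted_list_of_set ?P) \<le> m" using P(2) by auto
    ultimately show ?thesis using ne by simp
  qed
  have "u s = 1" "v s = 1" using assms sm by (auto simp: supp_def)
  moreover have "K s A u v = merge T u v 0 A (sorted_list_of_set (?P \<union> {s}))"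
    by (rule K_eq) (use assms P sm in \<open>auto simp: pts_def\<close>)
  ultimately show ?thesis unfolding l merge_append last by (simp add: K_def pts_def)
qed

text \<open>Complete positivity preserves the form of a Gram matrix at each step, and the letters at
  p are absorbed into its factors on the right.\<close>

lemma merge_psd:
  assumes "sorted (q # ps)" "\<And>i j. i < n \<Longrightarrow> j < n \<Longrightarrow> A i j = (\<Sum>k<n. cstar (X k i) * X k j)"
  shows "\<exists>Y :: nat \<Rightarrow> nat \<Rightarrow> 'a. \<forall>i<n. \<forall>j<n. merge T (u i) (u j) q (A i j) ps = (\<Sum>k<n. cstar (Y k i) * Y k j)"
  using assms
proof (induction ps arbitrary: q A X)
  case Nil
  then show ?case by (intro exI[of _ X]) simp
next
  case (Cons p ps)
  have pq: "p - q \<ge> 0" using Cons.prems by simp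
  obtain Y :: "nat \<Rightarrow> nat \<Rightarrow> 'a" where Y: "\<And>i j. i < n \<Longrightarrow> j < n \<Longrightarrow> (\<Sum>k<n. T (p - q) (cstar (X k i) * X k j)) = (\<Sum>k<n. cstar (Y k i) * Y k j)"
    using T_psd[OF pq, of n X] by blast
  have "cstar (u i p) * T (p - q) (A i j) * u j p = (\<Sum>k<n. cstar (Y k i * u i p) * (Y k j * u j p))"
    if ij: "i < n" "j < n" for i j
  proof -
    have "T (p - q) (A i j) = (\<Sum>k<n. cstar (Y k i) * Y k j)"
      using Cons.prems(2)[OF ij] Y[OF ij] by (simp add: T_sum_right[OF pq])
    then show ?thesis by (simp add: cstar_mult sum_distrib_left sum_distrib_right mult.assoc)
  qed
  moreover have "sorted (p # ps)" using Cons.prems by simp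
  ultimately show ?case using Cons.IH[of p "\<lambda>i j. cstar (u i p) * T (p - q) (A i j) * u j p" "\<lambda>k i. Y k i * u i p"] by simp
qed

lemma K_psd:
  fixes u :: "nat \<Rightarrow> real \<Rightarrow> 'a"
  assumes \<omega>: "pos_functional \<omega>" and s: "s \<ge> 0" and fin: "\<And>i. i < n \<Longrightarrow> finite (supp (u i))"
  shows "\<exists>r\<ge>0. (\<Sum>i<n. \<Sum>j<n. cnj (z i) * z j * \<omega> (K s 1 (u i) (u j))) = complex_of_real r"
proof -
  let ?P = "(\<Union>i<n. supp (u i)) \<inter> {0..s} \<union> {0, s}"
  have "finite (\<Union>i<n. supp (u i))" using fin by simp
  then have fP: "finite ?P" by simp
  have K: "K s 1 (u i) (u j) = merge T (u i) (u j) 0 1 (sorted_list_of_set ?P)" if "i < n" "j < n" for i j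
    by (rule K_eq) (use that fP s in auto)
  \<comment> \<open>The recursion starts from the matrix with all entries 1, the Gram matrix of a
    square matrix with ones in its first row and zeros elsewhere.\<close>
  have one: "(1::'a) = (\<Sum>k<n. cstar (if k = 0 then 1 else 0) * (if k = 0 then 1 else 0))" if "0 < n"
  proof -
    have "(\<Sum>k<n. cstar (if k = 0 then 1 else 0) * (if k = 0 then 1 else (0::'a))) = (\<Sum>k<n. if k = 0 then 1 else 0)"
      by (rule sum.cong) auto
    then show ?thesis using that by simp
  qed
  have srt: "sorted (0 # sorted_list_of_set ?P)" by (rule sorted_0_Cons[OF fP, of s]) (use s in auto)
  have "\<exists>Y :: nat \<Rightarrow> nat \<Rightarrow> 'a. \<forall>i<n. \<forall>j<n.
      merge T (u i) (u j) 0 ((\<lambda>_ _. 1) i j) (sorted_list_of_set ?P) = (\<Sum>k<n. cstar (Y k i) * Y k j)"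
    by (rule merge_psd[OF srt, where X = "\<lambda>k i. if k = 0 then 1 else 0"], rule one) linarith
  then obtain Y :: "nat \<Rightarrow> nat \<Rightarrow> 'a" where
    "\<And>i j. i < n \<Longrightarrow> j < n \<Longrightarrow> merge T (u i) (u j) 0 1 (sorted_list_of_set ?P) = (\<Sum>k<n. cstar (Y k i) * Y k j)"
    by blast
  then show ?thesis by (intro pos_functional_matrix[OF \<omega>, where m = n and Y = Y]) (simp add: K)
qed

lemma K_trivial: assumes "s \<ge> 0" shows "K s A (\<lambda>_. 1) (\<lambda>_. 1) = T s A"
proof -
  have "K s A (\<lambda>_. 1) (\<lambda>_. 1) = merge T (\<lambda>_. 1) (\<lambda>_. 1) 0 A (sorted_list_of_set {s})"
    by (rule K_eq) (use assms in \<open>auto simp: supp_def\<close>)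
  then show ?thesis by simp
qed

end

section \<open>The Fock space\<close>

type_synonym 'a gen = "('a \<Rightarrow> complex) \<times> (real \<Rightarrow> 'a) \<times> real \<times> real"

lemma shift_shift: "s \<ge> 0 \<Longrightarrow> t \<ge> 0 \<Longrightarrow> shift (s + t) u = shift s (shift t u)"
  by (auto simp: shift_def fun_eq_iff algebra_simps)

lemma shift_zero: "supp u \<subseteq> {0..a} \<Longrightarrow> shift 0 u = u"
  by (force simp: shift_def supp_def fun_eq_iff)

lemma integrable_sum_list:
  fixes f :: "'i \<Rightarrow> 'x \<Rightarrow> complex"
  shows "(\<And>i. i \<in> set xs \<Longrightarrow> integrable M (f i)) \<Longrightarrow> integrable M (\<lambda>s. \<Sum>i\<leftarrow>xs. f i s)"
  by (induction xs) auto

lemma integral_sum_list: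
  fixes f :: "'i \<Rightarrow> 'x \<Rightarrow> complex"
  shows "(\<And>i. i \<in> set xs \<Longrightarrow> integrable M (f i)) \<Longrightarrow>
    (\<integral>s. (\<Sum>i\<leftarrow>xs. f i s) \<partial>M) = (\<Sum>i\<leftarrow>xs. \<integral>s. f i s \<partial>M)"
  by (induction xs) (auto simp: integrable_sum_list)

lemma ex_nonneg_sum:
  assumes "\<And>x. x \<in> S \<Longrightarrow> \<exists>r\<ge>0. f x = complex_of_real r"
  shows "\<exists>r\<ge>0. sum f S = complex_of_real r"
proof -
  have *: "f x = complex_of_real (Re (f x))" "0 \<le> Re (f x)" if "x \<in> S" for x using assms[OF that] by auto
  then have "sum f S = complex_of_real (\<Sum>x\<in>S. Re (f x))"
    unfolding of_real_sum by (intro sum.cong refl) blast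
  moreover have "0 \<le> (\<Sum>x\<in>S. Re (f x))" by (intro sum_nonneg *)
  ultimately show ?thesis by blast
qed

text \<open>The generator \<open>(\<omega>, u, a, b)\<close> stands for the section that is \<open>u\<close> on \<open>{a..b}\<close> and \<open>0\<close> elsewhere.\<close>

locale fock_kernel = cp_sg T for T :: "real \<Rightarrow> 'a::unital_cstar_algebra \<Rightarrow> 'a" +
  fixes \<mu> :: "real measure" and W :: "(real \<times> real) set"
  assumes translate: "\<And>f :: real \<Rightarrow> complex. (\<integral>s. f s \<partial>\<mu>) = (\<integral>s. f (s + t) \<partial>\<mu>)"
    and W_shift: "(a, b) \<in> W \<Longrightarrow> t \<ge> 0 \<Longrightarrow> (a + t, b + t) \<in> W"
    and W_nonneg: "(a, b) \<in> W \<Longrightarrow> 0 \<le> a"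
    and integrable: "(a, b) \<in> W \<Longrightarrow> (a', b') \<in> W \<Longrightarrow> pos_functional \<omega> \<Longrightarrow>
      integrable \<mu> (\<lambda>s. indicator {max a a'..min b b'} s * \<omega> (T (s - max a a') x))"
    and separating: "x \<noteq> 0 \<Longrightarrow> \<exists>\<omega> a b. pos_functional \<omega> \<and> (a, b) \<in> W \<and>
      (\<integral>s. indicator {a..b} s * \<omega> (T s (cstar x * x)) \<partial>\<mu>) \<noteq> 0"
begin

text \<open>All letters occur no later than the start a of the interval, so at a time s in it the
  section is the word up to a followed by \<xi>_(s - a).\<close>

definition valid :: "'a gen \<Rightarrow> bool" where
  "valid g \<longleftrightarrow> (case g of (\<omega>, u, a, b) \<Rightarrow> pos_functional \<omega> \<and> finite (supp u) \<and> supp u \<subseteq> {0..a} \<and> (a, b) \<in> W)"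

fun kdens :: "'a \<Rightarrow> 'a gen \<Rightarrow> 'a gen \<Rightarrow> real \<Rightarrow> complex" where
  "kdens A (\<omega>, u, a, b) (\<omega>', u', a', b') s =
     (if \<omega> = \<omega>' then indicator {max a a'..min b b'} s * \<omega> (K s A u u') else 0)"

text \<open>Generators form a full type, so invalid ones cannot be excluded; value 0 turns them into
  null vectors.\<close>

definition kint :: "'a \<Rightarrow> 'a gen \<Rightarrow> 'a gen \<Rightarrow> complex" where
  "kint A g h = (if valid g \<and> valid h then \<integral>s. kdens A g h s \<partial>\<mu> else 0)"

fun lmul :: "'a \<Rightarrow> 'a gen \<Rightarrow> 'a gen" where
  "lmul x (\<omega>, u, a, b) = (\<omega>, act x u, a, b)"

text \<open>Invalid generators stay fixed because the law for time 0 must hold for all of them,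
  whereas \<open>shift 0\<close> would erase letters at negative times.\<close>

definition translation :: "real \<Rightarrow> 'a gen \<Rightarrow> 'a gen" where
  "translation t g = (if valid g then case g of (\<omega>, u, a, b) \<Rightarrow> (\<omega>, shift t u, a + t, b + t) else g)"

text \<open>On the common interval, \<open>K_extend\<close> from its left end reduces the density to
  the integrand in the hypothesis \<open>integrable\<close>.\<close>

lemma integrable_kdens:
  assumes "valid g" "valid h" shows "Bochner_Integration.integrable \<mu> (kdens A g h)"
proof -
  obtain \<omega> u a b \<omega>' u' a' b' where gh: "g = (\<omega>, u, a, b)" "h = (\<omega>', u', a', b')"
    by (metis prod_cases4)
  have v: "pos_functional \<omega>" "finite (supp u)" "finite (supp u')" "supp u \<subseteq> {0..a}" "supp u' \<subseteq> {0..a'}"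
    "(a, b) \<in> W" "(a', b') \<in> W" using assms by (auto simp: gh valid_def)
  have "kdens A g h s = (if \<omega> = \<omega>' then indicator {max a a'..min b b'} s * \<omega> (T (s - max a a') (K (max a a') A u u')) else 0)" for s
  proof (cases "s \<in> {max a a'..min b b'}")
    case True
    have "K s A u u' = T (s - max a a') (K (max a a') A u u')"
    proof (rule K_extend[OF v(2,3)])
      show "supp u \<subseteq> {0..max a a'}" by (rule order_trans[OF v(4)]) simp
      show "supp u' \<subseteq> {0..max a a'}" by (rule order_trans[OF v(5)]) simp
    qed (use True W_nonneg[OF v(6)] in auto)
    then show ?thesis by (simp add: gh)
  qed (simp add: gh)
  then have "kdens A g h = (\<lambda>s. if \<omega> = \<omega>' then indicator {max a a'..min b b'} s * \<omega> (T (s - max a a') (K (max a a') A u u')) else 0)"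
    by (rule ext)
  then show ?thesis using integrable[OF v(6,7,1)] by (cases "\<omega> = \<omega>'") simp_all
qed

lemma valid_lmul: "valid (lmul x g) \<longleftrightarrow> valid g"
proof -
  obtain \<omega> u a b where g: "g = (\<omega>, u, a, b)" by (metis prod_cases4)
  have "supp (act x u) \<subseteq> {0..a} \<longleftrightarrow> supp u \<subseteq> {0..a}" if "0 \<le> a"
    using supp_act(1)[of x u] supp_act(2)[of u x] that by fastforce
  then show ?thesis using W_nonneg by (auto simp: g valid_def finite_supp_act)
qed

lemma supp_shift_subset: "supp u \<subseteq> {0..a} \<Longrightarrow> t \<ge> 0 \<Longrightarrow> supp (shift t u) \<subseteq> {0..a + t}"
  using supp_shift[of t u] by fastforce

lemma valid_trans: "t \<ge> 0 \<Longrightarrow> valid (translation t g) \<longleftrightarrow> valid g"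
proof -
  assume t: "t \<ge> 0"
  obtain \<omega> u a b where g: "g = (\<omega>, u, a, b)" by (metis prod_cases4)
  have "finite (supp (shift t u))" if "finite (supp u)" using finite_subset[OF supp_shift] that by blast
  then show ?thesis using t supp_shift_subset[of u a t] W_shift[of a b t] by (auto simp: translation_def valid_def g)
qed

lemma validD:
  assumes "valid (\<omega>, u, a, b)" shows "pos_functional \<omega>" "finite (supp u)" "0 \<le> a"
  using assms W_nonneg[of a b] by (simp_all add: valid_def)

lemma validD2:
  assumes "valid g \<and> valid h" "g = (\<omega>, u, a, b)" "h = (\<omega>', u', a', b')" "s \<in> {max a a'..min b b'}"
  shows "0 \<le> s" "finite (supp u)" "finite (supp u')" "pos_functional \<omega>"
proof -
  have v: "valid (\<omega>, u, a, b)" "valid (\<omega>', u', a', b')" using assms by simp_all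
  show "finite (supp u)" "finite (supp u')" "pos_functional \<omega>" using validD[OF v(1)] validD[OF v(2)] by blast+
  have "a \<le> s" using assms(4) by simp
  then show "0 \<le> s" using validD(3)[OF v(1)] by linarith
qed

lemma kint_lmul_right: "kint A g (lmul x h) = kint (A * x) g h"
proof -
  obtain \<omega> u a b \<omega>' u' a' b' where gh: "g = (\<omega>, u, a, b)" "h = (\<omega>', u', a', b')"
    by (metis prod_cases4)
  have "kdens A g (lmul x h) s = kdens (A * x) g h s" if "valid g" "valid h" for s
  proof (cases "s \<in> {max a a'..min b b'}")
    case True
    from True have "s \<in> {max a a'..min b b'}" .
    note * = validD2[OF conjI[OF that] gh this]
    show ?thesis using K_act_right[OF *(2,3,1)] by (simp add: gh)
  qed (simp add: gh)
  then show ?thesis by (simp add: kint_def valid_lmul cong: if_cong)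
qed

lemma kint_lmul_left: "kint A (lmul x g) h = kint (cstar x * A) g h"
proof -
  obtain \<omega> u a b \<omega>' u' a' b' where gh: "g = (\<omega>, u, a, b)" "h = (\<omega>', u', a', b')"
    by (metis prod_cases4)
  have "kdens A (lmul x g) h s = kdens (cstar x * A) g h s" if "valid g" "valid h" for s
  proof (cases "s \<in> {max a a'..min b b'}")
    case True
    from True have "s \<in> {max a a'..min b b'}" .
    note * = validD2[OF conjI[OF that] gh this]
    show ?thesis using K_act_left[OF *(2,3,1)] by (simp add: gh)
  qed (simp add: gh)
  then show ?thesis by (simp add: kint_def valid_lmul cong: if_cong)
qed

lemma kint_add: "kint (A + B) g h = kint A g h + kint B g h"
proof (cases "valid g \<and> valid h")
  case True
  obtain \<omega> u a b \<omega>' u' a' b' where gh: "g = (\<omega>, u, a, b)" "h = (\<omega>', u', a', b')"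
    by (metis prod_cases4)
  have "kdens (A + B) g h s = kdens A g h s + kdens B g h s" for s
  proof (cases "s \<in> {max a a'..min b b'}")
    case s: True
    from s have "s \<in> {max a a'..min b b'}" .
    note * = validD2[OF True gh this]
    show ?thesis using *(4) by (auto simp: gh K_add[OF *(2,3,1)] pos_functional_add ring_distribs)
  qed (simp add: gh)
  then have "kdens (A + B) g h = (\<lambda>s. kdens A g h s + kdens B g h s)" by (rule ext)
  then show ?thesis using True by (simp add: kint_def integrable_kdens)
qed (auto simp: kint_def)

lemma kint_scale: "kint (scaleC c A) g h = c * kint A g h"
proof (cases "valid g \<and> valid h")
  case True
  obtain \<omega> u a b \<omega>' u' a' b' where gh: "g = (\<omega>, u, a, b)" "h = (\<omega>', u', a', b')"
    by (metis prod_cases4)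
  have "kdens (scaleC c A) g h s = c * kdens A g h s" for s
  proof (cases "s \<in> {max a a'..min b b'}")
    case s: True
    from s have "s \<in> {max a a'..min b b'}" .
    note * = validD2[OF True gh this]
    show ?thesis using *(4) by (auto simp: gh K_scale[OF *(2,3,1)] pos_functional_scale)
  qed (simp add: gh)
  then have "kdens (scaleC c A) g h = (\<lambda>s. c * kdens A g h s)" by (rule ext)
  then show ?thesis using True by (simp add: kint_def)
qed (auto simp: kint_def)

text \<open>Translation invariance of the integral moves the common interval back by t, and
  \<open>K_shift\<close> is applied at each time.\<close>

lemma kint_trans:
  assumes t: "t \<ge> 0" shows "kint A (translation t g) (translation t h) = kint (T t A) g h"
proof (cases "valid g \<and> valid h")
  case True
  obtain \<omega> u a b \<omega>' u' a' b' where gh: "g = (\<omega>, u, a, b)" "h = (\<omega>', u', a', b')"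
    by (metis prod_cases4)
  have tg: "translation t g = (\<omega>, shift t u, a + t, b + t)" "translation t h = (\<omega>', shift t u', a' + t, b' + t)"
    using True by (auto simp: translation_def gh)
  have "kdens A (translation t g) (translation t h) (s + t) = kdens (T t A) g h s" for s
  proof (cases "s \<in> {max a a'..min b b'}")
    case s: True
    from s have "s \<in> {max a a'..min b b'}" .
    note * = validD2[OF True gh this]
    have "K (s + t) A (shift t u) (shift t u') = K s (T t A) u u'" by (rule K_shift[OF *(2,3,1) t])
    moreover have "s + t \<in> {max (a + t) (a' + t)..min (b + t) (b' + t)}" using s by auto
    ultimately show ?thesis using s unfolding tg unfolding gh by simp
  next
    case False
    then have "s + t \<notin> {max (a + t) (a' + t)..min (b + t) (b' + t)}" by auto
    then show ?thesis using False unfolding tg unfolding gh by simp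
  qed
  then show ?thesis using True t translate[of "kdens A (translation t g) (translation t h)" t]
    by (simp add: kint_def valid_trans)
qed (use t in \<open>auto simp: kint_def valid_trans\<close>)

text \<open>At a fixed time the form is a direct sum over the functionals that occur, and each
  summand is positive by \<open>K_psd\<close>.\<close>

lemma kdens_psd:
  assumes "\<And>g. g \<in> snd ` set xs \<Longrightarrow> valid g"
  shows "\<exists>r\<ge>0. (\<Sum>p\<leftarrow>xs. \<Sum>q\<leftarrow>xs. cnj (fst p) * fst q * kdens 1 (snd p) (snd q) s) = complex_of_real r"
proof -
  define n where "n = length xs"
  define z where "z i = fst (xs ! i)" for i
  define w where "w i = fst (snd (xs ! i))" for i
  define u where "u i = fst (snd (snd (xs ! i)))" for i
  define a where "a i = fst (snd (snd (snd (xs ! i))))" for i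
  define b where "b i = snd (snd (snd (snd (xs ! i))))" for i
  have x: "xs ! i = (z i, w i, u i, a i, b i)" for i by (simp add: z_def w_def u_def a_def b_def)
  have v: "pos_functional (w i)" "finite (supp (u i))" "0 \<le> a i" if "i < n" for i
  proof -
    have "valid (snd (xs ! i))" using that by (intro assms imageI nth_mem) (simp add: n_def)
    then show "pos_functional (w i)" "finite (supp (u i))" "0 \<le> a i" using W_nonneg by (auto simp: x valid_def)
  qed
  \<comment> \<open>The weight of the i-th generator if it belongs to the summand of \<omega> and
    its interval contains s, and 0 otherwise; this absorbs both case distinctions of
    \<open>kdens\<close>.\<close>
  define c where "c \<omega> i = (if w i = \<omega> \<and> s \<in> {a i..b i} then z i else 0)" for \<omega> i
  have "(\<Sum>p\<leftarrow>xs. \<Sum>q\<leftarrow>xs. cnj (fst p) * fst q * kdens 1 (snd p) (snd q) s)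
      = (\<Sum>i<n. \<Sum>j<n. cnj (z i) * z j * kdens 1 (w i, u i, a i, b i) (w j, u j, a j, b j) s)"
    by (simp add: sum_list_sum_nth x n_def atLeast0LessThan)
  also have "\<dots> = (\<Sum>i<n. \<Sum>j<n. \<Sum>\<omega>\<in>w ` {..<n}. cnj (c \<omega> i) * c \<omega> j * \<omega> (K s 1 (u i) (u j)))"
  proof (intro sum.cong refl)
    fix i j assume ij: "i \<in> {..<n}" "j \<in> {..<n}"
    have "(\<Sum>\<omega>\<in>w ` {..<n}. cnj (c \<omega> i) * c \<omega> j * \<omega> (K s 1 (u i) (u j)))
       = (\<Sum>\<omega>\<in>w ` {..<n}. if \<omega> = w i then cnj (c \<omega> i) * c \<omega> j * \<omega> (K s 1 (u i) (u j)) else 0)"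
      by (intro sum.cong) (auto simp: c_def)
    also have "\<dots> = cnj (c (w i) i) * c (w i) j * w i (K s 1 (u i) (u j))" using ij by simp
    also have "\<dots> = cnj (z i) * z j * kdens 1 (w i, u i, a i, b i) (w j, u j, a j, b j) s"
      by (auto simp: c_def indicator_def)
    finally show "cnj (z i) * z j * kdens 1 (w i, u i, a i, b i) (w j, u j, a j, b j) s
       = (\<Sum>\<omega>\<in>w ` {..<n}. cnj (c \<omega> i) * c \<omega> j * \<omega> (K s 1 (u i) (u j)))" by simp
  qed
  also have "\<dots> = (\<Sum>i<n. \<Sum>\<omega>\<in>w ` {..<n}. \<Sum>j<n. cnj (c \<omega> i) * c \<omega> j * \<omega> (K s 1 (u i) (u j)))"
    by (intro sum.cong refl sum.swap)
  also have "\<dots> = (\<Sum>\<omega>\<in>w ` {..<n}. \<Sum>i<n. \<Sum>j<n. cnj (c \<omega> i) * c \<omega> j * \<omega> (K s 1 (u i) (u j)))"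
    by (rule sum.swap)
  finally have e: "(\<Sum>p\<leftarrow>xs. \<Sum>q\<leftarrow>xs. cnj (fst p) * fst q * kdens 1 (snd p) (snd q) s)
      = (\<Sum>\<omega>\<in>w ` {..<n}. \<Sum>i<n. \<Sum>j<n. cnj (c \<omega> i) * c \<omega> j * \<omega> (K s 1 (u i) (u j)))" .
  show ?thesis
  proof (cases "s \<ge> 0")
    case True
    have "\<exists>r\<ge>0. (\<Sum>i<n. \<Sum>j<n. cnj (c \<omega> i) * c \<omega> j * \<omega> (K s 1 (u i) (u j))) = complex_of_real r"
      if "\<omega> \<in> w ` {..<n}" for \<omega>
      by (rule K_psd[OF _ True]) (use that v in auto)
    then show ?thesis unfolding e by (rule ex_nonneg_sum)
  next
    case False
    \<comment> \<open>Intervals start at or after 0, so no generator is present at a negative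
      time.\<close>
    have "c \<omega> i = 0" if "i < n" for \<omega> i using False v(3)[OF that] by (auto simp: c_def)
    then show ?thesis unfolding e by (intro exI[of _ 0]) simp
  qed
qed

text \<open>After discarding invalid generators, the form is the integral of the pointwise forms,
  each real and nonnegative.\<close>

lemma kint_psd: "Im (ipl (kint 1) xs xs) = 0 \<and> 0 \<le> Re (ipl (kint 1) xs xs)"
proof -
  define ys where "ys = filter (\<lambda>p. valid (snd p)) xs"
  have red: "(\<Sum>p\<leftarrow>xs. if valid (snd p) then f p else 0) = (\<Sum>p\<leftarrow>ys. f p)" for f :: "complex \<times> 'a gen \<Rightarrow> complex"
    unfolding ys_def by (induction xs) auto
  define F where "F s = (\<Sum>p\<leftarrow>ys. \<Sum>q\<leftarrow>ys. cnj (fst p) * fst q * kdens 1 (snd p) (snd q) s)" for s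
  have v: "valid (snd p)" if "p \<in> set ys" for p using that by (simp add: ys_def)
  have int: "Bochner_Integration.integrable \<mu> (\<lambda>s. cnj (fst p) * fst q * kdens 1 (snd p) (snd q) s)"
    if "p \<in> set ys" "q \<in> set ys" for p q
    using integrable_kdens[OF v[OF that(1)] v[OF that(2)], of 1] by simp
  have iF: "Bochner_Integration.integrable \<mu> F" unfolding F_def by (intro integrable_sum_list int)
  have "ipl (kint 1) xs xs = (\<Sum>p\<leftarrow>xs. if valid (snd p) then (\<Sum>q\<leftarrow>xs. if valid (snd q) then
      cnj (fst p) * fst q * (\<integral>s. kdens 1 (snd p) (snd q) s \<partial>\<mu>) else 0) else 0)"
    unfolding ipl_def kint_def by (intro arg_cong[of _ _ sum_list] map_cong refl) (auto intro!: arg_cong[of _ _ sum_list])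
  also have "\<dots> = (\<Sum>p\<leftarrow>ys. \<Sum>q\<leftarrow>ys. cnj (fst p) * fst q * (\<integral>s. kdens 1 (snd p) (snd q) s \<partial>\<mu>))"
    by (simp only: red)
  also have "\<dots> = (\<Sum>p\<leftarrow>ys. \<Sum>q\<leftarrow>ys. \<integral>s. cnj (fst p) * fst q * kdens 1 (snd p) (snd q) s \<partial>\<mu>)" by simp
  also have "\<dots> = (\<integral>s. F s \<partial>\<mu>)"
    unfolding F_def by (subst integral_sum_list, intro integrable_sum_list int, assumption+)
      (intro arg_cong[of _ _ sum_list] map_cong refl, rule integral_sum_list[symmetric], intro int)
  finally have e: "ipl (kint 1) xs xs = (\<integral>s. F s \<partial>\<mu>)" .
  have "\<exists>r\<ge>0. F s = complex_of_real r" for s unfolding F_def by (rule kdens_psd) (use v in auto)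
  then have F: "Im (F s) = 0" "0 \<le> Re (F s)" for s by (metis Im_complex_of_real Re_complex_of_real)+
  have "Im (\<integral>s. F s \<partial>\<mu>) = (\<integral>s. Im (F s) \<partial>\<mu>)" "Re (\<integral>s. F s \<partial>\<mu>) = (\<integral>s. Re (F s) \<partial>\<mu>)"
    using iF by simp_all
  then show ?thesis unfolding e using F by (simp add: integral_nonneg)
qed

sublocale dilation_kernel "kint 1" T lmul translation
proof (intro dilation_kernel.intro dilation_kernel_axioms.intro)
  show "pd_kernel (kint 1)" by (rule pd_kernelI) (rule kint_psd)
next
  fix t :: real assume "t \<ge> 0" then show "cstar (T t 1) = T t 1" by (rule T_one_sa)
next
  fix x y and g :: "'a gen"
  show "lmul (x * y) g = lmul x (lmul y g)" by (cases g rule: prod_cases4) (simp add: act_def mult.assoc)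
  show "lmul 1 g = g" by (cases g rule: prod_cases4) (simp add: act_def)
  fix h :: "'a gen" and c
  show "kint 1 (lmul x g) h = kint 1 g (lmul (cstar x) h)" by (simp add: kint_lmul_left kint_lmul_right)
  show "kint 1 g (lmul (x + y) h) = kint 1 g (lmul x h) + kint 1 g (lmul y h)"
    by (simp add: kint_lmul_right kint_add)
  show "kint 1 g (lmul (scaleC c x) h) = c * kint 1 g (lmul x h)"
    by (simp add: kint_lmul_right kint_scale)
next
  fix g :: "'a gen"
  obtain \<omega> u a b where g: "g = (\<omega>, u, a, b)" by (metis prod_cases4)
  show "translation 0 g = g" using shift_zero[of u a] by (auto simp: g translation_def valid_def)
  fix s t :: real assume st: "s \<ge> 0" "t \<ge> 0"
  show "translation (s + t) g = translation s (translation t g)"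
  proof (cases "valid g")
    case True
    then have "valid (translation t g)" using valid_trans st by simp
    then show ?thesis using True st by (simp add: translation_def g shift_shift split: if_splits)
  qed (simp add: translation_def)
next
  fix t :: real and x and g h :: "'a gen" assume "t \<ge> 0"
  then show "kint 1 (translation t g) (lmul x (translation t h)) = kint 1 g (lmul (T t x) h)"
    by (simp add: kint_lmul_right kint_trans)
next
  fix x :: 'a assume "x \<noteq> 0"
  then obtain \<omega> a b where *: "pos_functional \<omega>" "(a, b) \<in> W"
      "(\<integral>s. indicator {a..b} s * \<omega> (T s (cstar x * x)) \<partial>\<mu>) \<noteq> 0"
    using separating by blast
  \<comment> \<open>On the trivial word, inner products at time s reduce to \<omega>(T_s(A)), so
    faithfulness becomes the separation hypothesis.\<close>
  let ?g = "(\<omega>, \<lambda>_. 1, a, b) :: 'a gen"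
  have v: "valid ?g" using * by (simp add: valid_def supp_def)
  have kd: "kdens (cstar x * x) ?g ?g s = indicator {a..b} s * \<omega> (T s (cstar x * x))" for s
    using W_nonneg[OF *(2)] by (cases "s \<in> {a..b}") (auto simp: K_trivial)
  have "kint 1 ?g (lmul (cstar x * x) ?g) = kint (cstar x * x) ?g ?g" by (simp only: kint_lmul_right mult_1)
  also have "\<dots> = (\<integral>s. indicator {a..b} s * \<omega> (T s (cstar x * x)) \<partial>\<mu>)"
    by (simp only: kint_def kd v simp_thms if_True)
  finally have "kint 1 ?g (lmul (cstar x * x) ?g) \<noteq> 0" using *(3) by simp
  then show "\<exists>g. kint 1 g (lmul (cstar x * x) g) \<noteq> 0" by blast
qed

text \<open>Logarithmic time on the positive half-line leaves room for the other data of a generator.\<close>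

definition code :: "'a gen \<times> nat \<Rightarrow> real \<Rightarrow> 'a \<Rightarrow> 'a" where
  "code = (\<lambda>((\<omega>, u, a, b), n) t x. if t > 0 then u (ln t) else if t = 0 then scaleC (\<omega> x) 1
     else if t = -1 then a *\<^sub>R 1 else if t = -2 then b *\<^sub>R 1 else real n *\<^sub>R 1)"

lemma scaleC_one_inject: "scaleC c (1::'a) = scaleC d 1 \<longleftrightarrow> c = d"
proof
  assume "scaleC c (1::'a) = scaleC d 1"
  then have "scaleC (c - d) (1::'a) = 0" using scaleC_add_left[of "c - d" d "1::'a"] by simp
  then have "cmod (c - d) = 0" using norm_scaleC[of "c - d" "1::'a"] by simp
  then show "c = d" by simp
qed simp

lemma inj_code: "inj code"
proof (rule injI)
  fix g h :: "'a gen \<times> nat" assume e: "code g = code h"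
  obtain \<omega> u a b n where g: "g = ((\<omega>, u, a, b), n)" by (metis prod.exhaust prod_cases4)
  obtain \<omega>' u' a' b' n' where h: "h = ((\<omega>', u', a', b'), n')" by (metis prod.exhaust prod_cases4)
  have E: "code ((\<omega>, u, a, b), n) t x = code ((\<omega>', u', a', b'), n') t x" for t x using e by (simp add: g h)
  have "u p = u' p" for p using E[of "exp p" 0] by (simp add: code_def)
  moreover have "\<omega> x = \<omega>' x" for x using E[of 0 x] by (simp add: code_def scaleC_one_inject)
  moreover have "a = a'" using E[of "-1" 0] by (simp add: code_def)
  moreover have "b = b'" using E[of "-2" 0] by (simp add: code_def)
  moreover have "n = n'" using E[of "-3" 0] by (simp add: code_def)
  ultimately show "g = h" by (simp add: g h fun_eq_iff)
qed

lemma cont_at_invalid: "\<not> valid g \<Longrightarrow> cont_at [(1, g)]"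
  by (simp add: cont_at_def mapl_def translation_def)

text \<open>Peeling off the first letter of a word reduces continuity to the trivial word.\<close>

lemma cont_at_gen:
  assumes Tc: "strongly_continuous_sg T"
    and W_back: "\<And>a b t. (a, b) \<in> W \<Longrightarrow> 0 \<le> t \<Longrightarrow> t \<le> a \<Longrightarrow> (a - t, b - t) \<in> W"
    and triv: "\<And>\<omega> a b. pos_functional \<omega> \<Longrightarrow> (a, b) \<in> W \<Longrightarrow> cont_at [(1, (\<omega>, \<lambda>_. 1, a, b))]"
  shows "cont_at [(1, g)]"
proof (cases "valid g")
  case True
  obtain \<omega> u a b where g: "g = (\<omega>, u, a, b)" by (metis prod_cases4)
  have "valid (\<omega>, u, a, b) \<Longrightarrow> cont_at [(1, (\<omega>, u, a, b))]" for u a b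
  proof (induction "card (supp u)" arbitrary: u a b rule: less_induct)
    case less
    then have v: "pos_functional \<omega>" "finite (supp u)" "supp u \<subseteq> {0..a}" "(a, b) \<in> W" by (auto simp: valid_def)
    show ?case
    proof (cases "supp u = {}")
      case True
      then have "u = (\<lambda>_. 1)" by (auto simp: supp_def)
      then show ?thesis using triv v by simp
    next
      case False
      define p where "p = Min (supp u)"
      have p: "p \<in> supp u" "\<And>q. q \<in> supp u \<Longrightarrow> p \<le> q" using v(2) False by (auto simp: p_def)
      then have p0: "0 \<le> p" "p \<le> a" using v(3) by auto
      \<comment> \<open>The word after its first letter, moved back to time 0 with that letter
        deleted. Multiplying by u(p) and translating by p restores u, and u' has fewer
        letters.\<close>
      define u' where "u' = (\<lambda>r. if r = 0 then 1 else u (r + p))"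
      have s': "supp u' \<subseteq> (\<lambda>q. q - p) ` (supp u - {p})"
      proof
        fix r assume "r \<in> supp u'"
        then have "r \<noteq> 0" "r + p \<in> supp u" by (auto simp: supp_def u'_def split: if_splits)
        then show "r \<in> (\<lambda>q. q - p) ` (supp u - {p})" by (intro image_eqI[of _ _ "r + p"]) auto
      qed
      have "card (supp u') \<le> card ((\<lambda>q. q - p) ` (supp u - {p}))" using v(2) s' by (intro card_mono) auto
      also have "\<dots> \<le> card (supp u - {p})" using v(2) by (intro card_image_le) auto
      also have "\<dots> < card (supp u)" using v(2) p(1) by (intro psubset_card_mono) auto
      finally have c: "card (supp u') < card (supp u)" .
      have "supp u' \<subseteq> {0..a - p}" using s' v(3) p(2) by force
      moreover have "finite (supp u')" using finite_subset[OF s'] v(2) by simp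
      ultimately have v': "valid (\<omega>, u', a - p, b - p)" using v W_back p0 by (simp add: valid_def)
      let ?g' = "(\<omega>, u', a - p, b - p) :: 'a gen"
      have "cont_at [(1, ?g')]" using less.hyps[OF c v'] .
      then have "cont_at (shft p (lact (u p) [(1, ?g')]))"
        by (intro cont_at_shft[OF Tc T_zero] cont_at_lact[OF Tc T_zero] p0)
      moreover have "shift p (act (u p) u') = u"
      proof
        fix q
        have "u q = 1" if "q < p" using p(2)[of q] that by (force simp: supp_def)
        then show "shift p (act (u p) u') q = u q" by (auto simp: shift_def act_def u'_def)
      qed
      moreover have "valid (lmul (u p) ?g')" using v' by (simp only: valid_lmul)
      ultimately show ?thesis by (simp add: mapl_def translation_def)
    qed
  qed
  then show ?thesis using True by (simp add: g)
qed (rule cont_at_invalid)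

end

section \<open>Sections at single times, with counting measure\<close>

lemma indicator_times: "indicator A s * z = indicator A s *\<^sub>R (z :: complex)"
  by (simp split: split_indicator)

lemma integral_single_point:
  fixes f :: "real \<Rightarrow> complex"
  shows "integrable (count_space UNIV) (\<lambda>s. indicator {a} s * f s)"
    and "(\<integral>s. indicator {a} s * f s \<partial>count_space UNIV) = f a"
proof -
  have e: "(\<lambda>s. indicator {a} s * f s) = (\<lambda>s. indicator {a} s *\<^sub>R f a)"
    by (auto simp: fun_eq_iff split: split_indicator)
  have i: "integrable (count_space UNIV) (indicator {a} :: real \<Rightarrow> real)"
    by (rule integrable_real_indicator) (auto simp: emeasure_count_space_finite)
  show "integrable (count_space UNIV) (\<lambda>s. indicator {a} s * f s)" unfolding e using i by simp
  show "(\<integral>s. indicator {a} s * f s \<partial>count_space UNIV) = f a" unfolding e using i by (simp add: measure_count_space)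
qed

text \<open>Intervals are single points: two of them share one time or none, so every integral is
  one value or 0. The point 0 separates because \<open>T 0 = id\<close>.\<close>

lemma fock_kernel_discrete:
  assumes cp: "cp_semigroup T" shows "fock_kernel T (count_space UNIV) {(a, a) | a. 0 \<le> a}"
proof (intro fock_kernel.intro fock_kernel_axioms.intro)
  show "cp_sg T" using cp by (rule cp_sg.intro)
  then interpret cp_sg T .
  show "(\<integral>s. f s \<partial>count_space UNIV) = (\<integral>s. f (s + t) \<partial>count_space UNIV)" for f :: "real \<Rightarrow> complex" and t
    by (rule integral_bij_count_space[symmetric]) (rule bij_plus_right)
  show "integrable (count_space UNIV) (\<lambda>s. indicator {max a a'..min b b'} s * \<omega> (T (s - max a a') x))"
    if "(a, b) \<in> {(a, a) |a. 0 \<le> a}" "(a', b') \<in> {(a, a) |a. 0 \<le> a}" "pos_functional \<omega>" for a b a' b' \<omega> x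
  proof (cases "a = a'")
    case True
    then show ?thesis using that integral_single_point(1) by simp
  next
    case False
    then have "{max a a'..min b b'} = {}" using that by auto
    then show ?thesis by simp
  qed
  fix x :: 'a assume "x \<noteq> 0"
  then obtain \<omega> where "pos_functional \<omega>" "\<omega> (cstar x * x) \<noteq> 0" using pos_functionals_separate by blast
  then show "\<exists>\<omega> a b. pos_functional \<omega> \<and> (a, b) \<in> {(a, a) |a. 0 \<le> a} \<and>
      (\<integral>s. indicator {a..b} s * \<omega> (T s (cstar x * x)) \<partial>count_space UNIV) \<noteq> 0"
    by (intro exI[of _ \<omega>] exI[of _ 0]) (simp add: integral_single_point(2) T_zero)
qed auto

section \<open>Sections on intervals, with Lebesgue measure\<close>

locale sc_cp_sg = cp_sg T for T :: "real \<Rightarrow> 'a::unital_cstar_algebra \<Rightarrow> 'a" +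
  assumes Tc: "strongly_continuous_sg T"
begin

lemma continuous_functional:
  assumes "pos_functional \<omega>" "0 \<le> m" "c \<le> m" shows "continuous_on {m..b} (\<lambda>s. \<omega> (T (s - c) x))"
proof -
  have c: "continuous_on {0..} (\<lambda>s. T s x)" using Tc by (simp add: strongly_continuous_sg_def)
  have "continuous_on {m..b} (\<lambda>s. T (s - c) x)"
    by (rule continuous_on_compose2[OF c]) (use assms(3) in \<open>auto intro!: continuous_intros\<close>)
  then show ?thesis unfolding continuous_on_def using pos_functional_tendsto[OF assms(1)] by blast
qed

lemma integrable_functional:
  assumes "pos_functional \<omega>" "0 \<le> m" "c \<le> m"
  shows "integrable lborel (\<lambda>s. indicator {m..b} s * \<omega> (T (s - c) x))"
  using borel_integrable_atLeastAtMost'[OF continuous_functional[OF assms]]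
  by (simp add: set_integrable_def indicator_times)

text \<open>Continuity supplies integrability. It also supplies separation: for suitable \<omega>
  the function s \<mapsto> \<omega>(T_s(x^* x)) is positive at 0 and keeps more than half of that
  value nearby, so its integral over a short interval is not 0.\<close>

lemma fock_kernel_lborel: "fock_kernel T lborel {(a, b). 0 \<le> a \<and> a < b}"
proof (intro fock_kernel.intro fock_kernel_axioms.intro)
  show "cp_sg T" ..
  show "(\<integral>s. f s \<partial>lborel) = (\<integral>s. f (s + t) \<partial>lborel)" for f :: "real \<Rightarrow> complex" and t
    using lborel_integral_real_affine[of 1 f t] by (simp add: add.commute)
  show "integrable lborel (\<lambda>s. indicator {max a a'..min b b'} s * \<omega> (T (s - max a a') x))"
    if "(a, b) \<in> {(a, b). 0 \<le> a \<and> a < b}" "(a', b') \<in> {(a, b). 0 \<le> a \<and> a < b}" "pos_functional \<omega>" for a b a' b' \<omega> x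
    by (rule integrable_functional) (use that in auto)
  fix x :: 'a assume "x \<noteq> 0"
  then obtain \<omega> where \<omega>: "pos_functional \<omega>" "\<omega> (cstar x * x) \<noteq> 0" using pos_functionals_separate by blast
  define F where "F s = \<omega> (T s (cstar x * x))" for s
  obtain r where r: "F 0 = complex_of_real r" "r > 0"
    using \<omega> unfolding F_def pos_functional_def T_zero by (metis id_apply of_real_0 order_le_less)
  have "continuous_on {0..1} F" using continuous_functional[OF \<omega>(1), of 0 0 1 "cstar x * x"] by (simp add: F_def)
  then have "((\<lambda>s. Re (F s)) \<longlongrightarrow> Re (F 0)) (at 0 within {0..1})"
    by (intro tendsto_Re) (auto simp: continuous_on_def)
  then have "\<forall>\<^sub>F s in at 0 within {0..1}. r / 2 < Re (F s)"
    by (rule order_tendstoD) (use r in simp)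
  then obtain d where d: "d > 0" "\<And>s. s \<in> {0..1} \<Longrightarrow> s \<noteq> 0 \<Longrightarrow> dist s 0 < d \<Longrightarrow> r / 2 < Re (F s)"
    unfolding eventually_at by blast
  \<comment> \<open>Half of d keeps the closed interval up to e strictly inside the
    neighbourhood.\<close>
  define e where "e = min 1 (d / 2)"
  have e: "e > 0" using d(1) by (simp add: e_def)
  have ge: "r / 2 \<le> Re (F s)" if "s \<in> {0..e}" for s
    using d(2)[of s] that r d(1) by (cases "s = 0") (auto simp: e_def)
  have iF: "integrable lborel (\<lambda>s. indicator {0..e} s * F s)"
    using integrable_functional[OF \<omega>(1), of 0 0 e "cstar x * x"] by (simp add: F_def)
  have "e * (r / 2) = (\<integral>s. indicator {0..e} s * (r / 2) \<partial>lborel)" using e by simp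
  also have "\<dots> \<le> (\<integral>s. Re (indicator {0..e} s * F s) \<partial>lborel)"
  proof (rule integral_mono)
    show "integrable lborel (\<lambda>s. indicator {0..e} s * (r / 2))"
      by (intro integrable_mult_left integrable_real_indicator) (use e in simp_all)
    show "integrable lborel (\<lambda>s. Re (indicator {0..e} s * F s))" using iF by (rule integrable_Re)
    show "indicator {0..e} s * (r / 2) \<le> Re (indicator {0..e} s * F s)" for s
      using ge[of s] by (auto split: split_indicator)
  qed
  also have "\<dots> = Re (\<integral>s. indicator {0..e} s * F s \<partial>lborel)" by (rule integral_Re[OF iF])
  finally have "(\<integral>s. indicator {0..e} s * F s \<partial>lborel) \<noteq> 0" using e r by (metis less_irrefl mult_pos_pos half_gt_zero order_less_le_trans zero_complex.simps(1))
  then show "\<exists>\<omega> a b. pos_functional \<omega> \<and> (a, b) \<in> {(a, b). 0 \<le> a \<and> a < b} \<and>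
      (\<integral>s. indicator {a..b} s * \<omega> (T s (cstar x * x)) \<partial>lborel) \<noteq> 0"
    using \<omega> e by (intro exI[of _ \<omega>] exI[of _ 0] exI[of _ e]) (simp add: F_def)
qed auto

sublocale fock_kernel T lborel "{(a, b). 0 \<le> a \<and> a < b}"
  by (rule fock_kernel_lborel)

text \<open>Expand the square norm of the difference: the translate contributes the form of T_t(1),
  which tends to that of 1, and the cross term tends to the square norm because only a piece of
  length at most t of the interval is lost.\<close>

lemma cont_at_trivial:
  assumes \<omega>: "pos_functional \<omega>" and ab: "0 \<le> a" "a < b"
  shows "cont_at [(1, (\<omega>, \<lambda>_. 1, a, b))]"
proof -
  let ?g = "(\<omega>, \<lambda>_. 1, a, b) :: 'a gen" and ?k = "kint 1"
  let ?x = "[(1, ?g)] :: (complex \<times> 'a gen) list"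
  define F where "F s = \<omega> (T s 1)" for s
  have v: "valid ?g" using assms by (simp add: valid_def supp_def)
  have tg: "translation t ?g = (\<omega>, \<lambda>_. 1, a + t, b + t)" for t
    using v by (auto simp: translation_def shift_def)
  have vt: "valid (\<omega>, \<lambda>_. 1, a + t, b + t)" if "t \<ge> 0" for t
    using valid_trans[OF that, of ?g] v by (simp add: tg)
  have int: "integrable lborel (\<lambda>s. indicator {c..b} s * F s)" if "0 \<le> c" for c
    using integrable_functional[OF \<omega> that, of 0 b 1] that by (simp add: F_def)
  have "continuous_on {a..b} F" using continuous_functional[OF \<omega> ab(1), of 0 b 1] ab by (simp add: F_def)
  then obtain B where B: "\<And>s. s \<in> {a..b} \<Longrightarrow> norm (F s) \<le> B"
    using compact_imp_bounded[OF compact_continuous_image[of "{a..b}" F]] by (force simp: bounded_iff)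
  have B0: "B \<ge> 0" using B[of a] ab norm_ge_zero[of "F a"] by (meson atLeastAtMost_iff less_imp_le order.refl order_trans)
  \<comment> \<open>A translated trivial word is again trivial, so the density at s is
    \<omega>(T_s(1)) for every t; only the overlap of the intervals depends on t.\<close>
  have kg: "?k (translation t ?g) ?g = (\<integral>s. indicator {a + t..b} s * F s \<partial>lborel)" if t: "t \<ge> 0" for t
  proof -
    have "kdens 1 (translation t ?g) ?g s = indicator {a + t..b} s * F s" for s
    proof (cases "s \<in> {a + t..b}")
      case True
      then have "s \<ge> 0" using ab t by simp
      then show ?thesis using t by (simp add: tg F_def K_trivial max_def min_def)
    qed (use t in \<open>simp add: tg max_def min_def\<close>)
    then have "kdens 1 (translation t ?g) ?g = (\<lambda>s. indicator {a + t..b} s * F s)" by (rule ext)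
    moreover have "valid (translation t ?g)" using vt[OF t] by (simp only: tg)
    ultimately show ?thesis using v by (simp only: kint_def simp_thms if_True)
  qed
  have bound: "norm (?k (translation t ?g) ?g - ?k ?g ?g) \<le> B * t" if t: "t \<ge> 0" for t
  proof -
    have "?k ?g ?g = (\<integral>s. indicator {a..b} s * F s \<partial>lborel)" using kg[of 0] by (simp add: \<gamma>_zero)
    then have "?k (translation t ?g) ?g - ?k ?g ?g = (\<integral>s. indicator {a + t..b} s * F s - indicator {a..b} s * F s \<partial>lborel)"
      using kg[OF t] int[of a] int[of "a + t"] ab t by simp
    also have "norm \<dots> \<le> (\<integral>s. indicator {a..a + t} s * B \<partial>lborel)"
    proof (rule Bochner_Integration.integral_norm_bound_integral)
      \<comment> \<open>The integrands differ only at times of \<open>{a..b}\<close> below a + t,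
        where F is bounded by B.\<close>
      show "norm (indicator {a + t..b} s * F s - indicator {a..b} s * F s) \<le> indicator {a..a + t} s * B" for s
        using B[of s] B0 t by (auto split: split_indicator)
    qed (use int[of a] int[of "a + t"] ab t in simp_all)
    also have "\<dots> = B * t" using t by simp
    finally show ?thesis .
  qed
  have cross: "((\<lambda>t. ?k (translation t ?g) ?g) \<longlongrightarrow> ?k ?g ?g) (at_right 0)"
  proof (rule LIM_zero_cancel, rule tendsto_norm_zero_cancel, rule tendsto_sandwich[OF _ _ tendsto_const])
    have "((\<lambda>t. B * t) \<longlongrightarrow> B * 0) (at_right 0)" by (intro tendsto_intros)
    then show "((\<lambda>t. B * t) \<longlongrightarrow> 0) (at_right 0)" by simp
    show "\<forall>\<^sub>F t in at_right 0. norm (?k (translation t ?g) ?g - ?k ?g ?g) \<le> B * t"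
      using bound by (auto simp: eventually_at_right_field intro!: exI[of _ 1])
  qed simp
  have e: "(V.nrm (V.sub (shft t ?x) ?x))\<^sup>2
     = Re (ipl ?k ?x (lact (T t 1) ?x)) - 2 * Re (?k (translation t ?g) ?g) + Re (?k ?g ?g)" if t: "t \<ge> 0" for t
  proof -
    have "ipl ?k (shft t ?x) (shft t ?x) = ipl ?k ?x (lact (T t 1) ?x)"
      using shft_dilates[OF t, of ?x 1 ?x] by (simp only: lact_one)
    moreover have "ipl ?k (shft t ?x) ?x = ?k (translation t ?g) ?g" "ipl ?k ?x ?x = ?k ?g ?g"
      by (simp_all add: ipl_def mapl_def)
    ultimately show ?thesis by (subst V.nrm_sub_sq) (simp_all only: V.nrm_sq UNIV_I)
  qed
  have "((\<lambda>t. Re (ipl ?k ?x (lact (T t 1) ?x)) - 2 * Re (?k (translation t ?g) ?g) + Re (?k ?g ?g)) \<longlongrightarrow>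
      Re (ipl ?k ?x (lact 1 ?x)) - 2 * Re (?k ?g ?g) + Re (?k ?g ?g)) (at_right 0)"
    by (intro tendsto_intros cross lact_form_tendsto[OF Tc T_zero] T_tendsto_0[OF Tc T_zero])
  moreover have "ipl ?k ?x (lact 1 ?x) = ?k ?g ?g" unfolding lact_one by (simp add: ipl_def)
  ultimately have "((\<lambda>t. Re (ipl ?k ?x (lact (T t 1) ?x)) - 2 * Re (?k (translation t ?g) ?g) + Re (?k ?g ?g)) \<longlongrightarrow> 0) (at_right 0)"
    by simp
  then have "((\<lambda>t. (V.nrm (V.sub (shft t ?x) ?x))\<^sup>2) \<longlongrightarrow> 0) (at_right 0)"
    by (rule Lim_transform_eventually) (auto simp only: eventually_at_right_field e less_imp_le intro!: exI[of _ 1])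
  then have "((\<lambda>t. sqrt ((V.nrm (V.sub (shft t ?x) ?x))\<^sup>2)) \<longlongrightarrow> sqrt 0) (at_right 0)" by (rule tendsto_real_sqrt)
  then show ?thesis by (simp add: cont_at_def)
qed

lemma cont_at_generator: "cont_at [(1, g)]"
  by (rule cont_at_gen[OF Tc]) (use cont_at_trivial in auto)

end

theorem theorem3p4:
  fixes T :: "real \<Rightarrow> 'a::unital_cstar_algebra \<Rightarrow> 'a"
  assumes "cp_semigroup T" and "semifaithful T"
  shows "(\<exists>(I :: (real \<Rightarrow> 'a \<Rightarrow> 'a) set) \<phi> c. elementary_dilation T I \<phi> c) \<and>
         (strongly_continuous_sg T \<longrightarrow>
           (\<exists>(I :: (real \<Rightarrow> 'a \<Rightarrow> 'a) set) \<phi> c.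
              elementary_dilation T I \<phi> c \<and> strongly_continuous_op_sg I c))"
proof (intro conjI impI)
  interpret fock_kernel T "count_space UNIV" "{(a, a) | a. 0 \<le> a}" by (rule fock_kernel_discrete[OF assms(1)])
  show "\<exists>(I :: (real \<Rightarrow> 'a \<Rightarrow> 'a) set) \<phi> c. elementary_dilation T I \<phi> c"
    using ex_elementary_dilation[OF inj_code] by blast
next
  assume "strongly_continuous_sg T"
  then interpret sc_cp_sg T using assms(1) by (intro sc_cp_sg.intro cp_sg.intro sc_cp_sg_axioms.intro)
  show "\<exists>(I :: (real \<Rightarrow> 'a \<Rightarrow> 'a) set) \<phi> c. elementary_dilation T I \<phi> c \<and> strongly_continuous_op_sg I c"
    using ex_elementary_dilation[OF inj_code] Tc T_zero cont_at_generator by blast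
qed

end
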